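(* Let $F$ be an inner product distribution on $\mathbb{R}^d$ satisfying Assumption 1 (stated in the context), with $c_d$ the constant in part (iii) of that assumption, and let $m$ be the number of graphs. There exist constants $D,D'>0$ and an integer $\mathfrak{s}''>0$ (depending only on $F$ and $m$), where $D$ is the constant of the out-of-sample error bound (OOS) stated in the context, and a constant $C>0$ independent of $d$, such that the following holds. Let $s,u$ be positive integers with $s\ge \mathfrak{s}''$, let $(\mathbf{A}^{(1)},\dots,\mathbf{A}^{(m)},\mathbf{X})\sim \mathrm{JRDPG}(F,n=s+u,m)$, let $\mathbf{Q}^{(1)},\dots,\mathbf{Q}^{(m)}\in\Pi_u$ be the unknown shuffling permutation matrices, and let $\mathbf{C}^{(i,j)}\in\mathbb{R}^{u\times u}$, $i,j\in[m]$, be the cost matrices computed by OmniMatch with $\lambda=0$ from the observed graphs $\mathbf{B}^{(i)}=(\mathbf{I}_s\oplus\mathbf{Q}^{(i)})\mathbf{A}^{(i)}(\mathbf{I}_s\oplus\mathbf{Q}^{(i)})^T$ (as defined in the context). Then, with probability at least $$1-C\,c_d\,10^d D^d\, m^{d/2}u^2\,\frac{\log^{2d}(ms)}{s^{d/2}}-D'mus^{-2},$$ OmniMatch perfectly aligns the unaligned vertices across all $m$ graphs simultaneously; that is, with at least this probability, for all $i,j\in[m]$, $$\operatorname*{arg\,min}_{\mathbf{Q}\in\Pi_u}\operatorname{tr}(\mathbf{C}^{(i,j)}\mathbf{Q})=\{\mathbf{Q}^{(j)}(\mathbf{Q}^{(i)})^T\}.$$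
   Context: **Notation.** $[n]=\{1,\dots,n\}$; $\Pi_u$ is the set of $u\times u$ permutation matrices; $\mathbf{I}_s$ is the $s\times s$ identity; $\oplus$ is the direct sum of matrices; $\|\cdot\|$ is the Euclidean norm on vectors. **JRDPG.** Let $F$ be a distribution on a set $\mathcal{X}\subset\mathbb{R}^d$ with $\langle x,x'\rangle\in[0,1]$ for all $x,x'\in\mathcal{X}$ (an inner product distribution). $(\mathbf{A}^{(1)},\dots,\mathbf{A}^{(m)},\mathbf{X})\sim\mathrm{JRDPG}(F,n,m)$ means: $X_1,\dots,X_n$ are i.i.d. from $F$ and are the rows of $\mathbf{X}\in\mathbb{R}^{n\times d}$; conditionally on $\mathbf{X}$, the $\mathbf{A}^{(k)}$ are independent symmetric $n\times n$ $0/1$ matrices with zero diagonal, and for each $k$ the entries $A^{(k)}_{ij}$ with $i<j$ are independent Bernoulli$(X_i^TX_j)$. The dimension $d$ and the number of graphs $m$ are fixed. **Assumption 1 on $F$.** (i) There is a constant $\delta>0$ such that $\delta\le x^Ty\le 1-\delta$ for all $x,y\in\mathrm{supp}(F)$. (ii) If $\mathbf{Y}\sim F$ then $\mathbb{E}(\mathbf{Y}\mathbf{Y}^T)$ has rank $d$. (iii) There is a constant $c_d>0$ such that for every $x\in\mathrm{supp}(F)$ and every $r>0$, $\mathbb{P}_F(X\in \mathrm{B}_r(x))\le c_d r^d$, where $\mathrm{B}_r(x)$ is the ball of radius $r$ about $x$. **Seeds and shuffling.** $n=s+u$. The first $s$ vertices $\mathcal{S}$ are seeds (aligned across the graphs);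 the remaining $u$ vertices form $\mathcal{U}$. The observed graphs are $\mathbf{B}^{(i)}=(\mathbf{I}_s\oplus\mathbf{Q}^{(i)})\mathbf{A}^{(i)}(\mathbf{I}_s\oplus\mathbf{Q}^{(i)})^T$ for permutation matrices $\mathbf{Q}^{(i)}\in\Pi_u$. Write $$\mathbf{B}^{(i)}=\begin{bmatrix}\tilde{\mathbf{A}}^{(i)}&\mathbf{B}^{(i)}_{12}\\ \mathbf{B}^{(i)}_{21}&\mathbf{B}^{(i)}_{22}\end{bmatrix}$$ with $\tilde{\mathbf{A}}^{(i)}$ of size $s\times s$. **Embeddings.** For a symmetric matrix $\mathbf{A}$, $\mathrm{ASE}(\mathbf{A},d)=U_AS_A^{1/2}$, where $S_A$ is the diagonal matrix of the $d$ largest eigenvalues of $|\mathbf{A}|=(\mathbf{A}^T\mathbf{A})^{1/2}$ and $U_A$ has the corresponding orthonormal eigenvectors as columns. The omnibus matrix $\mathbf{M}\in\mathbb{R}^{ms\times ms}$ of the seed graphs has $(i,j)$-th $s\times s$ block $(\tilde{\mathbf{A}}^{(i)}+\tilde{\mathbf{A}}^{(j)})/2$, and $\widehat{\mathbf{X}}_M=\mathrm{ASE}(\mathbf{M},d)\in\mathbb{R}^{ms\times d}$; $\widehat{\mathbf{X}}_M^{(i)}\in\mathbb{R}^{s\times d}$ denotes its rows $(i-1)s+1,\dots,is$. **OmniMatch with $\lambda=0$.** The least-squares out-of-sample (OOS) embedding of the unseeded vertices of $\mathbf{B}^{(i)}$ is $$\widehat{\mathbf{Y}}^{(i)}=(\mathbf{B}^{(i)}_{12})^T\widehat{\mathbf{X}}_M^{(i)}\big((\widehat{\mathbf{X}}_M^{(i)})^T\widehat{\mathbf{X}}_M^{(i)}\big)^{-1}\in\mathbb{R}^{u\times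 d},$$ i.e. the minimizer of $\|\mathbf{B}^{(i)}_{12}-\widehat{\mathbf{X}}_M^{(i)}\mathbf{Y}^T\|_F^2$ over $\mathbf{Y}\in\mathbb{R}^{u\times d}$. The cost matrix is $\mathbf{C}^{(i,j)}_{v,w}=\|(\text{row }v\text{ of }\widehat{\mathbf{Y}}^{(i)})-(\text{row }w\text{ of }\widehat{\mathbf{Y}}^{(j)})\|^2$, with $v,w$ indexing the unseeded vertices in the observed (shuffled) order of $\mathbf{B}^{(i)}$ and $\mathbf{B}^{(j)}$ respectively. In the version of the algorithm considered here, the output consists of the solutions of the pairwise linear assignment problems $\operatorname{arg\,min}_{\mathbf{Q}\in\Pi_u}\operatorname{tr}(\mathbf{C}^{(i,j)}\mathbf{Q})$. **Out-of-sample error bound (OOS), fixing the constants $D,D'$.** For $v\in\mathcal{U}$ in the true (unshuffled) labelling, let $\widehat{Y}^{(i)}_v\in\mathbb{R}^d$ be the OOS embedding of vertex $v$ in graph $i$, i.e. the row of $(\mathbf{Q}^{(i)})^T\widehat{\mathbf{Y}}^{(i)}$ corresponding to $v$, and let $X_v$ be the row of $\mathbf{X}$ corresponding to $v$ (as a column vector). The constants $D,D'>0$ are those for which there is an integer $\mathfrak{s}$ (all depending only on $F$ and $m$) such that for $s\ge\mathfrak{s}$ there is a $d\times d$ orthogonal matrix $\mathbf{W}$ (independent of $v$ and $i$) such that for each $v\in\mathcal{U}$, $i\in[m]$, $\|\widehat{Y}^{(i)}_v-\mathbf{W}^TX_v\|\le D\,m^{1/2}\log(ms)/\sqrt{s}$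 with probability at least $1-D's^{-2}$. *)

theory Defs
  imports
    "HOL-Probability.Probability"
    "Jordan_Normal_Form.Gauss_Jordan_Elimination"
    "Jordan_Normal_Form.Char_Poly"
    "Jordan_Normal_Form.DL_Rank"
begin

unbundle no vec_syntax and no inner_syntax

text \<open>
  All dimensions are natural numbers, so that they can be quantified over, and all indices
  start at 0. Matrices are those of \<^theory>\<open>Jordan_Normal_Form.Matrix\<close>. A point of
  \<open>\<real>\<^sup>d\<close> in a sample space is an element \<open>x\<close> of \<open>{..<d} \<rightarrow>\<^sub>E UNIV\<close>, a space that
  carries the product Borel sigma-algebra; the corresponding column vector is \<open>vec d x\<close>.
\<close>

definition vnorm :: "real vec \<Rightarrow> real" where
  "vnorm x = sqrt (x \<bullet> x)"

definition mtrace :: "real mat \<Rightarrow> real" where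
  "mtrace A = (\<Sum>i<dim_row A. A $$ (i, i))"

definition perm_mats :: "nat \<Rightarrow> real mat set" where
  "perm_mats u = {mat u u (\<lambda>(i, j). if \<pi> i = j then 1 else 0) | \<pi>. \<pi> permutes {..<u}}"

definition orthogonal_mats :: "nat \<Rightarrow> real mat set" where
  "orthogonal_mats d = {W \<in> carrier_mat d d. W\<^sup>T * W = 1\<^sub>m d}"


text \<open>Inner product distributions\<close>

abbreviation Rd :: "nat \<Rightarrow> (nat \<Rightarrow> real) measure" where
  "Rd d \<equiv> \<Pi>\<^sub>M a\<in>{..<d}. borel"

definition inner_product_distribution :: "nat \<Rightarrow> (nat \<Rightarrow> real) measure \<Rightarrow> bool" where
  "inner_product_distribution d F \<longleftrightarrow>
     prob_space F \<and> sets F = sets (Rd d) \<and>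
     (\<exists>\<X>. (AE x in F. x \<in> \<X>) \<and> (\<forall>x\<in>\<X>. \<forall>y\<in>\<X>. vec d x \<bullet> vec d y \<in> {0..1}))"

definition Rd_ball :: "nat \<Rightarrow> (nat \<Rightarrow> real) \<Rightarrow> real \<Rightarrow> (nat \<Rightarrow> real) set" where
  "Rd_ball d x r = {y \<in> space (Rd d). vnorm (vec d y - vec d x) < r}"

definition Rd_support :: "nat \<Rightarrow> (nat \<Rightarrow> real) measure \<Rightarrow> (nat \<Rightarrow> real) set" where
  "Rd_support d F = {x \<in> space (Rd d). \<forall>r>0. measure F (Rd_ball d x r) > 0}"

definition second_moment :: "nat \<Rightarrow> (nat \<Rightarrow> real) measure \<Rightarrow> real mat" where
  "second_moment d F = mat d d (\<lambda>(a, b). \<integral>y. y a * y b \<partial>F)"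

definition assumption1 :: "nat \<Rightarrow> (nat \<Rightarrow> real) measure \<Rightarrow> real \<Rightarrow> bool" where
  "assumption1 d F c \<longleftrightarrow>
     (\<exists>\<delta>>0. \<forall>x\<in>Rd_support d F. \<forall>y\<in>Rd_support d F. vec d x \<bullet> vec d y \<in> {\<delta>..1 - \<delta>}) \<and>
     vec_space.rank d (second_moment d F) = d \<and>
     0 < c \<and> (\<forall>x\<in>Rd_support d F. \<forall>r>0. measure F (Rd_ball d x r) \<le> c * r ^ d)"


text \<open>
  The joint law of \<open>m\<close> graphs and the latent positions. A sample is a pair \<open>(E, X)\<close>: the
  Boolean \<open>E (k, i, j)\<close>, for \<open>i < j\<close>, says whether the \<open>k\<close>-th graph has the edge between
  \<open>i\<close> and \<open>j\<close>, and \<open>X i\<close> is the latent position of vertex \<open>i\<close>.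
\<close>

type_synonym sample = "(nat \<times> nat \<times> nat \<Rightarrow> bool) \<times> (nat \<Rightarrow> nat \<Rightarrow> real)"

definition edge_slots :: "nat \<Rightarrow> nat \<Rightarrow> (nat \<times> nat \<times> nat) set" where
  "edge_slots n m = {(k, i, j). k < m \<and> i < j \<and> j < n}"

definition edge_pmf ::
    "nat \<Rightarrow> nat \<Rightarrow> nat \<Rightarrow> (nat \<Rightarrow> nat \<Rightarrow> real) \<Rightarrow> (nat \<times> nat \<times> nat \<Rightarrow> bool) pmf" where
  "edge_pmf d n m X =
     Pi_pmf (edge_slots n m) False (\<lambda>(k, i, j). bernoulli_pmf (vec d (X i) \<bullet> vec d (X j)))"

definition JRDPG :: "nat \<Rightarrow> (nat \<Rightarrow> real) measure \<Rightarrow> nat \<Rightarrow> nat \<Rightarrow> sample measure" where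
  "JRDPG d F n m =
     do {
       X \<leftarrow> (\<Pi>\<^sub>M i\<in>{..<n}. F);
       E \<leftarrow> measure_pmf (edge_pmf d n m X);
       return (count_space UNIV \<Otimes>\<^sub>M (\<Pi>\<^sub>M i\<in>{..<n}. F)) (E, X)
     }"

text \<open>The edge law is a measurable kernel, so the binds above are not degenerate.\<close>

lemma finite_edge_slots: "finite (edge_slots n m)"
  by (rule finite_subset[of _ "{..<m} \<times> {..<n} \<times> {..<n}"]) (auto simp: edge_slots_def)

lemma measurable_edge_pmf:
  assumes F: "sets F = sets (Rd d)"
  shows "(\<lambda>X. measure_pmf (edge_pmf d n m X)) \<in>
    measurable (\<Pi>\<^sub>M i\<in>{..<n}. F) (subprob_algebra (count_space UNIV))"
proof (rule measurable_subprob_algebra)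
  fix T :: "(nat \<times> nat \<times> nat \<Rightarrow> bool) set"
  define S where "S = {f. \<forall>x. x \<notin> edge_slots n m \<longrightarrow> f x = False}"
  have "S = PiE_dflt (edge_slots n m) False (\<lambda>_. UNIV)"
    by (auto simp: S_def PiE_dflt_def)
  hence fin: "finite S"
    by (simp add: finite_edge_slots finite_PiE_dflt)
  have coord: "(\<lambda>X. X i a) \<in> borel_measurable (\<Pi>\<^sub>M i\<in>{..<n}. F)" if "i < n" "a < d" for i a
  proof -
    have "(\<lambda>x. x a) \<in> borel_measurable F"
      using that by (subst measurable_cong_sets[OF F refl]) auto
    thus ?thesis
      using that by (intro measurable_compose[OF measurable_component_singleton[of i]]) auto
  qed
  have em: "emeasure (measure_pmf (edge_pmf d n m X)) T = ennreal (\<Sum>f\<in>T \<inter> S. pmf (edge_pmf d n m X) f)" for X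
  proof -
    have "set_pmf (edge_pmf d n m X) \<subseteq> S"
      unfolding edge_pmf_def S_def by (rule set_Pi_pmf_subset[OF finite_edge_slots])
    hence "emeasure (measure_pmf (edge_pmf d n m X)) T = emeasure (measure_pmf (edge_pmf d n m X)) (T \<inter> S)"
      by (intro emeasure_eq_AE) (auto simp: AE_measure_pmf_iff)
    thus ?thesis
      using fin by (simp add: measure_pmf.emeasure_eq_measure measure_measure_pmf_finite)
  qed
  have "pmf (edge_pmf d n m X) f = (\<Prod>(k, i, j)\<in>edge_slots n m.
      if f (k, i, j) then min 1 (max 0 (\<Sum>a<d. X i a * X j a))
        else 1 - min 1 (max 0 (\<Sum>a<d. X i a * X j a)))" if "f \<in> S" for X f
    using that unfolding edge_pmf_def S_def
    by (subst pmf_Pi'[OF finite_edge_slots])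
       (auto intro!: prod.cong simp: bernoulli_pmf.rep_eq scalar_prod_def atLeast0LessThan)
  moreover have "(\<lambda>X. \<Prod>(k, i, j)\<in>edge_slots n m.
      if f (k, i, j) then min 1 (max 0 (\<Sum>a<d. X i a * X j a))
        else 1 - min 1 (max 0 (\<Sum>a<d. X i a * X j a))) \<in> borel_measurable (\<Pi>\<^sub>M i\<in>{..<n}. F)" for f
  proof (intro borel_measurable_prod)
    fix x assume "x \<in> edge_slots n m"
    then obtain k i j where x: "x = (k, i, j)" "i < n" "j < n"
      by (auto simp: edge_slots_def)
    have [measurable]: "(\<lambda>X. \<Sum>a<d. X i a * X j a) \<in> borel_measurable (\<Pi>\<^sub>M i\<in>{..<n}. F)"
      by (intro borel_measurable_sum borel_measurable_times coord x) auto
    show "(\<lambda>X. case x of (k, i, j) \<Rightarrow>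
        if f (k, i, j) then min 1 (max 0 (\<Sum>a<d. X i a * X j a))
          else 1 - min 1 (max 0 (\<Sum>a<d. X i a * X j a))) \<in> borel_measurable (\<Pi>\<^sub>M i\<in>{..<n}. F)"
      unfolding x prod.case by (cases "f (k, i, j)") simp_all
  qed
  ultimately have "(\<lambda>X. pmf (edge_pmf d n m X) f) \<in> borel_measurable (\<Pi>\<^sub>M i\<in>{..<n}. F)" if "f \<in> S" for f
    using that by simp
  thus "(\<lambda>X. emeasure (measure_pmf (edge_pmf d n m X)) T)
      \<in> borel_measurable (\<Pi>\<^sub>M i\<in>{..<n}. F)"
    unfolding em by (intro measurable_compose[OF _ measurable_ennreal] borel_measurable_sum) auto
qed (auto simp: measure_pmf.subprob_space_axioms)

lemma
  assumes "inner_product_distribution d F"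
  shows prob_space_JRDPG: "prob_space (JRDPG d F n m)"
    and sets_JRDPG: "sets (JRDPG d F n m) = sets (count_space UNIV \<Otimes>\<^sub>M (\<Pi>\<^sub>M i\<in>{..<n}. F))"
proof -
  let ?P = "\<Pi>\<^sub>M i\<in>{..<n}. F"
  interpret F: prob_space F
    using assms by (simp add: inner_product_distribution_def)
  interpret P: product_prob_space "\<lambda>_. F" "{..<n}" by unfold_locales
  note [measurable] = measurable_edge_pmf[of F d n m]
  have [simp]: "sets F = sets (Rd d)"
    using assms by (simp add: inner_product_distribution_def)
  have K: "(\<lambda>X. measure_pmf (edge_pmf d n m X) \<bind> (\<lambda>E. return (count_space UNIV \<Otimes>\<^sub>M ?P) (E, X)))
      \<in> measurable ?P (subprob_algebra (count_space UNIV \<Otimes>\<^sub>M ?P))"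
    by (rule measurable_bind[OF measurable_edge_pmf]) (auto simp: measurable_pair_swap)
  have "X \<in> space ?P \<Longrightarrow> prob_space (measure_pmf (edge_pmf d n m X) \<bind> (\<lambda>E. return (count_space UNIV \<Otimes>\<^sub>M ?P) (E, X)))" for X
    by (rule measure_pmf.prob_space_bind[where S = "count_space UNIV \<Otimes>\<^sub>M ?P"])
       (auto intro!: AE_I2 prob_space_return simp: space_pair_measure measurable_def space_subprob_algebra
          prob_space_return prob_space_imp_subprob_space)
  thus "prob_space (JRDPG d F n m)"
    unfolding JRDPG_def by (intro P.prob_space_bind[OF _ K] AE_I2) auto
  show "sets (JRDPG d F n m) = sets (count_space UNIV \<Otimes>\<^sub>M ?P)"
    unfolding JRDPG_def by (rule sets_bind[OF sets_kernel[OF K]]) (auto simp: space_PiM PiE_eq_empty_iff F.not_empty)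
qed

definition adjacency :: "nat \<Rightarrow> (nat \<times> nat \<times> nat \<Rightarrow> bool) \<Rightarrow> nat \<Rightarrow> real mat" where
  "adjacency n E k =
     mat n n (\<lambda>(i, j). if i \<noteq> j \<and> E (k, min i j, max i j) then 1 else 0)"


text \<open>Adjacency spectral embedding\<close>

definition is_mat_abs :: "real mat \<Rightarrow> real mat \<Rightarrow> bool" where
  "is_mat_abs A P \<longleftrightarrow>
     P \<in> carrier_mat (dim_col A) (dim_col A) \<and> P\<^sup>T = P \<and>
     (\<forall>v\<in>carrier_vec (dim_col A). 0 \<le> v \<bullet> (P *\<^sub>v v)) \<and> P * P = A\<^sup>T * A"

text \<open>
  The columns of \<open>U\<close> are an orthonormal basis of eigenvectors of \<open>P = |A|\<close>, ordered by
  decreasing eigenvalue, so its first \<open>d\<close> columns belong to the \<open>d\<close> largest eigenvalues,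
  counted with multiplicity. The embedding depends on the choice of this basis, whence a
  relation rather than a function.
\<close>

definition is_ASE :: "nat \<Rightarrow> real mat \<Rightarrow> real mat \<Rightarrow> bool" where
  "is_ASE d A Z \<longleftrightarrow>
     (let N = dim_row A in
      \<exists>P U \<sigma>. is_mat_abs A P \<and> U \<in> orthogonal_mats N \<and>
        (\<forall>i<N. eigenvector P (col U i) (\<sigma> i)) \<and>
        (\<forall>i j. i \<le> j \<and> j < N \<longrightarrow> \<sigma> j \<le> \<sigma> i) \<and>
        Z = mat N d (\<lambda>(i, a). U $$ (i, a)) * mat_diag d (\<lambda>a. sqrt (\<sigma> a)))"

definition ASE_choice :: "nat \<Rightarrow> (real mat \<Rightarrow> real mat) \<Rightarrow> bool" where
  "ASE_choice d ase \<longleftrightarrow>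
     (\<forall>N. \<forall>A\<in>carrier_mat N N. A\<^sup>T = A \<and> d \<le> N \<longrightarrow> is_ASE d A (ase A))"


text \<open>
  The matching procedure. Its observed input is the family \<open>B\<close> of shuffled graphs on
  \<open>s + u\<close> vertices.
\<close>

definition shuffle_graph :: "nat \<Rightarrow> nat \<Rightarrow> real mat \<Rightarrow> real mat \<Rightarrow> real mat" where
  "shuffle_graph s u Q A =
     (let P = four_block_mat (1\<^sub>m s) (0\<^sub>m s u) (0\<^sub>m u s) Q in P * A * P\<^sup>T)"

definition seed_block :: "nat \<Rightarrow> real mat \<Rightarrow> real mat" where
  "seed_block s B = (case split_block B s s of (B11, B12, B21, B22) \<Rightarrow> B11)"

definition cross_block :: "nat \<Rightarrow> real mat \<Rightarrow> real mat" where
  "cross_block s B = (case split_block B s s of (B11, B12, B21, B22) \<Rightarrow> B12)"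

definition omnibus :: "nat \<Rightarrow> nat \<Rightarrow> (nat \<Rightarrow> real mat) \<Rightarrow> real mat" where
  "omnibus m s A = mat (m * s) (m * s) (\<lambda>(p, q).
     (A (p div s) $$ (p mod s, q mod s) + A (q div s) $$ (p mod s, q mod s)) / 2)"

definition seed_embedding ::
    "(real mat \<Rightarrow> real mat) \<Rightarrow> nat \<Rightarrow> nat \<Rightarrow> nat \<Rightarrow> (nat \<Rightarrow> real mat) \<Rightarrow> nat \<Rightarrow> real mat" where
  "seed_embedding ase d m s B i =
     (let Z = ase (omnibus m s (\<lambda>k. seed_block s (B k)))
      in mat s d (\<lambda>(p, a). Z $$ (i * s + p, a)))"

definition oos_embedding ::
    "(real mat \<Rightarrow> real mat) \<Rightarrow> nat \<Rightarrow> nat \<Rightarrow> nat \<Rightarrow> (nat \<Rightarrow> real mat) \<Rightarrow> nat \<Rightarrow> real mat" where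
  "oos_embedding ase d m s B i =
     (let Z = seed_embedding ase d m s B i
      in (cross_block s (B i))\<^sup>T * Z * the (mat_inverse (Z\<^sup>T * Z)))"

definition cost_mat ::
    "(real mat \<Rightarrow> real mat) \<Rightarrow> nat \<Rightarrow> nat \<Rightarrow> nat \<Rightarrow> nat \<Rightarrow> (nat \<Rightarrow> real mat) \<Rightarrow> nat \<Rightarrow> nat \<Rightarrow> real mat" where
  "cost_mat ase d m s u B i j = mat u u (\<lambda>(v, w).
     (vnorm (row (oos_embedding ase d m s B i) v - row (oos_embedding ase d m s B j) w))\<^sup>2)"

definition assignment_argmin :: "nat \<Rightarrow> real mat \<Rightarrow> real mat set" where
  "assignment_argmin u C = {P. is_arg_min (\<lambda>Q. mtrace (C * Q)) (\<lambda>Q. Q \<in> perm_mats u) P}"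

definition observed ::
    "nat \<Rightarrow> nat \<Rightarrow> (nat \<Rightarrow> real mat) \<Rightarrow> (nat \<times> nat \<times> nat \<Rightarrow> bool) \<Rightarrow> nat \<Rightarrow> real mat" where
  "observed s u Q E k = shuffle_graph s u (Q k) (adjacency (s + u) E k)"


text \<open>
  The out-of-sample error bound with constants \<open>D\<close>, \<open>D'\<close> and threshold \<open>s1\<close>. The orthogonal
  matrix \<open>W\<close> is random, since the embedding is only determined up to the choice of
  eigenvectors of a random matrix, but it does not depend on the vertex or on the graph.
\<close>

definition OOS_bound ::
    "nat \<Rightarrow> (nat \<Rightarrow> real) measure \<Rightarrow> nat \<Rightarrow> real \<Rightarrow> real \<Rightarrow> nat \<Rightarrow> bool" where
  "OOS_bound d F m D D' s1 \<longleftrightarrow>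
     (\<forall>s u Q ase. 0 < s \<and> 0 < u \<and> s1 \<le> s \<and> (\<forall>k<m. Q k \<in> perm_mats u) \<and> ASE_choice d ase \<longrightarrow>
       (let \<P> = JRDPG d F (s + u) m in
        \<exists>W :: sample \<Rightarrow> real mat.
          (\<forall>\<omega>\<in>space \<P>. W \<omega> \<in> orthogonal_mats d) \<and>
          (\<forall>a<d. \<forall>b<d. (\<lambda>\<omega>. W \<omega> $$ (a, b)) \<in> borel_measurable \<P>) \<and>
          (\<forall>v<u. \<forall>i<m.
            measure \<P> {\<omega> \<in> space \<P>. case \<omega> of (E, X) \<Rightarrow>
              vnorm (row ((Q i)\<^sup>T * oos_embedding ase d m s (observed s u Q E) i) v
                      - (W \<omega>)\<^sup>T *\<^sub>v vec d (X (s + v)))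
                \<le> D * sqrt (real m) * ln (real (m * s)) / sqrt (real s)}
            \<ge> 1 - D' / (real s)\<^sup>2)))"

end

(*
Write b = X y + e for the edges between a vertex with latent position y and the seeds, whose latent
positions are the rows of X. If the seed embedding Z is close to X W for an orthogonal W, then the
least-squares coefficients of b on Z are close to W^T y: the error is Z^T (X W - Z) W^T y + Z^T e,
multiplied by the inverse of Z^T Z, which is of order 1/s.  Conditionally on the seed graphs,
Hoeffding's inequality bounds Z^T e, so it remains to bound the Frobenius norm of X W - Z by O(log s).

For this no optimal spectral norm bound is needed. With N the noise of a seed graph, Hoeffding's
inequality bounds the entries of N X and the off-diagonal entries of N^2 by O(sqrt s log s); hence
||N||^2 = O(s^(3/2) log s), which is o(s^2), so the d leading eigenvectors of |M| are eigenvectors of M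
with eigenvalues of order s. Each scaled eigenvector z = X h + N z / sigma satisfies, after inserting
this equation into itself, z = X h + N X h / sigma + N^2 z / sigma^2, where both error terms have norm
O(log s). The vectors h are orthonormal up to O(log s / sqrt s), and Gram-Schmidt, which depends
measurably on the sample, turns them into the columns of W.

Finally, if all out-of-sample errors are at most eps and the latent positions are more than 4 eps apart,
then every wrong assignment costs strictly more than the true one. The small-ball assumption, applied
with radius 10 eps to each pair of vertices, bounds the probability that two positions are closer.
*)
theory Submission
  imports Defs "HOL-Real_Asymp.Real_Asymp"
begin

section \<open>Euclidean geometry of finite families of reals\<close>

text \<open>The crude noise bound is affordable because of the double substitution. Bounding N z /
  sigma directly would cost ||N|| / sqrt sigma, about s^(1/4). After the substitution the norm
  enters as ||N||^2 / sigma^(3/2), and s^(3/2) log s against s^(3/2) leaves log s. The term N X h /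
  sigma has the same order because N X is controlled entry by entry and not through ||N||.

  Deviation thresholds carry log s in place of sqrt(log s): the tails become exp(-8 log^2 s) \<le>
  s^(-4), which leaves s^(-2) after a union bound over O(s^2) entries.

  The eigenbasis is an uncontrolled choice. The edges form a discrete factor of the sample space, so
  every function of them is measurable, whatever the choice; only the dependence on the latent
  positions has to be explicit. Hence the columns of W are computed by a formula from Z and X, with
  the eigenvalues recovered from Z.

  One family of events, with one W for all vertices and graphs, serves both the out-of-sample bound
  and the matching, so both hold with the same D and D'.\<close>

definition dot :: "nat \<Rightarrow> (nat \<Rightarrow> real) \<Rightarrow> (nat \<Rightarrow> real) \<Rightarrow> real" where
  "dot n x y = (\<Sum>i<n. x i * y i)"

definition nrm :: "nat \<Rightarrow> (nat \<Rightarrow> real) \<Rightarrow> real" where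
  "nrm n x = sqrt (dot n x x)"

text \<open>Only the summation range is bounded; the row index is free. One function thus covers
  square matrices, the s by d matrix \<open>X\<close> as \<open>mv d X\<close>, and its transpose
  after flipping the arguments.\<close>

definition mv :: "nat \<Rightarrow> (nat \<Rightarrow> nat \<Rightarrow> real) \<Rightarrow> (nat \<Rightarrow> real) \<Rightarrow> nat \<Rightarrow> real" where
  "mv n A x i = (\<Sum>j<n. A i j * x j)"

lemma nrm_L2_set: "nrm n x = L2_set x {..<n}"
  by (simp add: nrm_def dot_def L2_set_def power2_eq_square)

lemma dot_cong: "(\<And>i. i < n \<Longrightarrow> x i = x' i) \<Longrightarrow> (\<And>i. i < n \<Longrightarrow> y i = y' i) \<Longrightarrow> dot n x y = dot n x' y'"
  by (simp add: dot_def)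

lemma nrm_cong: "(\<And>i. i < n \<Longrightarrow> x i = x' i) \<Longrightarrow> nrm n x = nrm n x'"
  by (simp add: nrm_def dot_def)

lemma dot_commute: "dot n x y = dot n y x"
  by (simp add: dot_def mult.commute)

lemma dot_add_left: "dot n (\<lambda>i. x i + y i) z = dot n x z + dot n y z"
  and dot_diff_left: "dot n (\<lambda>i. x i - y i) z = dot n x z - dot n y z"
  and dot_scale_left: "dot n (\<lambda>i. c * x i) z = c * dot n x z"
  and dot_sum_left: "dot n (\<lambda>i. \<Sum>a\<in>A. f a i) z = (\<Sum>a\<in>A. dot n (f a) z)"
  unfolding dot_def
     apply (simp_all add: algebra_simps sum.distrib sum_subtractf sum_distrib_left)
  by (subst sum.swap) simp

lemma dot_add_right: "dot n z (\<lambda>i. x i + y i) = dot n z x + dot n z y"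
  and dot_diff_right: "dot n z (\<lambda>i. x i - y i) = dot n z x - dot n z y"
  and dot_scale_right: "dot n z (\<lambda>i. c * x i) = c * dot n z x"
  and dot_sum_right: "dot n z (\<lambda>i. \<Sum>a\<in>A. f a i) = (\<Sum>a\<in>A. dot n z (f a))"
  by (simp_all add: dot_commute[of n z] dot_add_left dot_diff_left dot_scale_left dot_sum_left)

lemma dot_self_nonneg [simp]: "0 \<le> dot n x x"
  by (simp add: dot_def sum_nonneg)

lemma dot_self: "dot n x x = (nrm n x)\<^sup>2"
  by (simp add: nrm_def)

lemma nrm_nonneg [simp]: "0 \<le> nrm n x"
  by (simp add: nrm_def)

lemma abs_dot_le: "\<bar>dot n x y\<bar> \<le> nrm n x * nrm n y"
proof -
  have "\<bar>dot n x y\<bar> \<le> (\<Sum>i<n. \<bar>x i\<bar> * \<bar>y i\<bar>)"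
    unfolding dot_def by (rule order_trans[OF sum_abs]) (simp add: abs_mult)
  also have "\<dots> \<le> nrm n x * nrm n y"
    unfolding nrm_L2_set by (rule L2_set_mult_ineq)
  finally show ?thesis .
qed

lemma dot_le: "dot n x y \<le> nrm n x * nrm n y"
  using abs_dot_le[of n x y] by linarith

lemma nrm_scale: "nrm n (\<lambda>i. c * x i) = \<bar>c\<bar> * nrm n x"
  by (simp add: nrm_def dot_scale_left dot_scale_right real_sqrt_mult mult.assoc[symmetric])

lemma nrm_triangle: "nrm n (\<lambda>i. x i + y i) \<le> nrm n x + nrm n y"
  unfolding nrm_L2_set by (rule L2_set_triangle_ineq)

lemma nrm_minus_commute: "nrm n (\<lambda>i. x i - y i) = nrm n (\<lambda>i. y i - x i)"
  using nrm_scale[of n "-1" "\<lambda>i. x i - y i"] by simp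

lemma nrm_triangle_diff: "nrm n (\<lambda>i. x i - z i) \<le> nrm n (\<lambda>i. x i - y i) + nrm n (\<lambda>i. y i - z i)"
  using nrm_triangle[of n "\<lambda>i. x i - y i" "\<lambda>i. y i - z i"] by simp

lemma nrm_diff_ge: "nrm n x - nrm n y \<le> nrm n (\<lambda>i. x i - y i)"
  using nrm_triangle[of n "\<lambda>i. x i - y i" y] by simp

lemma nrm_diff_le: "nrm n (\<lambda>i. x i - y i) \<le> nrm n x + nrm n y"
  using nrm_triangle[of n x "\<lambda>i. (-1) * y i"] by (simp add: nrm_scale[of n "-1", simplified])

lemma nrm_sum_le: "nrm n (\<lambda>i. \<Sum>a\<in>A. f a i) \<le> (\<Sum>a\<in>A. nrm n (f a))"
proof (induction A rule: infinite_finite_induct)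
  case (insert a A)
  have "nrm n (\<lambda>i. \<Sum>a\<in>insert a A. f a i) \<le> nrm n (f a) + nrm n (\<lambda>i. \<Sum>a\<in>A. f a i)"
    using insert nrm_triangle[of n "f a" "\<lambda>i. \<Sum>a\<in>A. f a i"] by simp
  with insert show ?case by simp
qed (simp_all add: nrm_def dot_def)

lemma nrm_eq_0_iff: "nrm n x = 0 \<longleftrightarrow> (\<forall>i<n. x i = 0)"
  by (auto simp: nrm_L2_set L2_set_eq_0_iff)

lemma abs_le_nrm: "i < n \<Longrightarrow> \<bar>x i\<bar> \<le> nrm n x"
proof -
  assume i: "i < n"
  have "(x i)\<^sup>2 \<le> dot n x x"
    unfolding dot_def power2_eq_square by (rule member_le_sum[of i "{..<n}" "\<lambda>i. x i * x i"]) (use i in auto)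
  thus ?thesis by (simp add: nrm_def real_le_rsqrt)
qed

lemma nrm_le_sum_abs: "nrm n x \<le> (\<Sum>i<n. \<bar>x i\<bar>)"
  using nrm_L2_set L2_set_le_sum_abs by metis

lemma sum_abs_le_nrm: "(\<Sum>i<n. \<bar>x i\<bar>) \<le> sqrt (real n) * nrm n x"
proof -
  have "(\<Sum>i<n. \<bar>1\<bar> * \<bar>x i\<bar>) \<le> L2_set (\<lambda>_. 1) {..<n} * L2_set x {..<n}"
    by (rule L2_set_mult_ineq)
  thus ?thesis by (simp add: nrm_L2_set L2_set_def)
qed

lemma mv_diff: "mv n A (\<lambda>j. x j - y j) = (\<lambda>i. mv n A x i - mv n A y i)"
  and mv_scale: "mv n A (\<lambda>j. c * x j) = (\<lambda>i. c * mv n A x i)"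
  by (auto simp: mv_def algebra_simps sum_subtractf sum_distrib_left)

lemma mv_cong: "(\<And>j. j < n \<Longrightarrow> x j = y j) \<Longrightarrow> mv n A x = mv n A y"
  by (auto simp: mv_def intro!: sum.cong)

lemma mv_adjoint: "dot k (mv n A x) y = dot n x (mv k (\<lambda>j i. A i j) y)"
  unfolding dot_def mv_def sum_distrib_left sum_distrib_right
  by (subst sum.swap) (simp add: ac_simps)

lemma mv_sym:
  assumes "\<And>i j. i < n \<Longrightarrow> j < n \<Longrightarrow> A i j = A j i"
  shows "dot n (mv n A x) y = dot n x (mv n A y)"
  unfolding mv_adjoint
  by (rule dot_cong) (auto simp: mv_def assms intro!: sum.cong)

text \<open>The hypothesis is completeness, a sum over the family index \<open>a\<close>, and not
  orthonormality, a sum over coordinates. For square families \<open>orthonormal_complete\<close>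
  converts the second into the first.\<close>

lemma dot_expand:
  assumes "\<And>i j. i < n \<Longrightarrow> j < n \<Longrightarrow> (\<Sum>a<n. u a i * u a j) = of_bool (i = j)" and "i < n"
  shows "x i = (\<Sum>a<n. dot n (u a) x * u a i)"
proof -
  have "(\<Sum>a<n. dot n (u a) x * u a i) = (\<Sum>j<n. x j * (\<Sum>a<n. u a j * u a i))"
    unfolding dot_def sum_distrib_left sum_distrib_right
    by (subst sum.swap) (simp add: ac_simps)
  also have "\<dots> = (\<Sum>j<n. x j * of_bool (j = i))"
    using assms by simp
  finally show ?thesis using assms(2) by (simp add: of_bool_def if_distrib cong: if_cong)
qed

lemma exists_orthogonal_combination:
  fixes V :: "nat \<Rightarrow> nat \<Rightarrow> real"
  assumes "0 < d"
  shows "\<exists>c. nrm d c > 0 \<and> (\<forall>a<d - 1. dot d (V a) c = 0)"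
proof -
  \<comment> \<open>A zero last row pads the d - 1 conditions to a singular square matrix; a kernel
    vector is the required combination.\<close>
  define A where "A = mat\<^sub>r d d (\<lambda>a. if a = d - 1 then 0\<^sub>v d else vec d (V a))"
  have A: "A \<in> carrier_mat d d" by (simp add: A_def)
  have "det A = 0"
    unfolding A_def using assms by (intro det_row_0) auto
  then obtain v where v: "v \<in> carrier_vec d" "v \<noteq> 0\<^sub>v d" "A *\<^sub>v v = 0\<^sub>v d"
    using det_0_iff_vec_prod_zero[OF A] by auto
  define c where "c = (\<lambda>i. v $ i)"
  have "nrm d c \<noteq> 0"
  proof
    assume "nrm d c = 0"
    hence "v = 0\<^sub>v d" using v(1) by (intro eq_vecI) (auto simp: nrm_eq_0_iff c_def)
    thus False using v by simp
  qed
  hence "nrm d c > 0" using nrm_nonneg[of d c] by linarith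
  moreover have "dot d (V a) c = 0" if "a < d - 1" for a
  proof -
    have "(A *\<^sub>v v) $ a = 0" using v that by simp
    moreover have "(A *\<^sub>v v) $ a = dot d (V a) c"
      using that v(1) A by (simp add: A_def scalar_prod_def dot_def c_def atLeast0LessThan)
    ultimately show ?thesis by simp
  qed
  ultimately show ?thesis by blast
qed

section \<open>Gram--Schmidt for nearly orthonormal families\<close>

text \<open>The recursion is total: a vanishing remainder is divided by 0 and yields the zero
  vector. An explicit formula without case distinctions makes every vector measurable in
  \<open>h\<close>, by induction on the index.\<close>

fun gram_schmidt_vec :: "nat \<Rightarrow> (nat \<Rightarrow> nat \<Rightarrow> real) \<Rightarrow> nat \<Rightarrow> nat \<Rightarrow> real" where
  "gram_schmidt_vec d h k =
    (\<lambda>i. (h k i - (\<Sum>a<k. dot d (gram_schmidt_vec d h a) (h k) * gram_schmidt_vec d h a i)) /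
         nrm d (\<lambda>i. h k i - (\<Sum>a<k. dot d (gram_schmidt_vec d h a) (h k) * gram_schmidt_vec d h a i)))"

declare gram_schmidt_vec.simps [simp del]

text \<open>\<open>K\<close> and \<open>\<eta>\<^sub>0\<close> quantify the continuity of Gram--Schmidt at orthonormal families.\<close>

definition gram_schmidt_modulus :: "nat \<Rightarrow> nat \<Rightarrow> real \<Rightarrow> real \<Rightarrow> bool" where
  "gram_schmidt_modulus d k K \<eta>\<^sub>0 \<longleftrightarrow> (\<forall>h \<eta>. 0 \<le> \<eta> \<and> \<eta> \<le> \<eta>\<^sub>0 \<and>
      (\<forall>a<k. \<forall>b<k. \<bar>dot d (h a) (h b) - of_bool (a = b)\<bar> \<le> \<eta>) \<longrightarrow>
    (\<forall>a<k. \<forall>b<k. dot d (gram_schmidt_vec d h a) (gram_schmidt_vec d h b) = of_bool (a = b)) \<and>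
    (\<forall>a<k. nrm d (\<lambda>i. gram_schmidt_vec d h a i - h a i) \<le> K * \<eta>))"

lemma gram_schmidt_modulusD:
  assumes "gram_schmidt_modulus d k K \<eta>\<^sub>0" "0 \<le> \<eta>" "\<eta> \<le> \<eta>\<^sub>0"
    and "\<And>a b. a < k \<Longrightarrow> b < k \<Longrightarrow> \<bar>dot d (h a) (h b) - of_bool (a = b)\<bar> \<le> \<eta>"
  shows "a < k \<Longrightarrow> b < k \<Longrightarrow> dot d (gram_schmidt_vec d h a) (gram_schmidt_vec d h b) = of_bool (a = b)"
    and "a < k \<Longrightarrow> nrm d (\<lambda>i. gram_schmidt_vec d h a i - h a i) \<le> K * \<eta>"
  using spec[OF spec[OF assms(1)[unfolded gram_schmidt_modulus_def], of h], of \<eta>] assms(2-) by blast+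

lemma gram_schmidt_modulus_exists: "\<exists>K>0. \<exists>\<eta>\<^sub>0>0. gram_schmidt_modulus d k K \<eta>\<^sub>0"
proof (induction k)
  case 0
  show ?case unfolding gram_schmidt_modulus_def by (intro exI[of _ "1::real"] conjI allI impI) simp_all
next
  case (Suc k)
  then obtain K \<eta>\<^sub>0 where K: "K > 0" "\<eta>\<^sub>0 > 0" and IH: "gram_schmidt_modulus d k K \<eta>\<^sub>0"
    by blast
  \<comment> \<open>\<open>L\<close> bounds the projection of \<open>h k\<close> onto the earlier
    vectors, k coefficients of size (1 + 2K) \<eta> each. In \<open>K'\<close>, 2L + 1 pays for
    projecting and normalising the new vector, and K keeps the old bound. \<open>\<eta>'\<close>
    makes (L + 1) \<eta> at most 1/2, so that the remainder cannot vanish.\<close>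
  define L where "L = real k * (1 + 2 * K)"
  define K' where "K' = 2 * L + 1 + K"
  define \<eta>' where "\<eta>' = min (min \<eta>\<^sub>0 1) (1 / (2 * (L + 1)))"
  have L: "0 \<le> L" using K by (simp add: L_def)
  have pos: "K' > 0" "\<eta>' > 0" using K L by (auto simp: K'_def \<eta>'_def)
  have key: "(\<forall>a<Suc k. \<forall>b<Suc k. dot d (gram_schmidt_vec d h a) (gram_schmidt_vec d h b) = of_bool (a = b)) \<and>
      (\<forall>a<Suc k. nrm d (\<lambda>i. gram_schmidt_vec d h a i - h a i) \<le> K' * \<eta>)"
    if \<eta>: "0 \<le> \<eta>" "\<eta> \<le> \<eta>'"
    and H: "\<forall>a<Suc k. \<forall>b<Suc k. \<bar>dot d (h a) (h b) - of_bool (a = b)\<bar> \<le> \<eta>" for h \<eta>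
  proof -
    let ?w = "gram_schmidt_vec d h"
    have \<eta>1: "\<eta> \<le> 1" "\<eta> \<le> \<eta>\<^sub>0" "\<eta> \<le> 1 / (2 * (L + 1))" using \<eta> by (auto simp: \<eta>'_def)
    from \<eta>1(3) L have \<eta>L: "\<eta> * (L + 1) \<le> 1/2"
      by (simp add: field_simps)
    have orth: "\<And>a b. a < k \<Longrightarrow> b < k \<Longrightarrow> dot d (?w a) (?w b) = of_bool (a = b)"
      and near: "\<And>a. a < k \<Longrightarrow> nrm d (\<lambda>i. ?w a i - h a i) \<le> K * \<eta>"
      using gram_schmidt_modulusD[OF IH \<eta>(1) \<eta>1(2), of h] H by simp_all
    have hk2: "\<bar>(nrm d (h k))\<^sup>2 - 1\<bar> \<le> \<eta>"
      using H[rule_format, of k k] by (simp add: dot_self[symmetric])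
    have hk: "\<bar>nrm d (h k) - 1\<bar> \<le> \<eta>"
    proof -
      have "\<bar>nrm d (h k) - 1\<bar> * 1 \<le> \<bar>nrm d (h k) - 1\<bar> * \<bar>nrm d (h k) + 1\<bar>"
        by (intro mult_left_mono) (use nrm_nonneg[of d "h k"] in auto)
      also have "\<dots> = \<bar>(nrm d (h k))\<^sup>2 - 1\<bar>"
        by (subst abs_mult[symmetric]) (simp add: power2_eq_square algebra_simps)
      finally show ?thesis using hk2 by simp
    qed
    define p where "p = (\<lambda>i. \<Sum>a<k. dot d (?w a) (h k) * ?w a i)"
    define g where "g = (\<lambda>i. h k i - p i)"
    define c where "c = 1 / nrm d g"
    have wk: "?w k = (\<lambda>i. c * g i)"
      by (subst gram_schmidt_vec.simps) (simp add: g_def p_def c_def)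
    have coef: "\<bar>dot d (?w a) (h k)\<bar> \<le> (1 + 2 * K) * \<eta>" if "a < k" for a
    proof -
      have "dot d (?w a) (h k) = dot d (h a) (h k) + dot d (\<lambda>i. ?w a i - h a i) (h k)"
        by (simp add: dot_diff_left)
      moreover have "\<bar>dot d (h a) (h k)\<bar> \<le> \<eta>" using H[rule_format, of a k] that by simp
      moreover have "\<bar>dot d (\<lambda>i. ?w a i - h a i) (h k)\<bar> \<le> (K * \<eta>) * 2"
        using near[OF that] hk \<eta>1 K \<eta>
        by (intro order_trans[OF abs_dot_le mult_mono]) auto
      ultimately show ?thesis by (simp add: algebra_simps)
    qed
    have wn: "nrm d (?w a) = 1" if "a < k" for a
      using orth[OF that that] by (simp add: nrm_def)
    have pn: "nrm d p \<le> L * \<eta>"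
    proof -
      have "nrm d p \<le> (\<Sum>a<k. nrm d (\<lambda>i. dot d (?w a) (h k) * ?w a i))"
        unfolding p_def by (rule nrm_sum_le)
      also have "\<dots> \<le> (\<Sum>a<k. (1 + 2 * K) * \<eta>)"
        by (intro sum_mono) (use coef wn in \<open>auto simp: nrm_scale\<close>)
      finally show ?thesis by (simp add: L_def)
    qed
    have gn: "\<bar>nrm d g - 1\<bar> \<le> (L + 1) * \<eta>"
    proof -
      have "nrm d g \<le> nrm d (h k) + nrm d p" "nrm d (h k) - nrm d p \<le> nrm d g"
        unfolding g_def by (rule nrm_diff_le nrm_diff_ge)+
      thus ?thesis using pn hk by (simp add: algebra_simps abs_le_iff)
    qed
    have gpos: "nrm d g > 0" using gn \<eta>L by (simp add: abs_le_iff algebra_simps)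
    hence cg: "c * nrm d g = 1" "0 < c" by (simp_all add: c_def)
    have perp: "dot d (?w a) g = 0" if "a < k" for a
    proof -
      have "dot d (?w a) p = (\<Sum>b<k. dot d (?w b) (h k) * of_bool (a = b))"
        unfolding p_def dot_sum_right by (intro sum.cong) (auto simp: dot_scale_right orth that)
      also have "\<dots> = dot d (?w a) (h k)"
        using that by (simp add: of_bool_def if_distrib cong: if_cong)
      finally show ?thesis by (simp add: g_def dot_diff_right)
    qed
    have "(c * nrm d g) * (c * nrm d g) = 1" unfolding cg by simp
    hence "dot d (?w k) (?w k) = 1"
      unfolding wk dot_scale_left dot_scale_right dot_self by (simp add: power2_eq_square ac_simps)
    moreover have "dot d (?w a) (?w k) = 0" "dot d (?w k) (?w a) = 0" if "a < k" for a
      unfolding wk dot_scale_left dot_scale_right using perp[OF that] dot_commute[of d g "?w a"] by simp_all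
    ultimately have 1: "\<forall>a<Suc k. \<forall>b<Suc k. dot d (?w a) (?w b) = of_bool (a = b)"
      using orth by (auto simp: less_Suc_eq)
    have "nrm d (\<lambda>i. ?w k i - h k i) \<le> nrm d (\<lambda>i. ?w k i - g i) + nrm d (\<lambda>i. g i - h k i)"
      by (rule nrm_triangle_diff)
    also have "nrm d (\<lambda>i. g i - h k i) = nrm d p"
      using nrm_scale[of d "-1" p] by (simp add: g_def)
    also have "nrm d (\<lambda>i. ?w k i - g i) = nrm d (\<lambda>i. (c - 1) * g i)"
      unfolding wk by (simp add: left_diff_distrib)
    also have "\<dots> = \<bar>(c - 1) * nrm d g\<bar>"
      by (simp add: nrm_scale abs_mult)
    also have "(c - 1) * nrm d g = 1 - nrm d g" using cg by (simp add: left_diff_distrib)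
    also have "\<bar>1 - nrm d g\<bar> = \<bar>nrm d g - 1\<bar>" by (rule abs_minus_commute)
    finally have "nrm d (\<lambda>i. ?w k i - h k i) \<le> (2 * L + 1) * \<eta>"
      using gn pn by (simp add: algebra_simps)
    also have "\<dots> \<le> K' * \<eta>" using \<eta> K by (intro mult_right_mono) (auto simp: K'_def)
    finally have 2: "nrm d (\<lambda>i. ?w k i - h k i) \<le> K' * \<eta>" .
    have "K * \<eta> \<le> K' * \<eta>" using \<eta> K L by (intro mult_right_mono) (auto simp: K'_def)
    hence "\<forall>a<Suc k. nrm d (\<lambda>i. ?w a i - h a i) \<le> K' * \<eta>"
      using near 2 by (force simp: less_Suc_eq)
    with 1 show ?thesis by blast
  qed
  show ?case
    unfolding gram_schmidt_modulus_def
    by (rule exI[of _ K'], rule conjI, rule pos, rule exI[of _ \<eta>'], rule conjI, rule pos,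
        intro allI impI, elim conjE, rule key; assumption)
qed

section \<open>Perturbation of a positive semidefinite matrix of rank \<open>d\<close>\<close>

text \<open>The family \<open>u\<close> diagonalises |M|, so at first only the square of M is known
  to act diagonally (\<open>eig\<close>). \<open>\<gamma>\<close> bounds X^T X from below,
  \<open>\<Gamma>\<close> and \<open>\<nu>\<close> bound the operator norms of X and E, and
  \<open>\<tau>\<close> bounds E X, where cancellation beats the product of \<open>\<nu>\<close> and
  \<open>\<Gamma>\<close>. The gap \<open>\<nu> < \<gamma> / 2\<close> separates the d signal
  eigenvalues from the noise.\<close>

locale spectral_perturbation =
  fixes N d :: nat and M E X :: "nat \<Rightarrow> nat \<Rightarrow> real"
    and u :: "nat \<Rightarrow> nat \<Rightarrow> real" and \<sigma> :: "nat \<Rightarrow> real"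
    and \<gamma> \<Gamma> \<nu> \<tau> :: real
  assumes d: "0 < d" "d \<le> N"
    and M_eq: "\<And>i j. i < N \<Longrightarrow> j < N \<Longrightarrow> M i j = dot d (X i) (X j) + E i j"
    and E_sym: "\<And>i j. i < N \<Longrightarrow> j < N \<Longrightarrow> E i j = E j i"
    and orth: "\<And>a b. a < N \<Longrightarrow> b < N \<Longrightarrow> dot N (u a) (u b) = of_bool (a = b)"
    and complete: "\<And>i j. i < N \<Longrightarrow> j < N \<Longrightarrow> (\<Sum>a<N. u a i * u a j) = of_bool (i = j)"
    and eig: "\<And>a i. a < N \<Longrightarrow> i < N \<Longrightarrow> mv N M (mv N M (u a)) i = (\<sigma> a)\<^sup>2 * u a i"
    and \<sigma>_nonneg: "\<And>a. a < N \<Longrightarrow> 0 \<le> \<sigma> a"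
    and \<sigma>_mono: "\<And>a b. a \<le> b \<Longrightarrow> b < N \<Longrightarrow> \<sigma> b \<le> \<sigma> a"
    and gram_lower: "\<And>c. \<gamma> * (nrm d c)\<^sup>2 \<le> (nrm N (mv d X c))\<^sup>2"
    and gram_upper: "\<And>c. nrm N (mv d X c) \<le> \<Gamma> * nrm d c"
    and noise: "\<And>v. nrm N (mv N E v) \<le> \<nu> * nrm N v"
    and cross: "\<And>c. nrm N (mv N E (mv d X c)) \<le> \<tau> * nrm d c"
    and bounds: "0 \<le> \<nu>" "0 \<le> \<tau>" "0 \<le> \<Gamma>" "\<nu> < \<gamma> / 2"
begin

definition Xt :: "(nat \<Rightarrow> real) \<Rightarrow> nat \<Rightarrow> real" where
  "Xt v = mv N (\<lambda>c i. X i c) v"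

lemma \<gamma>_pos: "0 < \<gamma>" using bounds by linarith

lemma M_sym: "i < N \<Longrightarrow> j < N \<Longrightarrow> M i j = M j i"
  using M_eq[of i j] M_eq[of j i] E_sym[of i j] dot_commute[of d "X i" "X j"] by simp

lemma dot_Xt: "dot d (Xt v) c = dot N v (mv d X c)"
  unfolding Xt_def mv_adjoint ..

lemma mv_M:
  assumes "i < N"
  shows "mv N M v i = mv d X (Xt v) i + mv N E v i"
proof -
  have "mv N M v i = (\<Sum>j<N. (\<Sum>c<d. X i c * X j c) * v j + E i j * v j)"
    unfolding mv_def using assms by (intro sum.cong) (auto simp: M_eq dot_def distrib_right)
  also have "\<dots> = (\<Sum>j<N. \<Sum>c<d. X i c * (X j c * v j)) + mv N E v i"
    by (simp add: sum.distrib mv_def sum_distrib_right mult.assoc)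
  also have "(\<Sum>j<N. \<Sum>c<d. X i c * (X j c * v j)) = mv d X (Xt v) i"
    by (subst sum.swap) (simp add: mv_def Xt_def sum_distrib_left)
  finally show ?thesis .
qed

text \<open>A matrix and its transpose have the same operator norm: pair X^T v with itself and move
  X across.\<close>

lemma nrm_Xt: "nrm d (Xt v) \<le> \<Gamma> * nrm N v"
proof (cases "nrm d (Xt v) = 0")
  case False
  hence p: "nrm d (Xt v) > 0" using nrm_nonneg[of d "Xt v"] by linarith
  have "(nrm d (Xt v))\<^sup>2 = dot N v (mv d X (Xt v))"
    by (simp add: dot_self[symmetric] dot_Xt)
  also have "\<dots> \<le> nrm N v * (\<Gamma> * nrm d (Xt v))"
    by (intro order_trans[OF dot_le] mult_left_mono gram_upper) simp
  finally have "nrm d (Xt v) * nrm d (Xt v) \<le> (\<Gamma> * nrm N v) * nrm d (Xt v)"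
    by (simp add: power2_eq_square ac_simps)
  thus ?thesis using p by simp
qed (simp add: bounds)

text \<open>M^2 is diagonal in the basis \<open>u\<close>; the symmetry of M moves it onto the basis
  vectors.\<close>

lemma nrm_M_sq: "(nrm N (mv N M v))\<^sup>2 = (\<Sum>a<N. (\<sigma> a)\<^sup>2 * (dot N (u a) v)\<^sup>2)"
proof -
  have M2: "dot N (u a) (mv N M (mv N M v)) = (\<sigma> a)\<^sup>2 * dot N (u a) v" if a: "a < N" for a
  proof -
    have "dot N (u a) (mv N M (mv N M v)) = dot N (mv N M (mv N M (u a))) v"
      by (simp add: mv_sym[OF M_sym])
    also have "\<dots> = dot N (\<lambda>i. (\<sigma> a)\<^sup>2 * u a i) v"
      by (intro dot_cong) (auto simp: eig a)
    finally show ?thesis by (simp add: dot_scale_left)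
  qed
  have "(nrm N (mv N M v))\<^sup>2 = dot N v (mv N M (mv N M v))"
    by (simp add: dot_self[symmetric] mv_sym[OF M_sym])
  also have "\<dots> = dot N (\<lambda>i. \<Sum>a<N. dot N (u a) v * u a i) (mv N M (mv N M v))"
    by (intro dot_cong dot_expand[OF complete]) auto
  also have "\<dots> = (\<Sum>a<N. dot N (u a) v * dot N (u a) (mv N M (mv N M v)))"
    by (simp add: dot_sum_left dot_scale_left)
  also have "\<dots> = (\<Sum>a<N. (\<sigma> a)\<^sup>2 * (dot N (u a) v)\<^sup>2)"
    by (intro sum.cong) (auto simp: M2 power2_eq_square)
  finally show ?thesis .
qed

lemma parseval: "(nrm N v)\<^sup>2 = (\<Sum>a<N. (dot N (u a) v)\<^sup>2)"
proof -
  have "(nrm N v)\<^sup>2 = dot N (\<lambda>i. \<Sum>a<N. dot N (u a) v * u a i) v"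
    unfolding dot_self[symmetric] by (intro dot_cong dot_expand[OF complete]) auto
  thus ?thesis by (simp add: dot_sum_left dot_scale_left power2_eq_square)
qed

text \<open>The form of X X^T at v is the squared norm of X^T v, so only E can make the form of M
  negative.\<close>

lemma quadratic_M_lower: "(nrm d (Xt v))\<^sup>2 - \<nu> * (nrm N v)\<^sup>2 \<le> dot N v (mv N M v)"
proof -
  have "dot N v (mv N M v) = dot N v (\<lambda>i. mv d X (Xt v) i + mv N E v i)"
    by (intro dot_cong) (auto simp: mv_M)
  also have "\<dots> = (nrm d (Xt v))\<^sup>2 + dot N v (mv N E v)"
    by (simp add: dot_add_right dot_Xt[symmetric] dot_self)
  finally have eq: "dot N v (mv N M v) = (nrm d (Xt v))\<^sup>2 + dot N v (mv N E v)" .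
  have "\<bar>dot N v (mv N E v)\<bar> \<le> nrm N v * (\<nu> * nrm N v)"
    by (intro order_trans[OF abs_dot_le] mult_left_mono noise) simp
  thus ?thesis unfolding eq by (simp add: power2_eq_square abs_le_iff ac_simps)
qed

text \<open>Courant--Fischer: some nonzero vector in the column space of \<open>X\<close> is orthogonal to the
  first \<open>d - 1\<close> eigenvectors, and on that space the quadratic form of \<open>M\<close> is large.\<close>

lemma \<sigma>_lower:
  assumes a: "a < d"
  shows "\<gamma> / 2 \<le> \<sigma> a" "0 < \<sigma> a"
proof -
  obtain c where c: "nrm d c > 0" "\<And>b. b < d - 1 \<Longrightarrow> dot d (Xt (u b)) c = 0"
    using exists_orthogonal_combination[OF d(1), of "\<lambda>b. Xt (u b)"] by blast
  define v where "v = mv d X c"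
  have v_orth: "dot N (u b) v = 0" if "b < d - 1" for b
    using c(2)[OF that] by (simp add: v_def dot_Xt)
  have "0 < \<gamma> * (nrm d c)\<^sup>2" using \<gamma>_pos c(1) by simp
  hence "0 < (nrm N v)\<^sup>2" using gram_lower[of c] unfolding v_def by linarith
  hence v_pos: "0 < nrm N v" by (metis nrm_nonneg less_le zero_power2)
  \<comment> \<open>The components of v before index d - 1 vanish, and from there on
    \<open>\<sigma>\<close> is at most \<open>\<sigma> (d - 1)\<close>.\<close>
  have "(nrm N (mv N M v))\<^sup>2 \<le> (\<Sum>b<N. (\<sigma> (d - 1))\<^sup>2 * (dot N (u b) v)\<^sup>2)"
    unfolding nrm_M_sq
  proof (rule sum_mono)
    fix b assume b: "b \<in> {..<N}"
    show "(\<sigma> b)\<^sup>2 * (dot N (u b) v)\<^sup>2 \<le> (\<sigma> (d - 1))\<^sup>2 * (dot N (u b) v)\<^sup>2"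
    proof (cases "b < d - 1")
      case False
      hence "\<sigma> b \<le> \<sigma> (d - 1)" using b by (intro \<sigma>_mono) auto
      thus ?thesis using \<sigma>_nonneg[of b] b by (intro mult_right_mono power_mono) auto
    qed (simp add: v_orth)
  qed
  also have "\<dots> = (\<sigma> (d - 1) * nrm N v)\<^sup>2"
    by (simp add: parseval power_mult_distrib sum_distrib_left)
  finally have Mv: "nrm N (mv N M v) \<le> \<sigma> (d - 1) * nrm N v"
    by (rule power2_le_imp_le) (use \<sigma>_nonneg[of "d - 1"] d in auto)
  \<comment> \<open>With v = X c, Cauchy-Schwarz gives \<gamma> |c| \<le> |X^T v| and |v|^2 \<le>
    |X^T v| |c|. Combined they yield \<gamma> |v|^2 \<le> |X^T v|^2: on the column space of X, the
    form of X X^T is at least \<gamma>.\<close>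
  have "\<gamma> * nrm d c \<le> nrm d (Xt v)"
  proof -
    have "\<gamma> * (nrm d c)\<^sup>2 \<le> (nrm N v)\<^sup>2" unfolding v_def by (rule gram_lower)
    also have "\<dots> = dot d (Xt v) c"
      by (simp add: dot_Xt dot_self[symmetric] v_def[symmetric])
    also have "\<dots> \<le> nrm d (Xt v) * nrm d c" by (rule dot_le)
    finally show ?thesis using c(1) by (simp add: power2_eq_square)
  qed
  hence "\<gamma> * nrm d c * nrm d (Xt v) \<le> nrm d (Xt v) * nrm d (Xt v)"
    by (intro mult_right_mono) auto
  moreover have "(nrm N v)\<^sup>2 \<le> nrm d (Xt v) * nrm d c"
    using dot_le[of d "Xt v" c] by (simp add: dot_Xt dot_self[symmetric] v_def[symmetric])
  hence "\<gamma> * (nrm N v)\<^sup>2 \<le> \<gamma> * (nrm d (Xt v) * nrm d c)"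
    using \<gamma>_pos by (intro mult_left_mono) auto
  ultimately have "\<gamma> * (nrm N v)\<^sup>2 \<le> (nrm d (Xt v))\<^sup>2"
    by (simp add: power2_eq_square ac_simps)
  hence "(\<gamma> - \<nu>) * (nrm N v)\<^sup>2 \<le> dot N v (mv N M v)"
    using quadratic_M_lower[of v] by (simp add: left_diff_distrib)
  also have "\<dots> \<le> nrm N v * (\<sigma> (d - 1) * nrm N v)"
    by (intro order_trans[OF dot_le] mult_left_mono Mv) simp
  finally have "(\<gamma> - \<nu>) * (nrm N v)\<^sup>2 \<le> \<sigma> (d - 1) * (nrm N v)\<^sup>2"
    by (simp add: power2_eq_square ac_simps)
  hence "\<gamma> - \<nu> \<le> \<sigma> (d - 1)" using v_pos by simp
  moreover have "\<sigma> (d - 1) \<le> \<sigma> a" using a d by (intro \<sigma>_mono) auto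
  ultimately show "\<gamma> / 2 \<le> \<sigma> a" "0 < \<sigma> a" using bounds \<gamma>_pos by linarith+
qed

text \<open>Since \<open>M\<close> has no eigenvalue below \<open>-\<nu>\<close>, the leading eigenvectors of \<open>|M|\<close> are
  eigenvectors of \<open>M\<close> itself, with positive eigenvalues.\<close>

lemma M_u:
  assumes a: "a < d" and i: "i < N"
  shows "mv N M (u a) i = \<sigma> a * u a i"
proof -
  have aN: "a < N" using a d by simp
  \<comment> \<open>Because M^2 u = \<sigma>^2 u, the vector w = (M - \<sigma>) u satisfies M w =
    -\<sigma> w. The form of M is at least -\<nu> |w|^2 and \<nu> < \<sigma>, so w vanishes.\<close>
  define w where "w = (\<lambda>i. mv N M (u a) i - \<sigma> a * u a i)"
  have "mv N M w j = - \<sigma> a * w j" if "j < N" for j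
    unfolding w_def mv_diff mv_scale using eig[OF aN that] by (simp add: power2_eq_square algebra_simps)
  hence "dot N w (mv N M w) = dot N w (\<lambda>i. - \<sigma> a * w i)"
    by (intro dot_cong) auto
  also have "\<dots> = - \<sigma> a * (nrm N w)\<^sup>2" by (simp only: dot_scale_right dot_self)
  finally have "- \<nu> * (nrm N w)\<^sup>2 \<le> - \<sigma> a * (nrm N w)\<^sup>2"
    using quadratic_M_lower[of w] zero_le_power2[of "nrm d (Xt w)"] by linarith
  hence "(\<sigma> a - \<nu>) * (nrm N w)\<^sup>2 \<le> 0" by (simp add: left_diff_distrib)
  moreover have "\<sigma> a - \<nu> > 0" using \<sigma>_lower(1)[OF a] bounds by linarith
  ultimately have "nrm N w = 0" by (simp add: mult_le_0_iff)
  hence "w i = 0" using i by (simp add: nrm_eq_0_iff)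
  thus ?thesis by (simp add: w_def)
qed

lemma \<sigma>_upper:
  assumes a: "a < d"
  shows "\<sigma> a \<le> \<Gamma>\<^sup>2 + \<nu>"
proof -
  have aN: "a < N" using a d by simp
  have n1: "nrm N (u a) = 1" using orth[OF aN aN] by (simp add: nrm_def)
  have "\<sigma> a = nrm N (\<lambda>i. \<sigma> a * u a i)"
    using n1 \<sigma>_nonneg[OF aN] by (simp add: nrm_scale)
  also have "\<dots> = nrm N (\<lambda>i. mv d X (Xt (u a)) i + mv N E (u a) i)"
    by (intro nrm_cong) (simp add: M_u[OF a, symmetric] mv_M)
  also have "\<dots> \<le> nrm N (mv d X (Xt (u a))) + nrm N (mv N E (u a))" by (rule nrm_triangle)
  also have "nrm N (mv d X (Xt (u a))) \<le> \<Gamma> * (\<Gamma> * nrm N (u a))"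
    by (intro order_trans[OF gram_upper] mult_left_mono nrm_Xt bounds)
  also have "nrm N (mv N E (u a)) \<le> \<nu> * nrm N (u a)" by (rule noise)
  finally show ?thesis using n1 by (simp add: power2_eq_square)
qed

definition z :: "nat \<Rightarrow> nat \<Rightarrow> real" where "z a i = u a i * sqrt (\<sigma> a)"
text \<open>Since z = M z / \<sigma> = X (X^T z / \<sigma>) + E z / \<sigma>, the signal part of a
  column z of the embedding is X h with these coefficients.\<close>

definition h :: "nat \<Rightarrow> nat \<Rightarrow> real" where "h a c = Xt (z a) c / \<sigma> a"

lemma z_scale: "z a = (\<lambda>i. sqrt (\<sigma> a) * u a i)"
  by (auto simp: z_def)

lemma dot_z: "a < d \<Longrightarrow> b < d \<Longrightarrow> dot N (z a) (z b) = of_bool (a = b) * \<sigma> a"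
  using d \<sigma>_lower(2)[of a] unfolding z_scale dot_scale_left dot_scale_right
  by (subst orth) (auto simp: real_sqrt_mult_self)

lemma nrm_z: "a < d \<Longrightarrow> nrm N (z a) = sqrt (\<sigma> a)"
  by (simp add: nrm_def dot_z)

lemma M_z: "a < d \<Longrightarrow> i < N \<Longrightarrow> mv N M (z a) i = \<sigma> a * z a i"
  unfolding z_scale mv_scale by (simp add: M_u)

lemma z_decomp:
  assumes "a < d" "i < N"
  shows "z a i - mv d X (h a) i = mv N E (z a) i / \<sigma> a"
proof -
  have "mv d X (h a) i = mv d X (Xt (z a)) i / \<sigma> a"
    by (simp add: mv_def h_def sum_divide_distrib)
  thus ?thesis
    using M_z[OF assms] mv_M[OF assms(2), of "z a"] \<sigma>_lower(2)[OF assms(1)] by (simp add: field_simps)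
qed

lemma nrm_h:
  assumes "a < d"
  shows "nrm d (h a) \<le> \<Gamma> / sqrt (\<sigma> a)"
proof -
  note p = \<sigma>_lower(2)[OF assms]
  have "nrm d (h a) = (1 / \<sigma> a) * nrm d (Xt (z a))"
    using nrm_scale[of d "1 / \<sigma> a" "Xt (z a)"] p by (simp add: h_def[abs_def])
  also have "\<dots> \<le> (1 / \<sigma> a) * (\<Gamma> * sqrt (\<sigma> a))"
    using nrm_Xt[of "z a"] p by (intro mult_left_mono) (auto simp: nrm_z assms)
  also have "\<dots> = \<Gamma> / sqrt (\<sigma> a)"
    using p by (simp add: divide_simps)
  finally show ?thesis .
qed

text \<open>Expanding \<open>E z\<close> once more through \<open>z = X h + E z / \<sigma>\<close> replaces the first-order term by
  \<open>E X h\<close>, which is much smaller than the operator norm of \<open>E\<close> suggests.\<close>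

lemma residual:
  assumes "a < d"
  shows "nrm N (\<lambda>i. z a i - mv d X (h a) i) \<le> \<tau> * \<Gamma> / (\<sigma> a * sqrt (\<sigma> a)) + \<nu>\<^sup>2 / (\<sigma> a * sqrt (\<sigma> a))"
proof -
  note p = \<sigma>_lower(2)[OF assms]
  let ?r = "\<lambda>i. z a i - mv d X (h a) i"
  have r: "nrm N ?r = nrm N (mv N E (z a)) / \<sigma> a"
    using nrm_scale[of N "1 / \<sigma> a" "mv N E (z a)"] p
      nrm_cong[of N ?r "\<lambda>i. 1 / \<sigma> a * mv N E (z a) i", OF trans[OF z_decomp[OF assms]]] by simp
  have "nrm N (mv N E ?r) \<le> \<nu> * nrm N ?r" by (rule noise)
  also have "\<dots> \<le> \<nu> * (\<nu> * sqrt (\<sigma> a) / \<sigma> a)"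
    unfolding r using noise[of "z a"] p bounds by (intro mult_left_mono divide_right_mono) (auto simp: nrm_z assms)
  also have "\<dots> = \<nu>\<^sup>2 / sqrt (\<sigma> a)"
    using p by (simp add: power2_eq_square divide_simps)
  finally have 1: "nrm N (mv N E ?r) \<le> \<nu>\<^sup>2 / sqrt (\<sigma> a)" .
  have "nrm N (mv N E (mv d X (h a))) \<le> \<tau> * nrm d (h a)" by (rule cross)
  also have "\<dots> \<le> \<tau> * (\<Gamma> / sqrt (\<sigma> a))" by (intro mult_left_mono nrm_h assms bounds)
  finally have 2: "nrm N (mv N E (mv d X (h a))) \<le> \<tau> * \<Gamma> / sqrt (\<sigma> a)" by simp
  have "mv N E (z a) = (\<lambda>i. mv N E (mv d X (h a)) i + mv N E ?r i)"
    by (simp add: mv_diff)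
  hence "nrm N (mv N E (z a)) \<le> nrm N (mv N E (mv d X (h a))) + nrm N (mv N E ?r)"
    using nrm_triangle[of N "mv N E (mv d X (h a))" "mv N E ?r"] by simp
  hence "nrm N (mv N E (z a)) \<le> \<tau> * \<Gamma> / sqrt (\<sigma> a) + \<nu>\<^sup>2 / sqrt (\<sigma> a)"
    using 1 2 by linarith
  hence "nrm N ?r \<le> (\<tau> * \<Gamma> / sqrt (\<sigma> a) + \<nu>\<^sup>2 / sqrt (\<sigma> a)) / \<sigma> a"
    unfolding r using p by (intro divide_right_mono) auto
  thus ?thesis by (simp add: add_divide_distrib mult.commute)
qed

text \<open>Up to the factor \<open>\<sigma> a\<close>, the inner product of \<open>h a\<close> and
  \<open>h b\<close> is that of X^T \<open>z a\<close> with \<open>h b\<close>, hence that of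
  \<open>z a\<close> with X \<open>h b\<close>. The latter vector is within \<open>\<rho>\<close> of
  \<open>z b\<close>, and the columns z are orthogonal.\<close>

lemma nearly_orthonormal:
  assumes "a < d" "b < d" "nrm N (\<lambda>i. z b i - mv d X (h b) i) \<le> \<rho>"
  shows "\<bar>dot d (h a) (h b) - of_bool (a = b)\<bar> \<le> \<rho> / sqrt (\<sigma> a)"
proof -
  note p = \<sigma>_lower(2)[OF assms(1)]
  let ?r = "\<lambda>i. z b i - mv d X (h b) i"
  have "\<sigma> a * dot d (h a) (h b) = dot d (Xt (z a)) (h b)"
    using dot_scale_left[of d "1 / \<sigma> a" "Xt (z a)" "h b"] p by (simp add: h_def[abs_def])
  also have "\<dots> = dot N (z a) (mv d X (h b))" by (rule dot_Xt)
  also have "\<dots> = dot N (z a) (z b) - dot N (z a) ?r" by (simp add: dot_diff_right)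
  finally have "\<sigma> a * (dot d (h a) (h b) - of_bool (a = b)) = - dot N (z a) ?r"
    by (simp add: dot_z assms right_diff_distrib)
  hence "\<bar>\<sigma> a * (dot d (h a) (h b) - of_bool (a = b))\<bar> = \<bar>dot N (z a) ?r\<bar>"
    by simp
  hence "\<sigma> a * \<bar>dot d (h a) (h b) - of_bool (a = b)\<bar> = \<bar>dot N (z a) ?r\<bar>"
    unfolding abs_mult using p by simp
  also have "\<dots> \<le> sqrt (\<sigma> a) * \<rho>"
    using assms p by (intro order_trans[OF abs_dot_le] mult_mono) (auto simp: nrm_z)
  finally have "\<bar>dot d (h a) (h b) - of_bool (a = b)\<bar> \<le> sqrt (\<sigma> a) * \<rho> / \<sigma> a"
    using p by (simp add: field_simps)
  also have "\<dots> = \<rho> / sqrt (\<sigma> a)" using p by (simp add: divide_simps)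
  finally show ?thesis .
qed

end

context spectral_perturbation
begin

text \<open>The bound of \<open>residual\<close> at the smallest possible eigenvalue \<gamma> / 2,
  which makes it uniform in the column.\<close>

definition \<rho> :: real where "\<rho> = (\<tau> * \<Gamma> + \<nu>\<^sup>2) / (\<gamma> / 2 * sqrt (\<gamma> / 2))"

lemma \<rho>_nonneg: "0 \<le> \<rho>"
  using bounds \<gamma>_pos by (simp add: \<rho>_def)

lemma residual_le:
  assumes "a < d"
  shows "nrm N (\<lambda>i. z a i - mv d X (h a) i) \<le> \<rho>"
proof -
  have "nrm N (\<lambda>i. z a i - mv d X (h a) i) \<le> (\<tau> * \<Gamma> + \<nu>\<^sup>2) / (\<sigma> a * sqrt (\<sigma> a))"
    using residual[OF assms] by (simp add: add_divide_distrib)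
  also have "\<dots> \<le> \<rho>"
    unfolding \<rho>_def using \<sigma>_lower[OF assms] \<gamma>_pos bounds
    by (intro divide_left_mono mult_mono real_sqrt_le_mono mult_pos_pos) auto
  finally show ?thesis .
qed

text \<open>Passing from \<open>h\<close> to its orthonormalisation costs \<Gamma> K \<rho> /
  sqrt(\<gamma> / 2). In the application \<Gamma> and sqrt \<gamma> both grow like sqrt s, so the
  order of the error stays that of \<rho>.\<close>

lemma aligned:
  assumes gs: "gram_schmidt_modulus d d K \<eta>\<^sub>0" and small: "\<rho> / sqrt (\<gamma> / 2) \<le> \<eta>\<^sub>0"
  shows "a < d \<Longrightarrow> b < d \<Longrightarrow> dot d (gram_schmidt_vec d h a) (gram_schmidt_vec d h b) = of_bool (a = b)"
    and "a < d \<Longrightarrow> nrm N (\<lambda>i. z a i - mv d X (gram_schmidt_vec d h a) i) \<le> \<rho> + \<Gamma> * (K * (\<rho> / sqrt (\<gamma> / 2)))"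
proof -
  have 0: "0 \<le> \<rho> / sqrt (\<gamma> / 2)" using \<rho>_nonneg \<gamma>_pos by simp
  have 1: "\<bar>dot d (h a) (h b) - of_bool (a = b)\<bar> \<le> \<rho> / sqrt (\<gamma> / 2)" if "a < d" "b < d" for a b
  proof -
    have "\<bar>dot d (h a) (h b) - of_bool (a = b)\<bar> \<le> \<rho> / sqrt (\<sigma> a)"
      using that by (intro nearly_orthonormal residual_le)
    also have "\<dots> \<le> \<rho> / sqrt (\<gamma> / 2)"
      using \<sigma>_lower[OF that(1)] \<rho>_nonneg \<gamma>_pos by (intro divide_left_mono real_sqrt_le_mono mult_pos_pos) auto
    finally show ?thesis .
  qed
  show "a < d \<Longrightarrow> b < d \<Longrightarrow> dot d (gram_schmidt_vec d h a) (gram_schmidt_vec d h b) = of_bool (a = b)"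
    using gram_schmidt_modulusD(1)[OF gs 0 small, of h a b] 1 by blast
  assume a: "a < d"
  have w: "nrm d (\<lambda>i. h a i - gram_schmidt_vec d h a i) \<le> K * (\<rho> / sqrt (\<gamma> / 2))"
    using gram_schmidt_modulusD(2)[OF gs 0 small 1 a] by (simp add: nrm_minus_commute)
  have "nrm N (\<lambda>i. z a i - mv d X (gram_schmidt_vec d h a) i)
      \<le> nrm N (\<lambda>i. z a i - mv d X (h a) i) + nrm N (\<lambda>i. mv d X (h a) i - mv d X (gram_schmidt_vec d h a) i)"
    by (rule nrm_triangle_diff)
  also have "nrm N (\<lambda>i. mv d X (h a) i - mv d X (gram_schmidt_vec d h a) i)
      = nrm N (mv d X (\<lambda>i. h a i - gram_schmidt_vec d h a i))"
    by (simp add: mv_diff)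
  also have "\<dots> \<le> \<Gamma> * nrm d (\<lambda>i. h a i - gram_schmidt_vec d h a i)" by (rule gram_upper)
  also have "\<dots> \<le> \<Gamma> * (K * (\<rho> / sqrt (\<gamma> / 2)))" using w bounds by (intro mult_left_mono) auto
  also note residual_le[OF a]
  finally show "nrm N (\<lambda>i. z a i - mv d X (gram_schmidt_vec d h a) i) \<le> \<rho> + \<Gamma> * (K * (\<rho> / sqrt (\<gamma> / 2)))"
    by simp
qed

end

section \<open>Orthonormal frames and least squares with a perturbed design matrix\<close>

lemma orthonormal_complete:
  fixes w :: "nat \<Rightarrow> nat \<Rightarrow> real"
  assumes "\<And>a b. a < d \<Longrightarrow> b < d \<Longrightarrow> dot d (w a) (w b) = of_bool (a = b)" and "i < d" "j < d"
  shows "(\<Sum>a<d. w a i * w a j) = of_bool (i = j)"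
proof -
  define W where "W = mat d d (\<lambda>(i, a). w a i)"
  have W: "W \<in> carrier_mat d d" "W\<^sup>T \<in> carrier_mat d d" by (simp_all add: W_def)
  have "W\<^sup>T * W = 1\<^sub>m d"
    by (intro eq_matI) (auto simp: W_def scalar_prod_def dot_def[symmetric] atLeast0LessThan assms(1))
  hence "W * W\<^sup>T = 1\<^sub>m d" using mat_mult_left_right_inverse[OF W(2,1)] by simp
  hence "(W * W\<^sup>T) $$ (i, j) = of_bool (i = j)" using assms by simp
  thus ?thesis using assms(2,3) by (simp add: W_def scalar_prod_def atLeast0LessThan)
qed

lemma nrm_orthonormal_combination:
  assumes "\<And>a b. a < d \<Longrightarrow> b < d \<Longrightarrow> dot n (w a) (w b) = of_bool (a = b)"
  shows "nrm n (\<lambda>i. \<Sum>a<d. c a * w a i) = nrm d c"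
proof -
  have "dot n (\<lambda>i. \<Sum>a<d. c a * w a i) (\<lambda>i. \<Sum>b<d. c b * w b i)
      = (\<Sum>a<d. c a * (\<Sum>b<d. c b * dot n (w a) (w b)))"
    by (simp add: dot_sum_left dot_sum_right dot_scale_left dot_scale_right sum_distrib_left)
  also have "\<dots> = (\<Sum>a<d. c a * (\<Sum>b<d. c b * of_bool (a = b)))"
    by (intro sum.cong refl arg_cong2[where f = "(*)"]) (auto simp: assms)
  also have "\<dots> = dot d c c"
    unfolding dot_def by (intro sum.cong refl) (auto simp: of_bool_def if_distrib cong: if_cong)
  finally show ?thesis by (simp add: nrm_def)
qed

lemma nrm_combination_le:
  assumes "\<And>a. a < d \<Longrightarrow> nrm n (f a) \<le> \<rho>"
  shows "nrm n (\<lambda>p. \<Sum>a<d. c a * f a p) \<le> real d * \<rho> * nrm d c"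
proof -
  have "nrm n (\<lambda>p. \<Sum>a<d. c a * f a p) \<le> (\<Sum>a<d. nrm n (\<lambda>p. c a * f a p))"
    by (rule nrm_sum_le)
  also have "\<dots> \<le> (\<Sum>a<d. \<rho> * nrm d c)"
  proof (intro sum_mono)
    fix a assume a: "a \<in> {..<d}"
    have "\<bar>c a\<bar> * nrm n (f a) \<le> nrm d c * \<rho>"
      using a assms by (intro mult_mono abs_le_nrm) auto
    thus "nrm n (\<lambda>p. c a * f a p) \<le> \<rho> * nrm d c" by (simp add: nrm_scale mult.commute)
  qed
  finally show ?thesis by simp
qed

text \<open>Z e equals X applied to the combination of the \<open>w a\<close> with coefficients e,
  up to an error of norm at most d \<rho> |e|, and this combination has the norm of e.\<close>

lemma least_squares_lower:
  assumes orth: "\<And>a b. a < d \<Longrightarrow> b < d \<Longrightarrow> dot d (w a) (w b) = of_bool (a = b)"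
    and near: "\<And>a. a < d \<Longrightarrow> nrm s (\<lambda>p. Z p a - dot d (x p) (w a)) \<le> \<rho>"
    and gram: "\<And>c. \<kappa> * nrm d c \<le> nrm s (mv d x c)"
  shows "(\<kappa> - d * \<rho>) * nrm d e \<le> nrm s (mv d Z e)"
proof -
  define we where "we = (\<lambda>i. \<Sum>a<d. e a * w a i)"
  have "mv d Z e = (\<lambda>p. mv d x we p + (\<Sum>a<d. e a * (Z p a - dot d (x p) (w a))))"
  proof
    fix p
    have "mv d x we p = (\<Sum>a<d. e a * dot d (x p) (w a))"
      using dot_sum_right[of d "x p" "\<lambda>a i. e a * w a i" "{..<d}"]
      by (simp add: we_def dot_scale_right mv_def dot_def[of d "x p" "\<lambda>i. \<Sum>a<d. e a * w a i"])
    thus "mv d Z e p = mv d x we p + (\<Sum>a<d. e a * (Z p a - dot d (x p) (w a)))"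
      by (simp add: right_diff_distrib sum_subtractf) (simp add: mv_def mult.commute)
  qed
  hence "nrm s (mv d x we) \<le> nrm s (mv d Z e) + nrm s (\<lambda>p. \<Sum>a<d. e a * (Z p a - dot d (x p) (w a)))"
    using nrm_diff_le[of s "mv d Z e" "\<lambda>p. \<Sum>a<d. e a * (Z p a - dot d (x p) (w a))"] by simp
  moreover have "nrm s (\<lambda>p. \<Sum>a<d. e a * (Z p a - dot d (x p) (w a))) \<le> d * \<rho> * nrm d e"
    by (intro nrm_combination_le near)
  moreover have "nrm d we = nrm d e"
    unfolding we_def by (rule nrm_orthonormal_combination) (rule orth)
  ultimately show ?thesis using gram[of we] by (simp add: left_diff_distrib)
qed

text \<open>Let y' be the coordinates of y in the frame and D = Z y' - X y. The normal equations
  turn Z^T Z (yh - y') into Z^T \<epsilon> - Z^T D. Pairing with yh - y' itself and using the lower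
  bound \<open>\<kappa>'\<close> on Z gives the estimate without inverting a matrix.\<close>

lemma least_squares_error:
  assumes orth: "\<And>a b. a < d \<Longrightarrow> b < d \<Longrightarrow> dot d (w a) (w b) = of_bool (a = b)"
    and near: "\<And>a. a < d \<Longrightarrow> nrm s (\<lambda>p. Z p a - dot d (x p) (w a)) \<le> \<rho>"
    and gram: "\<And>c. \<kappa> * nrm d c \<le> nrm s (mv d x c)"
    and \<kappa>: "0 < \<kappa>'" "\<kappa>' \<le> \<kappa> - d * \<rho>" and "0 \<le> \<rho>"
    and col: "\<And>a. a < d \<Longrightarrow> nrm s (\<lambda>p. Z p a) \<le> B"
    and noise: "\<And>a. a < d \<Longrightarrow> \<bar>dot s (\<lambda>p. Z p a) \<epsilon>\<bar> \<le> T"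
    and y: "nrm d y \<le> 1"
    and normal: "\<And>a. a < d \<Longrightarrow> dot s (\<lambda>p. Z p a) (mv d Z yh) = dot s (\<lambda>p. Z p a) (\<lambda>p. dot d (x p) y + \<epsilon> p)"
  shows "nrm d (\<lambda>a. yh a - dot d (w a) y) \<le> d * (T + B * (d * \<rho>)) / \<kappa>'\<^sup>2"
proof -
  define y' where "y' = (\<lambda>a. dot d (w a) y)"
  define e where "e = (\<lambda>a. yh a - y' a)"
  define D where "D = (\<lambda>p. \<Sum>a<d. y' a * (Z p a - dot d (x p) (w a)))"
  have y_exp: "y i = (\<Sum>a<d. y' a * w a i)" if "i < d" for i
    unfolding y'_def by (rule dot_expand[OF orthonormal_complete[OF orth] that])
  have "nrm d y' = nrm d (\<lambda>i. \<Sum>a<d. y' a * w a i)"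
    by (rule nrm_orthonormal_combination[symmetric]) (rule orth)
  also have "\<dots> = nrm d y" by (intro nrm_cong) (simp add: y_exp)
  finally have y'1: "nrm d y' \<le> 1" using y by simp
  have Zy: "mv d Z y' p = dot d (x p) y + D p" for p
  proof -
    have "dot d (x p) y = dot d (x p) (\<lambda>i. \<Sum>a<d. y' a * w a i)"
      by (intro dot_cong) (simp_all add: y_exp)
    also have "\<dots> = (\<Sum>a<d. y' a * dot d (x p) (w a))"
      by (simp add: dot_sum_right dot_scale_right)
    finally show ?thesis
      by (simp add: D_def mv_def right_diff_distrib sum_subtractf mult.commute)
  qed
  have "nrm s D \<le> d * \<rho> * nrm d y'"
    unfolding D_def by (intro nrm_combination_le near)
  also have "\<dots> \<le> d * \<rho> * 1" using y'1 \<open>0 \<le> \<rho>\<close> by (intro mult_left_mono) auto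
  finally have Dn: "nrm s D \<le> d * \<rho>" by simp
  have Ze: "\<bar>dot s (\<lambda>p. Z p a) (mv d Z e)\<bar> \<le> T + B * (d * \<rho>)" if a: "a < d" for a
  proof -
    have "mv d Z e = (\<lambda>p. mv d Z yh p - (dot d (x p) y + D p))"
      unfolding e_def mv_diff by (simp add: Zy)
    hence "dot s (\<lambda>p. Z p a) (mv d Z e) = dot s (\<lambda>p. Z p a) \<epsilon> - dot s (\<lambda>p. Z p a) D"
      using normal[OF a] by (simp add: dot_diff_right dot_add_right)
    moreover have "\<bar>dot s (\<lambda>p. Z p a) D\<bar> \<le> B * (d * \<rho>)"
      using col[OF a] Dn order_trans[OF nrm_nonneg col[OF a]] by (intro order_trans[OF abs_dot_le mult_mono]) auto
    ultimately show ?thesis using noise[OF a] by linarith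
  qed
  have "(\<kappa>' * nrm d e)\<^sup>2 \<le> (nrm s (mv d Z e))\<^sup>2"
  proof (rule power_mono)
    have "\<kappa>' * nrm d e \<le> (\<kappa> - d * \<rho>) * nrm d e" using \<kappa> by (intro mult_right_mono) auto
    also have "\<dots> \<le> nrm s (mv d Z e)"
      by (rule least_squares_lower) (fact orth near gram)+
    finally show "\<kappa>' * nrm d e \<le> nrm s (mv d Z e)" .
  qed (use \<kappa> in auto)
  also have "(nrm s (mv d Z e))\<^sup>2 = (\<Sum>a<d. e a * dot s (\<lambda>p. Z p a) (mv d Z e))"
  proof -
    have "(nrm s (mv d Z e))\<^sup>2 = dot s (\<lambda>p. \<Sum>a<d. e a * Z p a) (mv d Z e)"
      unfolding dot_self[symmetric] by (intro dot_cong) (simp_all add: mv_def mult.commute)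
    thus ?thesis by (simp add: dot_sum_left dot_scale_left)
  qed
  also have "\<dots> \<le> (\<Sum>a<d. nrm d e * (T + B * (d * \<rho>)))"
  proof (intro sum_mono)
    fix a assume a: "a \<in> {..<d}"
    have "e a * dot s (\<lambda>p. Z p a) (mv d Z e) \<le> \<bar>e a\<bar> * \<bar>dot s (\<lambda>p. Z p a) (mv d Z e)\<bar>"
      by (simp add: abs_mult[symmetric])
    also have "\<dots> \<le> nrm d e * (T + B * (d * \<rho>))"
      using a by (intro mult_mono abs_le_nrm Ze) auto
    finally show "e a * dot s (\<lambda>p. Z p a) (mv d Z e) \<le> nrm d e * (T + B * (d * \<rho>))" .
  qed
  finally have main: "\<kappa>'\<^sup>2 * (nrm d e * nrm d e) \<le> (d * (T + B * (d * \<rho>))) * nrm d e"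
    by (simp add: power_mult_distrib power2_eq_square ac_simps)
  \<comment> \<open>\<open>T\<close> and \<open>B\<close> come without a sign; for d > 0 the bound
    \<open>Ze\<close> at index 0 shows that the expression is non-negative.\<close>
  have nn: "0 \<le> d * (T + B * (d * \<rho>))"
  proof (cases "d = 0")
    case False
    thus ?thesis using Ze[of 0] by (intro mult_nonneg_nonneg) auto
  qed simp
  show ?thesis
  proof (cases "nrm d e = 0")
    case True
    thus ?thesis using nn unfolding e_def y'_def by simp
  next
    case False
    hence "0 < nrm d e" using nrm_nonneg[of d e] by linarith
    hence "\<kappa>'\<^sup>2 * nrm d e \<le> d * (T + B * (d * \<rho>))"
      using main by (simp add: mult.assoc[symmetric])
    thus ?thesis using \<kappa> unfolding e_def y'_def by (simp add: pos_le_divide_eq mult.commute)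
  qed
qed

section \<open>Concentration for independent Bernoulli edges\<close>

lemma hoeffding_Pi_pmf_bernoulli:
  fixes a p :: "'i \<Rightarrow> real"
  assumes I: "finite I" "T \<subseteq> I" and p: "\<And>i. i \<in> T \<Longrightarrow> p i \<in> {0..1}"
    and V: "(\<Sum>i\<in>T. (a i)\<^sup>2) \<le> V" and "0 < V" "0 < t"
  shows "measure_pmf.prob (Pi_pmf I False (\<lambda>i. bernoulli_pmf (p i)))
      {E. t \<le> \<bar>\<Sum>i\<in>T. a i * (of_bool (E i) - p i)\<bar>} \<le> 2 * exp (- 2 * t\<^sup>2 / V)"
proof (cases "(\<Sum>i\<in>T. (a i)\<^sup>2) = 0")
  \<comment> \<open>The exponent in Hoeffding's inequality divides by the sum of squares. If all
    coefficients vanish, the event is empty because t > 0.\<close>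
  case True
  have "finite T" using I finite_subset by blast
  with True have "\<forall>i\<in>T. a i = 0" by (simp add: sum_nonneg_eq_0_iff)
  hence "{E :: 'i \<Rightarrow> bool. t \<le> \<bar>\<Sum>i\<in>T. a i * (of_bool (E i) - p i)\<bar>} = {}"
    using \<open>0 < t\<close> by simp
  thus ?thesis by (simp only: measure_empty) simp
next
  case False
  define P where "P = Pi_pmf I False (\<lambda>i. bernoulli_pmf (p i))"
  have fT: "finite T" using I finite_subset by blast
  have pos: "0 < (\<Sum>i\<in>T. (a i)\<^sup>2)" using False by (simp add: sum_nonneg less_le)
  have ind: "prob_space.indep_vars (measure_pmf P) (\<lambda>_. borel) (\<lambda>i E. a i * of_bool (E i)) T"
    unfolding P_def
    by (rule prob_space.indep_vars_subset[OF measure_pmf.prob_space_axioms _ I(2)],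
        rule prob_space.indep_vars_compose2[OF measure_pmf.prob_space_axioms indep_vars_Pi_pmf[OF I(1)]]) simp
  \<comment> \<open>A summand takes the values 0 and \<open>a i\<close>, so its range has length |a
    i| for either sign of \<open>a i\<close>.\<close>
  interpret H: indep_interval_bounded_random_variables "measure_pmf P" T "\<lambda>i E. a i * of_bool (E i)"
      "\<lambda>i. min 0 (a i)" "\<lambda>i. max 0 (a i)"
    by (unfold_locales) (auto simp: fT ind)
  interpret H: Hoeffding_ineq "measure_pmf P" T "\<lambda>i E. a i * of_bool (E i)"
      "\<lambda>i. min 0 (a i)" "\<lambda>i. max 0 (a i)" "\<Sum>i\<in>T. measure_pmf.expectation P (\<lambda>E. a i * of_bool (E i))"
    by unfold_locales simp
  have ex: "measure_pmf.expectation P (\<lambda>E. a i * of_bool (E i)) = a i * p i" if "i \<in> T" for i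
  proof -
    have "measure_pmf.expectation P (\<lambda>E. a i * of_bool (E i))
        = measure_pmf.expectation (map_pmf (\<lambda>E. E i) P) (\<lambda>b. a i * of_bool b)"
      by simp
    also have "map_pmf (\<lambda>E. E i) P = bernoulli_pmf (p i)"
      using that I by (auto simp: P_def Pi_pmf_component)
    finally show ?thesis using p[OF that] by simp
  qed
  have sq: "(max 0 (a i) - min 0 (a i))\<^sup>2 = (a i)\<^sup>2" for i by (auto simp: max_def min_def)
  have \<mu>: "(\<Sum>i\<in>T. measure_pmf.expectation P (\<lambda>E. a i * of_bool (E i))) = (\<Sum>i\<in>T. a i * p i)"
    by (intro sum.cong refl ex)
  have "{E. t \<le> \<bar>\<Sum>i\<in>T. a i * (of_bool (E i) - p i)\<bar>} =
      {E. t \<le> \<bar>(\<Sum>i\<in>T. a i * of_bool (E i)) - (\<Sum>i\<in>T. measure_pmf.expectation P (\<lambda>E. a i * of_bool (E i)))\<bar>}"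
    unfolding \<mu> by (simp add: right_diff_distrib sum_subtractf)
  hence "measure_pmf.prob P {E. t \<le> \<bar>\<Sum>i\<in>T. a i * (of_bool (E i) - p i)\<bar>} \<le> 2 * exp (- 2 * t\<^sup>2 / (\<Sum>i\<in>T. (a i)\<^sup>2))"
    using H.Hoeffding_ineq_abs_ge[of t] \<open>0 < t\<close> pos by (simp add: sq)
  also have "\<dots> \<le> 2 * exp (- 2 * t\<^sup>2 / V)"
    using V pos \<open>0 < V\<close> by (simp add: divide_left_mono)
  finally show ?thesis unfolding P_def .
qed

text \<open>Conditioning is expressed through the product structure: fix the coordinates outside T,
  on which alone the coefficients depend, and then draw those in T. For each fixed outside part the
  coefficients are constants and the plain inequality applies; averaging keeps the bound.\<close>

lemma hoeffding_conditional:
  fixes a :: "('i \<Rightarrow> bool) \<Rightarrow> 'i \<Rightarrow> real"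
  assumes I: "finite I" "T \<subseteq> I" and p: "\<And>i. i \<in> T \<Longrightarrow> p i \<in> {0..1}"
    and a: "\<And>E E'. (\<And>i. i \<notin> T \<Longrightarrow> E i = E' i) \<Longrightarrow> a E = a E'"
    and V: "\<And>E. (\<Sum>i\<in>T. (a E i)\<^sup>2) \<le> V" and "0 < V" "0 < t"
  shows "measure_pmf.prob (Pi_pmf I False (\<lambda>i. bernoulli_pmf (p i)))
      {E. t \<le> \<bar>\<Sum>i\<in>T. a E i * (of_bool (E i) - p i)\<bar>} \<le> 2 * exp (- 2 * t\<^sup>2 / V)"
proof -
  let ?b = "\<lambda>i. bernoulli_pmf (p i)" and ?S = "{E. t \<le> \<bar>\<Sum>i\<in>T. a E i * (of_bool (E i) - p i)\<bar>}"
  define h :: "('i \<Rightarrow> bool) \<Rightarrow> ('i \<Rightarrow> bool) \<Rightarrow> 'i \<Rightarrow> bool" where "h = (\<lambda>g f i. if i \<in> T then f i else g i)"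
  have fT: "finite T" using I finite_subset by blast
  have "Pi_pmf (T \<union> (I - T)) False ?b =
      map_pmf (\<lambda>(f, g) x. if x \<in> T then f x else g x) (pair_pmf (Pi_pmf T False ?b) (Pi_pmf (I - T) False ?b))"
    using I fT by (intro Pi_pmf_union) auto
  also have "\<dots> = bind_pmf (Pi_pmf (I - T) False ?b) (\<lambda>g. map_pmf (h g) (Pi_pmf T False ?b))"
    unfolding pair_pmf_def map_pmf_def h_def
    by (subst bind_commute_pmf) (simp add: bind_assoc_pmf bind_return_pmf)
  also have "T \<union> (I - T) = I" using I by auto
  finally have P: "Pi_pmf I False ?b = bind_pmf (Pi_pmf (I - T) False ?b) (\<lambda>g. map_pmf (h g) (Pi_pmf T False ?b))" .
  have "measure_pmf.prob (map_pmf (h g) (Pi_pmf T False ?b)) ?S \<le> 2 * exp (- 2 * t\<^sup>2 / V)" for g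
  proof -
    have aa: "a (h g f) = a (h g (\<lambda>_. False))" for f by (rule a) (simp add: h_def)
    have "h g -` ?S = {f. t \<le> \<bar>\<Sum>i\<in>T. a (h g (\<lambda>_. False)) i * (of_bool (h g f i) - p i)\<bar>}"
      unfolding vimage_def mem_Collect_eq by (rule Collect_cong) (subst aa, rule refl)
    also have "\<dots> = {f. t \<le> \<bar>\<Sum>i\<in>T. a (h g (\<lambda>_. False)) i * (of_bool (f i) - p i)\<bar>}"
      by (simp add: h_def)
    finally show ?thesis
      using hoeffding_Pi_pmf_bernoulli[of T T p "a (h g (\<lambda>_. False))" V t] fT p V \<open>0 < V\<close> \<open>0 < t\<close> by simp
  qed
  hence "emeasure (map_pmf (h g) (Pi_pmf T False ?b)) ?S \<le> ennreal (2 * exp (- 2 * t\<^sup>2 / V))" for g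
    unfolding measure_pmf.emeasure_eq_measure by (rule ennreal_leI)
  hence "emeasure (measure_pmf (Pi_pmf I False ?b)) ?S
      \<le> (\<integral>\<^sup>+g. ennreal (2 * exp (- 2 * t\<^sup>2 / V)) \<partial>measure_pmf (Pi_pmf (I - T) False ?b))"
    unfolding P emeasure_bind_pmf by (intro nn_integral_mono)
  also have "\<dots> = ennreal (2 * exp (- 2 * t\<^sup>2 / V))"
    by simp
  finally show ?thesis by (simp add: measure_pmf.emeasure_eq_measure)
qed

text \<open>In the application the sums run over vertices while the independent variables are edges;
  \<open>e\<close> assigns to each vertex its edge.\<close>

lemma hoeffding_indexed:
  fixes a :: "('i \<Rightarrow> bool) \<Rightarrow> 'r \<Rightarrow> real"
  assumes I: "finite I" and e: "inj_on e R" "e ` R \<subseteq> I" and p: "\<And>r. r \<in> R \<Longrightarrow> p (e r) \<in> {0..1}"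
    and a: "\<And>E E'. (\<And>i. i \<notin> e ` R \<Longrightarrow> E i = E' i) \<Longrightarrow> a E = a E'"
    and V: "\<And>E. (\<Sum>r\<in>R. (a E r)\<^sup>2) \<le> V" and "0 < V" "0 < t"
  shows "measure_pmf.prob (Pi_pmf I False (\<lambda>i. bernoulli_pmf (p i)))
      {E. t \<le> \<bar>\<Sum>r\<in>R. a E r * (of_bool (E (e r)) - p (e r))\<bar>} \<le> 2 * exp (- 2 * t\<^sup>2 / V)"
proof -
  define b where "b = (\<lambda>E i. a E (inv_into R e i))"
  have b: "b E (e r) = a E r" if "r \<in> R" for E r using that e by (simp add: b_def)
  have eq: "(\<Sum>i\<in>e ` R. b E i * (of_bool (E i) - p i)) = (\<Sum>r\<in>R. a E r * (of_bool (E (e r)) - p (e r)))" for E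
    by (subst sum.reindex[OF e(1)]) (simp add: b)
  have V': "(\<Sum>i\<in>e ` R. (b E i)\<^sup>2) \<le> V" for E
    using V[of E] by (subst sum.reindex[OF e(1)]) (simp add: b)
  have b': "b E = b E'" if "\<And>i. i \<notin> e ` R \<Longrightarrow> E i = E' i" for E E'
    using a[OF that] by (simp add: b_def)
  have "measure_pmf.prob (Pi_pmf I False (\<lambda>i. bernoulli_pmf (p i)))
      {E. t \<le> \<bar>\<Sum>i\<in>e ` R. b E i * (of_bool (E i) - p i)\<bar>} \<le> 2 * exp (- 2 * t\<^sup>2 / V)"
    by (rule hoeffding_conditional[OF I e(2) _ b' V' \<open>0 < V\<close> \<open>0 < t\<close>]) (use p in auto)
  thus ?thesis unfolding eq .
qed

section \<open>The embeddings in coordinates\<close>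

lemma mult_mat_vec_mv:
  assumes "A \<in> carrier_mat n k" "v \<in> carrier_vec k" "i < n"
  shows "(A *\<^sub>v v) $ i = mv k (\<lambda>i j. A $$ (i, j)) (\<lambda>j. v $ j) i"
  using assms by (simp add: scalar_prod_def mv_def atLeast0LessThan)

text \<open>Squaring eliminates |A|: as A is symmetric, P^2 = A^2, so an eigenvector of P for
  \<sigma> is one of A^2 for \<sigma>^2. That \<sigma> is non-negative comes from the positive
  semidefiniteness of P.\<close>

lemma is_ASE_cases:
  assumes ase: "is_ASE d A Z" and A: "A \<in> carrier_mat N N" "A\<^sup>T = A" and d: "d \<le> N"
  obtains u \<sigma> where "Z \<in> carrier_mat N d"
    and "\<And>a b. a < N \<Longrightarrow> b < N \<Longrightarrow> dot N (u a) (u b) = of_bool (a = b)"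
    and "\<And>i j. i < N \<Longrightarrow> j < N \<Longrightarrow> (\<Sum>a<N. u a i * u a j) = of_bool (i = j)"
    and "\<And>a i. a < N \<Longrightarrow> i < N \<Longrightarrow>
           mv N (\<lambda>i j. A $$ (i, j)) (mv N (\<lambda>i j. A $$ (i, j)) (u a)) i = (\<sigma> a)\<^sup>2 * u a i"
    and "\<And>a. a < N \<Longrightarrow> 0 \<le> \<sigma> a"
    and "\<And>a b. a \<le> b \<Longrightarrow> b < N \<Longrightarrow> \<sigma> b \<le> \<sigma> a"
    and "\<And>i a. i < N \<Longrightarrow> a < d \<Longrightarrow> Z $$ (i, a) = u a i * sqrt (\<sigma> a)"
proof -
  obtain P U \<sigma> where *: "is_mat_abs A P \<and> U \<in> orthogonal_mats N \<and>
        (\<forall>i<N. eigenvector P (col U i) (\<sigma> i)) \<and>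
        (\<forall>i j. i \<le> j \<and> j < N \<longrightarrow> \<sigma> j \<le> \<sigma> i) \<and>
        Z = mat N d (\<lambda>(i, a). U $$ (i, a)) * mat_diag d (\<lambda>a. sqrt (\<sigma> a))"
    using ase unfolding is_ASE_def Let_def carrier_matD(1)[OF A(1)] by blast
  have P: "is_mat_abs A P" and U: "U \<in> orthogonal_mats N"
    and ev: "\<And>i. i < N \<Longrightarrow> eigenvector P (col U i) (\<sigma> i)"
    and mono: "\<And>i j. i \<le> j \<Longrightarrow> j < N \<Longrightarrow> \<sigma> j \<le> \<sigma> i"
    and Z: "Z = mat N d (\<lambda>(i, a). U $$ (i, a)) * mat_diag d (\<lambda>a. sqrt (\<sigma> a))"
    using * by blast+
  have Pc: "P \<in> carrier_mat N N" and psd: "\<And>v. v \<in> carrier_vec N \<Longrightarrow> 0 \<le> v \<bullet> (P *\<^sub>v v)"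
    and PP: "P * P = A * A"
    using P A unfolding is_mat_abs_def by auto
  have Uc: "U \<in> carrier_mat N N" and UU: "U\<^sup>T * U = 1\<^sub>m N"
    using U unfolding orthogonal_mats_def by auto
  have cU: "col U a \<in> carrier_vec N" for a using Uc by auto
  define u where "u = (\<lambda>a i. U $$ (i, a))"
  have colu: "(\<lambda>j. col U a $ j) i = u a i" if "a < N" "i < N" for a i
    using that Uc by (simp add: u_def)
  have orth: "dot N (u a) (u b) = of_bool (a = b)" if "a < N" "b < N" for a b
  proof -
    have "(U\<^sup>T * U) $$ (a, b) = dot N (u a) (u b)"
      using that Uc by (simp add: scalar_prod_def dot_def u_def atLeast0LessThan)
    thus ?thesis using that unfolding UU by (cases "a = b") simp_all
  qed
  have complete: "(\<Sum>a<N. u a i * u a j) = of_bool (i = j)" if "i < N" "j < N" for i j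
    by (rule orthonormal_complete[OF orth that])
  have Pu: "P *\<^sub>v col U a = \<sigma> a \<cdot>\<^sub>v col U a" if "a < N" for a
    using ev[OF that] by (simp add: eigenvector_def)
  have AAu: "A *\<^sub>v (A *\<^sub>v col U a) = (\<sigma> a)\<^sup>2 \<cdot>\<^sub>v col U a" if "a < N" for a
  proof -
    have "A *\<^sub>v (A *\<^sub>v col U a) = (P * P) *\<^sub>v col U a"
      unfolding PP by (rule assoc_mult_mat_vec[OF A(1) A(1) cU, symmetric])
    also have "\<dots> = P *\<^sub>v (\<sigma> a \<cdot>\<^sub>v col U a)" using Pc cU Pu[OF that] by simp
    also have "\<dots> = \<sigma> a \<cdot>\<^sub>v (\<sigma> a \<cdot>\<^sub>v col U a)"
      using Pc cU Pu[OF that] by (simp add: mult_mat_vec)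
    finally show ?thesis by (simp add: smult_smult_assoc power2_eq_square)
  qed
  have eig: "mv N (\<lambda>i j. A $$ (i, j)) (mv N (\<lambda>i j. A $$ (i, j)) (u a)) i = (\<sigma> a)\<^sup>2 * u a i"
    if "a < N" "i < N" for a i
  proof -
    have Ac: "A *\<^sub>v col U a \<in> carrier_vec N" by (rule mult_mat_vec_carrier[OF A(1) cU])
    have "(A *\<^sub>v (A *\<^sub>v col U a)) $ i
        = mv N (\<lambda>i j. A $$ (i, j)) (mv N (\<lambda>i j. A $$ (i, j)) (\<lambda>j. col U a $ j)) i"
      unfolding mult_mat_vec_mv[OF A(1) Ac that(2)]
      by (intro fun_cong[OF mv_cong]) (simp only: mult_mat_vec_mv[OF A(1) cU])
    also have "mv N (\<lambda>i j. A $$ (i, j)) (\<lambda>j. col U a $ j) = mv N (\<lambda>i j. A $$ (i, j)) (u a)"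
      by (intro mv_cong) (simp add: colu[simplified] that)
    finally show ?thesis using AAu[OF that(1)] that Uc by (simp add: u_def)
  qed
  have nonneg: "0 \<le> \<sigma> a" if "a < N" for a
  proof -
    have "col U a \<bullet> (P *\<^sub>v col U a) = \<sigma> a * (col U a \<bullet> col U a)"
      using Pu[OF that] cU[of a] by simp
    also have "col U a \<bullet> col U a = dot N (u a) (u a)"
      using that Uc by (simp add: scalar_prod_def dot_def u_def atLeast0LessThan)
    finally show ?thesis using psd[OF cU[of a]] orth[OF that that] by simp
  qed
  have Zc: "Z \<in> carrier_mat N d" unfolding Z by (rule mult_carrier_mat) auto
  have Zi: "Z $$ (i, a) = u a i * sqrt (\<sigma> a)" if "i < N" "a < d" for i a
    using that unfolding Z by (subst mat_diag_mult_right[of _ N]) (auto simp: u_def)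
  show thesis by (rule that[OF Zc orth complete eig nonneg mono Zi])
qed

section \<open>Blocks of the shuffled graphs and the normal equations\<close>

definition adj :: "(nat \<times> nat \<times> nat \<Rightarrow> bool) \<Rightarrow> nat \<Rightarrow> nat \<Rightarrow> nat \<Rightarrow> real" where
  "adj E k i j = (if i \<noteq> j \<and> E (k, min i j, max i j) then 1 else 0)"

lemma perm_mats_carrier: "Q \<in> perm_mats u \<Longrightarrow> Q \<in> carrier_mat u u"
  by (auto simp: perm_mats_def)

lemma perm_mats_orthogonal:
  assumes "Q \<in> perm_mats u"
  shows "Q\<^sup>T * Q = 1\<^sub>m u"
proof -
  obtain \<pi> where \<pi>: "\<pi> permutes {..<u}" and Q: "Q = mat u u (\<lambda>(i, j). if \<pi> i = j then 1 else 0)"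
    using assms by (auto simp: perm_mats_def)
  show ?thesis
  proof (rule eq_matI)
    fix i j assume ij: "i < dim_row (1\<^sub>m u :: real mat)" "j < dim_col (1\<^sub>m u :: real mat)"
    have "(Q\<^sup>T * Q) $$ (i, j) = (\<Sum>k<u. (if \<pi> k = i then 1 else 0) * (if \<pi> k = j then 1 else 0))"
      using ij by (simp add: Q scalar_prod_def atLeast0LessThan)
    also have "\<dots> = (\<Sum>k<u. (if k = i then 1 else 0) * (if k = j then 1 else 0))"
      by (rule sum.reindex_bij_betw[OF permutes_imp_bij[OF \<pi>], of "\<lambda>k. (if k = i then 1 else 0) * (if k = j then 1 else 0)"])
    also have "\<dots> = (\<Sum>k<u. if k = i then (if i = j then 1 else 0) else 0)"
      by (intro sum.cong) auto
    also have "\<dots> = (1\<^sub>m u) $$ (i, j)" using ij by simp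
    finally show "(Q\<^sup>T * Q) $$ (i, j) = (1\<^sub>m u) $$ (i, j)" .
  qed (auto simp: Q)
qed

text \<open>The shuffling matrix is the identity on the seeds. It therefore leaves the seed block
  untouched and acts on the cross block from the right only, by permuting the unseeded
  vertices.\<close>

lemma
  assumes Q: "Q k \<in> perm_mats u"
  shows seed_block_observed: "seed_block s (observed s u Q E k) = mat s s (\<lambda>(p, q). adj E k p q)"
    and cross_block_observed:
      "cross_block s (observed s u Q E k) = mat s u (\<lambda>(p, v). adj E k p (s + v)) * (Q k)\<^sup>T"
proof -
  let ?A = "adjacency (s + u) E k"
  define A11 where "A11 = mat s s (\<lambda>(p, q). adj E k p q)"
  define A12 where "A12 = mat s u (\<lambda>(p, v). adj E k p (s + v))"
  define A21 where "A21 = mat u s (\<lambda>(v, p). adj E k (s + v) p)"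
  define A22 where "A22 = mat u u (\<lambda>(v, w). adj E k (s + v) (s + w))"
  have c: "A11 \<in> carrier_mat s s" "A12 \<in> carrier_mat s u" "A21 \<in> carrier_mat u s" "A22 \<in> carrier_mat u u"
    by (simp_all add: A11_def A12_def A21_def A22_def)
  have Qc: "Q k \<in> carrier_mat u u" "(Q k)\<^sup>T \<in> carrier_mat u u" using perm_mats_carrier[OF Q] by auto
  have "?A = four_block_mat A11 A12 A21 A22"
    by (rule eq_matI) (auto simp: adjacency_def A11_def A12_def A21_def A22_def adj_def)
  moreover have "four_block_mat (1\<^sub>m s) (0\<^sub>m s u) (0\<^sub>m u s) (Q k) * four_block_mat A11 A12 A21 A22
      = four_block_mat A11 A12 (Q k * A21) (Q k * A22)"
    using c Qc by (subst mult_four_block_mat[of _ s s _ u _ u _ _ s _ u]) auto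
  moreover have "(four_block_mat (1\<^sub>m s) (0\<^sub>m s u) (0\<^sub>m u s) (Q k))\<^sup>T
      = four_block_mat (1\<^sub>m s) (0\<^sub>m s u) (0\<^sub>m u s) ((Q k)\<^sup>T)"
    using Qc by (subst transpose_four_block_mat[of _ s s _ u _ u]) auto
  moreover have "four_block_mat A11 A12 (Q k * A21) (Q k * A22) * four_block_mat (1\<^sub>m s) (0\<^sub>m s u) (0\<^sub>m u s) ((Q k)\<^sup>T)
      = four_block_mat A11 (A12 * (Q k)\<^sup>T) (Q k * A21) (Q k * A22 * (Q k)\<^sup>T)"
    using c Qc by (subst mult_four_block_mat[of _ s s _ u _ u _ _ s _ u]) auto
  ultimately have ob: "observed s u Q E k
      = four_block_mat A11 (A12 * (Q k)\<^sup>T) (Q k * A21) (Q k * A22 * (Q k)\<^sup>T)"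
    by (simp add: observed_def shuffle_graph_def Let_def)
  have "seed_block s (observed s u Q E k) = A11"
    unfolding ob using c Qc by (intro eq_matI) (auto simp: seed_block_def split_block_def Let_def)
  thus "seed_block s (observed s u Q E k) = mat s s (\<lambda>(p, q). adj E k p q)" by (simp add: A11_def)
  have "cross_block s (observed s u Q E k) = A12 * (Q k)\<^sup>T"
    unfolding ob using c Qc by (intro eq_matI) (auto simp: cross_block_def split_block_def Let_def)
  thus "cross_block s (observed s u Q E k) = mat s u (\<lambda>(p, v). adj E k p (s + v)) * (Q k)\<^sup>T"
    by (simp add: A12_def)
qed

text \<open>The omnibus matrix written without \<open>u\<close> and \<open>Q\<close>, since
  shuffling does not reach the seed blocks. That it ignores the edges to unseeded vertices is what
  later permits conditioning on the seed graphs.\<close>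

definition omni_adj :: "nat \<Rightarrow> nat \<Rightarrow> (nat \<times> nat \<times> nat \<Rightarrow> bool) \<Rightarrow> real mat" where
  "omni_adj m s E = omnibus m s (\<lambda>k. mat s s (\<lambda>(p, q). adj E k p q))"

lemma mod_div_less: "P < m * s \<Longrightarrow> P div s < m \<and> P mod s < (s::nat)"
  by (cases "s = 0") (auto simp: less_mult_imp_div_less)

lemma omnibus_observed:
  assumes "\<And>k. k < m \<Longrightarrow> Q k \<in> perm_mats u"
  shows "omnibus m s (\<lambda>k. seed_block s (observed s u Q E k)) = omni_adj m s E"
  unfolding omni_adj_def omnibus_def
  by (intro eq_matI) (auto simp: seed_block_observed assms mod_div_less)

lemma omni_adj_carrier: "omni_adj m s E \<in> carrier_mat (m * s) (m * s)"
  by (simp add: omni_adj_def omnibus_def)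

lemma adj_sym: "adj E k p q = adj E k q p"
  by (simp add: adj_def min.commute max.commute)

lemma omni_adj_index:
  assumes "P < m * s" "P' < m * s"
  shows "omni_adj m s E $$ (P, P')
    = (adj E (P div s) (P mod s) (P' mod s) + adj E (P' div s) (P mod s) (P' mod s)) / 2"
  using assms by (simp add: omni_adj_def omnibus_def mod_div_less)

lemma omni_adj_symmetric: "(omni_adj m s E)\<^sup>T = omni_adj m s E"
  using omni_adj_carrier[of m s E]
  by (intro eq_matI) (auto simp: omni_adj_index adj_sym add.commute)

lemma ASE_omni_adj:
  assumes "ASE_choice d ase" "d \<le> m * s"
  shows "is_ASE d (omni_adj m s E) (ase (omni_adj m s E))"
  using assms omni_adj_carrier omni_adj_symmetric unfolding ASE_choice_def by blast

text \<open>Injectivity of the seed embedding makes its Gram matrix invertible, so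
  \<open>mat_inverse\<close> returns a genuine inverse. The transpose of \<open>Q i\<close> cancels
  the shuffling inside the cross block, and row v of \<open>Y\<close> belongs to the true vertex
  v.\<close>

lemma oos_normal_equations:
  assumes Q: "\<And>k. k < m \<Longrightarrow> Q k \<in> perm_mats u" and i: "i < m" and v: "v < u"
    and inj: "\<And>c. nrm s (mv d (\<lambda>p a. ase (omni_adj m s E) $$ (i * s + p, a)) c) = 0 \<Longrightarrow> nrm d c = 0"
  defines "Z \<equiv> \<lambda>p a. ase (omni_adj m s E) $$ (i * s + p, a)"
  defines "Y \<equiv> (Q i)\<^sup>T * oos_embedding ase d m s (observed s u Q E) i"
  shows "Y \<in> carrier_mat u d"
    and "a < d \<Longrightarrow> dot s (\<lambda>p. Z p a) (mv d Z (\<lambda>a. Y $$ (v, a))) = dot s (\<lambda>p. Z p a) (\<lambda>p. adj E i p (s + v))"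
proof -
  define Zm where "Zm = mat s d (\<lambda>(p, a). Z p a)"
  define A12 where "A12 = mat s u (\<lambda>(p, v). adj E i p (s + v))"
  define G where "G = Zm\<^sup>T * Zm"
  have Zc: "Zm \<in> carrier_mat s d" and Ac: "A12 \<in> carrier_mat s u"
    by (simp_all add: Zm_def A12_def)
  hence Gc: "G \<in> carrier_mat d d" unfolding G_def by (intro mult_carrier_mat[of _ d s]) auto
  have Qc: "Q i \<in> carrier_mat u u" using perm_mats_carrier[OF Q[OF i]] .
  have Gi: "G $$ (a, b) = dot s (\<lambda>p. Z p a) (\<lambda>p. Z p b)" if "a < d" "b < d" for a b
    using that by (simp add: G_def Zm_def scalar_prod_def dot_def atLeast0LessThan)
  have Gmv: "mv d (\<lambda>a b. G $$ (a, b)) c a = dot s (\<lambda>p. Z p a) (mv d Z c)" if "a < d" for c a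
  proof -
    have "dot s (\<lambda>p. Z p a) (mv d Z c) = (\<Sum>b<d. c b * dot s (\<lambda>p. Z p a) (\<lambda>p. Z p b))"
      unfolding mv_def using dot_sum_right[of s "\<lambda>p. Z p a" "\<lambda>b p. c b * Z p b" "{..<d}"]
      by (simp add: mult.commute dot_scale_right)
    thus ?thesis using that by (simp add: mv_def Gi mult.commute)
  qed
  \<comment> \<open>A kernel vector x of G satisfies |Z x|^2 = x^T G x = 0, which injectivity
    excludes.\<close>
  have "det G \<noteq> 0"
  proof
    assume "det G = 0"
    then obtain x where x: "x \<in> carrier_vec d" "x \<noteq> 0\<^sub>v d" "G *\<^sub>v x = 0\<^sub>v d"
      using det_0_iff_vec_prod_zero[OF Gc] by auto
    define c where "c = (\<lambda>j. x $ j)"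
    have z: "dot s (\<lambda>p. Z p a) (mv d Z c) = 0" if "a < d" for a
      using x(3) mult_mat_vec_mv[OF Gc x(1) that] Gmv[OF that, of c] that by (simp add: c_def)
    have "(nrm s (mv d Z c))\<^sup>2 = dot s (\<lambda>p. \<Sum>a<d. c a * Z p a) (mv d Z c)"
      unfolding dot_self[symmetric] by (intro dot_cong) (simp_all add: mv_def mult.commute)
    also have "\<dots> = 0" by (simp add: dot_sum_left dot_scale_left z)
    finally have "nrm d c = 0" using inj unfolding Z_def by simp
    hence "x = 0\<^sub>v d" using x(1) by (intro eq_vecI) (auto simp: nrm_eq_0_iff c_def)
    thus False using x(2) by simp
  qed
  hence "mat_inverse G \<noteq> None"
    using mat_inverse(1)[OF Gc, of "()"] det_non_zero_imp_unit[OF Gc, of "()"] by blast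
  then obtain B where B: "mat_inverse G = Some B" by blast
  have BG: "B * G = 1\<^sub>m d" and Bc: "B \<in> carrier_mat d d" using mat_inverse(2)[OF Gc B] by auto
  have om: "omnibus m s (\<lambda>k. seed_block s (observed s u Q E k)) = omni_adj m s E"
    by (rule omnibus_observed) (rule Q)
  have Zemb: "seed_embedding ase d m s (observed s u Q E) i = Zm"
    unfolding seed_embedding_def Let_def om Zm_def Z_def ..
  have "oos_embedding ase d m s (observed s u Q E) i = (A12 * (Q i)\<^sup>T)\<^sup>T * Zm * B"
    unfolding oos_embedding_def Let_def Zemb cross_block_observed[of Q i u, OF Q[OF i]]
    using B by (simp add: G_def A12_def)
  also have "(A12 * (Q i)\<^sup>T)\<^sup>T = Q i * A12\<^sup>T"
    using Ac Qc transpose_mult[OF Ac, of "(Q i)\<^sup>T" u] by simp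
  finally have "Y = (Q i)\<^sup>T * (Q i * A12\<^sup>T * Zm * B)" by (simp add: Y_def)
  also have "\<dots> = ((Q i)\<^sup>T * Q i) * (A12\<^sup>T * Zm * B)"
    using Ac Qc Zc Bc by (simp add: assoc_mult_mat[of _ u u _ u _ d] assoc_mult_mat[of _ u u _ s _ d]
      assoc_mult_mat[of _ u s _ d _ d] assoc_mult_mat[of _ u u _ d _ d])
  also have "\<dots> = A12\<^sup>T * Zm * B"
    unfolding perm_mats_orthogonal[OF Q[OF i]] using Ac Zc Bc by (simp add: left_mult_one_mat[of _ u d])
  finally have Y: "Y = A12\<^sup>T * Zm * B" .
  show Yc: "Y \<in> carrier_mat u d" unfolding Y using Ac Zc Bc by (intro mult_carrier_mat) auto
  have "Y * G = A12\<^sup>T * Zm * (B * G)"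
    unfolding Y using Ac Zc Bc Gc by (intro assoc_mult_mat[of _ u d _ d _ d]) auto
  also have "\<dots> = A12\<^sup>T * Zm" unfolding BG using Ac Zc by (intro right_mult_one_mat[of _ u d]) auto
  finally have YG: "Y * G = A12\<^sup>T * Zm" .
  assume a: "a < d"
  have "dot s (\<lambda>p. Z p a) (mv d Z (\<lambda>b. Y $$ (v, b))) = (\<Sum>b<d. G $$ (a, b) * Y $$ (v, b))"
    using Gmv[OF a, of "\<lambda>b. Y $$ (v, b)"] by (simp add: mv_def)
  also have "\<dots> = (\<Sum>b<d. Y $$ (v, b) * G $$ (b, a))"
    using a by (intro sum.cong) (auto simp: Gi dot_commute)
  also have "\<dots> = (Y * G) $$ (v, a)"
    using v a Yc Gc by (simp add: scalar_prod_def atLeast0LessThan)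
  also have "\<dots> = dot s (\<lambda>p. Z p a) (\<lambda>p. adj E i p (s + v))"
    unfolding YG using v a by (simp add: Zm_def A12_def scalar_prod_def dot_def atLeast0LessThan mult.commute)
  finally show "dot s (\<lambda>p. Z p a) (mv d Z (\<lambda>a. Y $$ (v, a))) = dot s (\<lambda>p. Z p a) (\<lambda>p. adj E i p (s + v))" .
qed

section \<open>The noise of the omnibus matrix\<close>

lemma sum_blocks: "(\<Sum>P<m * s. f P) = (\<Sum>j<m. \<Sum>q<s. f (j * s + q))" for f :: "nat \<Rightarrow> real"
proof -
  have "(\<Sum>P<m * s. f P) = (\<Sum>j<m. sum f {j * s..<j * s + s})"
    by (rule sum.nat_group[symmetric])
  also have "\<dots> = (\<Sum>j<m. \<Sum>q<s. f (j * s + q))"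
  proof (rule sum.cong[OF refl])
    fix j
    have "sum f {0 + j * s..<s + j * s} = (\<Sum>q = 0..<s. f (q + j * s))"
      by (rule sum.shift_bounds_nat_ivl)
    thus "sum f {j * s..<j * s + s} = (\<Sum>q<s. f (j * s + q))"
      by (simp add: add.commute atLeast0LessThan)
  qed
  finally show ?thesis .
qed

lemma nrm_blocks_sq: "(nrm (m * s) f)\<^sup>2 = (\<Sum>i<m. (nrm s (\<lambda>p. f (i * s + p)))\<^sup>2)"
  by (simp add: dot_self[symmetric] dot_def sum_blocks)

text \<open>The factor m in place of sqrt m avoids roots in the constants and is harmless for fixed
  m.\<close>

lemma nrm_blocks_le:
  assumes "\<And>i. i < m \<Longrightarrow> nrm s (\<lambda>p. f (i * s + p)) \<le> \<beta>" "0 \<le> \<beta>"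
  shows "nrm (m * s) f \<le> real m * \<beta>"
proof (rule power2_le_imp_le)
  have "(nrm (m * s) f)\<^sup>2 \<le> (\<Sum>i<m. \<beta>\<^sup>2)"
    unfolding nrm_blocks_sq by (intro sum_mono power_mono assms) auto
  also have "\<dots> = real m * 1 * \<beta>\<^sup>2" by simp
  also have "\<dots> \<le> real m * real m * \<beta>\<^sup>2"
  proof (intro mult_right_mono)
    show "real m * 1 \<le> real m * real m" by (cases "m = 0") auto
  qed simp
  also have "\<dots> = (real m * \<beta>)\<^sup>2" by (simp add: power2_eq_square)
  finally show "(nrm (m * s) f)\<^sup>2 \<le> (real m * \<beta>)\<^sup>2" .
qed (use assms(2) in auto)

lemma nrm_block_le:
  assumes "j < m"
  shows "nrm s (\<lambda>q. f (j * s + q)) \<le> nrm (m * s) f"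
proof (rule power2_le_imp_le)
  show "(nrm s (\<lambda>q. f (j * s + q)))\<^sup>2 \<le> (nrm (m * s) f)\<^sup>2"
    unfolding nrm_blocks_sq using assms
    by (intro member_le_sum[of j "{..<m}" "\<lambda>i. (nrm s (\<lambda>p. f (i * s + p)))\<^sup>2"]) auto
qed simp

text \<open>The off-diagonal entries of \<open>N\<^sup>2\<close> are small, so \<open>N\<^sup>2\<close> is close to its diagonal in the norm of
  its absolute row sums. The resulting bound of order \<open>s\<^bsup>3/4\<^esup>\<close> on the operator norm of \<open>N\<close> is weaker
  than the optimal \<open>s\<^bsup>1/2\<^esup>\<close> but suffices.\<close>

lemma operator_norm_from_square:
  assumes sym: "\<And>p q. p < s \<Longrightarrow> q < s \<Longrightarrow> N p q = N q p"
    and bd: "\<And>p q. p < s \<Longrightarrow> q < s \<Longrightarrow> \<bar>N p q\<bar> \<le> 1"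
    and sq: "\<And>p q. p < s \<Longrightarrow> q < s \<Longrightarrow> p \<noteq> q \<Longrightarrow> \<bar>\<Sum>r<s. N p r * N r q\<bar> \<le> t" and t: "0 \<le> t"
  shows "nrm s (mv s N y) \<le> sqrt (real s * (1 + t)) * nrm s y"
proof (rule power2_le_imp_le)
  define N2 where "N2 = (\<lambda>p q. \<Sum>r<s. N p r * N r q)"
  \<comment> \<open>The bound t is granted on the diagonal too. The second part of the form is then
    the full product t (sum of |y p|)^2, which Cauchy-Schwarz bounds by t s |y|^2.\<close>
  have N2: "\<bar>N2 p q\<bar> \<le> real s * of_bool (p = q) + t" if "p < s" "q < s" for p q
  proof (cases "p = q")
    case True
    have "\<bar>N2 p q\<bar> \<le> (\<Sum>r<s. \<bar>N p r * N r q\<bar>)" unfolding N2_def by (rule sum_abs)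
    also have "\<dots> \<le> (\<Sum>r<s. 1)"
      by (intro sum_mono) (use bd that in \<open>auto simp: abs_mult intro!: mult_le_one\<close>)
    finally show ?thesis using True t by simp
  qed (use sq[OF that] in \<open>simp add: N2_def\<close>)
  have "(nrm s (mv s N y))\<^sup>2 = dot s y (mv s N (mv s N y))"
    by (simp add: dot_self[symmetric] mv_sym[OF sym])
  also have "\<dots> = (\<Sum>p<s. y p * (\<Sum>r<s. N p r * (\<Sum>q<s. N r q * y q)))"
    by (simp add: dot_def mv_def)
  also have "\<dots> = (\<Sum>p<s. \<Sum>q<s. y p * N2 p q * y q)"
  proof (rule sum.cong[OF refl])
    fix p
    have "(\<Sum>r<s. N p r * (\<Sum>q<s. N r q * y q)) = (\<Sum>r<s. \<Sum>q<s. N p r * N r q * y q)"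
      by (simp add: sum_distrib_left mult.assoc)
    also have "\<dots> = (\<Sum>q<s. N2 p q * y q)"
      by (subst sum.swap) (simp add: N2_def sum_distrib_right)
    finally show "y p * (\<Sum>r<s. N p r * (\<Sum>q<s. N r q * y q)) = (\<Sum>q<s. y p * N2 p q * y q)"
      by (simp add: sum_distrib_left mult.assoc)
  qed
  also have "\<dots> \<le> (\<Sum>p<s. \<Sum>q<s. (real s * of_bool (p = q) + t) * (\<bar>y p\<bar> * \<bar>y q\<bar>))"
  proof (intro sum_mono)
    fix p q assume "p \<in> {..<s}" "q \<in> {..<s}"
    hence "\<bar>N2 p q\<bar> * (\<bar>y p\<bar> * \<bar>y q\<bar>) \<le> (real s * of_bool (p = q) + t) * (\<bar>y p\<bar> * \<bar>y q\<bar>)"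
      by (intro mult_right_mono N2) auto
    moreover have "y p * N2 p q * y q \<le> \<bar>N2 p q\<bar> * (\<bar>y p\<bar> * \<bar>y q\<bar>)"
      using abs_ge_self[of "y p * N2 p q * y q"] by (simp add: abs_mult ac_simps)
    ultimately show "y p * N2 p q * y q \<le> (real s * of_bool (p = q) + t) * (\<bar>y p\<bar> * \<bar>y q\<bar>)" by linarith
  qed
  also have "\<dots> = (\<Sum>p<s. (\<Sum>q<s. real s * of_bool (p = q) * (\<bar>y p\<bar> * \<bar>y q\<bar>)) + (\<Sum>q<s. t * (\<bar>y p\<bar> * \<bar>y q\<bar>)))"
    by (simp add: distrib_right sum.distrib)
  also have "\<dots> = (\<Sum>p<s. real s * (y p * y p)) + t * ((\<Sum>p<s. \<bar>y p\<bar>) * (\<Sum>q<s. \<bar>y q\<bar>))"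
    unfolding sum.distrib
  proof (intro arg_cong2[where f = "(+)"] sum.cong refl)
    fix p assume "p \<in> {..<s}"
    hence "(\<Sum>q<s. real s * of_bool (p = q) * (\<bar>y p\<bar> * \<bar>y q\<bar>)) = (\<Sum>q<s. if q = p then real s * (\<bar>y p\<bar> * \<bar>y p\<bar>) else 0)"
      by (intro sum.cong) auto
    thus "(\<Sum>q<s. real s * of_bool (p = q) * (\<bar>y p\<bar> * \<bar>y q\<bar>)) = real s * (y p * y p)"
      using \<open>p \<in> {..<s}\<close> by simp
  next
    show "(\<Sum>p<s. \<Sum>q<s. t * (\<bar>y p\<bar> * \<bar>y q\<bar>)) = t * ((\<Sum>p<s. \<bar>y p\<bar>) * (\<Sum>q<s. \<bar>y q\<bar>))"
      unfolding sum_product by (simp only: sum_distrib_left)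
  qed
  also have "(\<Sum>p<s. real s * (y p * y p)) = real s * (nrm s y)\<^sup>2"
    by (simp add: dot_self[symmetric] dot_def sum_distrib_left)
  also have "(\<Sum>p<s. \<bar>y p\<bar>) * (\<Sum>q<s. \<bar>y q\<bar>) \<le> (sqrt (real s) * nrm s y) * (sqrt (real s) * nrm s y)"
    by (intro mult_mono sum_abs_le_nrm) (auto intro!: sum_nonneg)
  finally have "(nrm s (mv s N y))\<^sup>2 \<le> real s * (nrm s y)\<^sup>2 + t * (sqrt (real s) * nrm s y * (sqrt (real s) * nrm s y))"
    using t by (simp add: mult_left_mono)
  also have "\<dots> = real s * (1 + t) * (nrm s y)\<^sup>2"
    by (simp add: power2_eq_square algebra_simps)
  also have "\<dots> = (sqrt (real s * (1 + t)) * nrm s y)\<^sup>2"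
    using t by (simp add: power_mult_distrib)
  finally show "(nrm s (mv s N y))\<^sup>2 \<le> (sqrt (real s * (1 + t)) * nrm s y)\<^sup>2" .
qed (use t in simp)

definition edge_noise :: "nat \<Rightarrow> (nat \<Rightarrow> nat \<Rightarrow> real) \<Rightarrow> (nat \<times> nat \<times> nat \<Rightarrow> bool) \<Rightarrow> nat \<Rightarrow> nat \<Rightarrow> nat \<Rightarrow> real" where
  "edge_noise d X E k p q = (if p = q then 0 else of_bool (E (k, min p q, max p q)) - dot d (X p) (X q))"

text \<open>An adjacency matrix has zero diagonal, X X^T does not. This deterministic difference is
  kept apart from \<open>edge_noise\<close>, whose off-diagonal entries are the centred edge
  variables.\<close>

definition full_noise :: "nat \<Rightarrow> (nat \<Rightarrow> nat \<Rightarrow> real) \<Rightarrow> (nat \<times> nat \<times> nat \<Rightarrow> bool) \<Rightarrow> nat \<Rightarrow> nat \<Rightarrow> nat \<Rightarrow> real" where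
  "full_noise d X E k p q = edge_noise d X E k p q - of_bool (p = q) * dot d (X p) (X p)"

lemma adj_noise: "adj E k p q = dot d (X p) (X q) + full_noise d X E k p q"
  by (simp add: adj_def full_noise_def edge_noise_def)

lemma edge_noise_sym: "edge_noise d X E k p q = edge_noise d X E k q p"
  by (simp add: edge_noise_def min.commute max.commute dot_commute)

definition omni_noise :: "nat \<Rightarrow> nat \<Rightarrow> (nat \<Rightarrow> nat \<Rightarrow> real) \<Rightarrow> (nat \<times> nat \<times> nat \<Rightarrow> bool) \<Rightarrow> nat \<Rightarrow> nat \<Rightarrow> real" where
  "omni_noise d s X E P P' = (full_noise d X E (P div s) (P mod s) (P' mod s)
     + full_noise d X E (P' div s) (P mod s) (P' mod s)) / 2"

text \<open>All graphs share the mean X X^T off the diagonal, so averaging two of them leaves it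
  alone. The signal part of the omnibus matrix is the Gram matrix of m stacked copies of X, again of
  rank at most d.\<close>

lemma omni_adj_noise:
  assumes "P < m * s" "P' < m * s"
  shows "omni_adj m s E $$ (P, P') = dot d (X (P mod s)) (X (P' mod s)) + omni_noise d s X E P P'"
  using assms by (simp add: omni_adj_index omni_noise_def adj_noise[where d = d and X = X])

lemma omni_noise_sym: "omni_noise d s X E P P' = omni_noise d s X E P' P"
  using edge_noise_sym[of d X E "P div s" "P mod s" "P' mod s"] edge_noise_sym[of d X E "P' div s" "P mod s" "P' mod s"]
  by (simp add: omni_noise_def full_noise_def)

text \<open>Block (i, j) mixes graphs i and j, hence the bound is required for every graph on every
  block of v. One factor m comes from summing a row of blocks, the other from stacking the
  rows.\<close>

lemma nrm_omni_noise_le: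
  assumes s: "0 < s" and \<beta>: "0 \<le> \<beta>"
    and le: "\<And>k j. k < m \<Longrightarrow> j < m \<Longrightarrow> nrm s (mv s (full_noise d X E k) (\<lambda>q. v (j * s + q))) \<le> \<beta>"
  shows "nrm (m * s) (mv (m * s) (omni_noise d s X E) v) \<le> (real m)\<^sup>2 * \<beta>"
proof -
  let ?F = "\<lambda>k j. mv s (full_noise d X E k) (\<lambda>q. v (j * s + q))"
  have "nrm s (\<lambda>p. mv (m * s) (omni_noise d s X E) v (i * s + p)) \<le> real m * \<beta>" if i: "i < m" for i
  proof -
    have "mv (m * s) (omni_noise d s X E) v (i * s + p)
        = 1 / 2 * ((\<Sum>j<m. ?F i j p) + (\<Sum>j<m. ?F j j p))" if p: "p < s" for p
    proof -
      have "mv (m * s) (omni_noise d s X E) v (i * s + p) = (\<Sum>j<m. \<Sum>q<s.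
          (full_noise d X E i p q + full_noise d X E j p q) / 2 * v (j * s + q))"
        unfolding mv_def sum_blocks using p by (simp add: omni_noise_def)
      also have "\<dots> = (\<Sum>j<m. 1 / 2 * ?F i j p + 1 / 2 * ?F j j p)"
        unfolding mv_def sum_distrib_left sum.distrib[symmetric]
        by (intro sum.cong refl) (simp add: field_simps)
      also have "\<dots> = 1 / 2 * ((\<Sum>j<m. ?F i j p) + (\<Sum>j<m. ?F j j p))"
        by (simp only: sum.distrib sum_distrib_left[symmetric] distrib_left)
      finally show ?thesis .
    qed
    hence "nrm s (\<lambda>p. mv (m * s) (omni_noise d s X E) v (i * s + p))
        = nrm s (\<lambda>p. 1 / 2 * ((\<Sum>j<m. ?F i j p) + (\<Sum>j<m. ?F j j p)))"
      by (intro nrm_cong)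
    also have "\<dots> = 1 / 2 * nrm s (\<lambda>p. (\<Sum>j<m. ?F i j p) + (\<Sum>j<m. ?F j j p))"
      unfolding nrm_scale by simp
    finally have eq: "nrm s (\<lambda>p. mv (m * s) (omni_noise d s X E) v (i * s + p))
        = 1 / 2 * nrm s (\<lambda>p. (\<Sum>j<m. ?F i j p) + (\<Sum>j<m. ?F j j p))" .
    have "nrm s (\<lambda>p. (\<Sum>j<m. ?F i j p) + (\<Sum>j<m. ?F j j p))
        \<le> nrm s (\<lambda>p. \<Sum>j<m. ?F i j p) + nrm s (\<lambda>p. \<Sum>j<m. ?F j j p)"
      by (rule nrm_triangle)
    moreover have "nrm s (\<lambda>p. \<Sum>j<m. ?F i j p) \<le> (\<Sum>j<m. \<beta>)"
      using i by (intro order_trans[OF nrm_sum_le] sum_mono le) auto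
    moreover have "nrm s (\<lambda>p. \<Sum>j<m. ?F j j p) \<le> (\<Sum>j<m. \<beta>)"
      by (intro order_trans[OF nrm_sum_le] sum_mono le) auto
    ultimately show ?thesis unfolding eq by simp
  qed
  hence "nrm (m * s) (mv (m * s) (omni_noise d s X E) v) \<le> real m * (real m * \<beta>)"
    using \<beta> by (intro nrm_blocks_le) auto
  thus ?thesis by (simp add: power2_eq_square)
qed

text \<open>Vector a depends on the inputs up to a alone. This matters because
  \<open>frame_coeff\<close> and the coefficients \<open>h\<close> are compared only below index
  d.\<close>

lemma gram_schmidt_vec_cong:
  assumes "\<And>b. b \<le> a \<Longrightarrow> h b = h' b"
  shows "gram_schmidt_vec d h a = gram_schmidt_vec d h' a"
  using assms
proof (induction a rule: less_induct)
  case (less a)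
  have ha: "h a = h' a" by (rule less.prems) simp
  have gb: "gram_schmidt_vec d h b = gram_schmidt_vec d h' b" if "b < a" for b
    using that less.prems by (intro less.IH) auto
  have "(\<Sum>b<a. dot d (gram_schmidt_vec d h b) (h a) * gram_schmidt_vec d h b i) =
      (\<Sum>b<a. dot d (gram_schmidt_vec d h' b) (h' a) * gram_schmidt_vec d h' b i)" for i
    by (intro sum.cong) (simp_all add: ha gb)
  thus ?case by (subst (1 2) gram_schmidt_vec.simps) (simp add: ha)
qed

section \<open>The embedding on the good event\<close>

text \<open>These are the coefficients \<open>h\<close> of the perturbation argument with the
  eigenvalue eliminated: it is the squared norm of column a of \<open>Z\<close>. The frame thereby
  becomes a formula in the positions and the embedding, valid for every choice of
  eigenvectors.\<close>

definition frame_coeff :: "nat \<Rightarrow> nat \<Rightarrow> (nat \<Rightarrow> nat \<Rightarrow> real) \<Rightarrow> real mat \<Rightarrow> nat \<Rightarrow> nat \<Rightarrow> real" where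
  "frame_coeff m s X Z a c = (\<Sum>P<m * s. X (P mod s) c * Z $$ (P, a)) / (\<Sum>P<m * s. (Z $$ (P, a))\<^sup>2)"

definition frame :: "nat \<Rightarrow> nat \<Rightarrow> nat \<Rightarrow> (nat \<Rightarrow> nat \<Rightarrow> real) \<Rightarrow> real mat \<Rightarrow> nat \<Rightarrow> nat \<Rightarrow> real" where
  "frame d m s X Z = gram_schmidt_vec d (frame_coeff m s X Z)"

text \<open>In the numerator, 3 d m^3 stems from the product of m^2 * 3 d s log s and m sqrt s, and
  8 m^4 from the squared noise norm; the denominator is (g s / 2)^(3/2). The powers of s
  cancel.\<close>

definition residual_const :: "nat \<Rightarrow> nat \<Rightarrow> real \<Rightarrow> real" where
  "residual_const d m g = (3 * real d * real m ^ 3 + 8 * real m ^ 4) / (g / 2 * sqrt (g / 2))"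

definition alignment_const :: "nat \<Rightarrow> nat \<Rightarrow> real \<Rightarrow> real \<Rightarrow> real" where
  "alignment_const d m g K = residual_const d m g * (1 + m * K / sqrt (g / 2))"

text \<open>Randomness is reduced to inequalities about one fixed sample; t is the deviation granted
  by Hoeffding. In \<open>large\<close>, the third condition gives \<nu> < \<gamma> / 2, the fourth
  lets Gram-Schmidt apply, and the fifth keeps the lower bound for the embedding above half of that
  for X.\<close>

locale good_sample =
  fixes d m s :: nat and X :: "nat \<Rightarrow> nat \<Rightarrow> real" and E :: "nat \<times> nat \<times> nat \<Rightarrow> bool"
    and ase :: "real mat \<Rightarrow> real mat" and g K \<eta>\<^sub>0 \<ll> t :: real
  assumes dm: "0 < d" "0 < m"
    and ll: "1 \<le> \<ll>" "t = 2 * sqrt (real s) * \<ll>"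
    and inner: "\<And>p q. p < s \<Longrightarrow> q < s \<Longrightarrow> dot d (X p) (X q) \<in> {0..1}"
    and gram: "\<And>c. g * s * (nrm d c)\<^sup>2 \<le> (nrm s (mv d X c))\<^sup>2"
    and noise_X: "\<And>k p a. k < m \<Longrightarrow> p < s \<Longrightarrow> a < d \<Longrightarrow> \<bar>\<Sum>q<s. edge_noise d X E k p q * X q a\<bar> \<le> t"
    and noise_sq: "\<And>k p q. k < m \<Longrightarrow> p < s \<Longrightarrow> q < s \<Longrightarrow> p \<noteq> q \<Longrightarrow>
        \<bar>\<Sum>r<s. edge_noise d X E k p r * edge_noise d X E k r q\<bar> \<le> t"
    and ase: "ASE_choice d ase"
    and gs: "gram_schmidt_modulus d d K \<eta>\<^sub>0" and pos: "0 < g" "0 < K" "0 < \<eta>\<^sub>0"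
    and large: "1 \<le> s" "d \<le> s" "32 * real m ^ 4 * \<ll> < g\<^sup>2 * sqrt (real s)"
      "residual_const d m g * \<ll> \<le> \<eta>\<^sub>0 * sqrt (g / 2) * sqrt (real s)"
      "2 * real d * alignment_const d m g K * \<ll> \<le> sqrt g * sqrt (real s)"
begin

abbreviation "Z \<equiv> ase (omni_adj m s E)"
abbreviation "w \<equiv> frame d m s X Z"

lemma s1: "1 \<le> sqrt (real s)" "0 < s" using large(1) by auto

lemma t_nonneg: "0 \<le> t" using ll by simp

lemma X_nrm: "p < s \<Longrightarrow> nrm d (X p) \<le> 1"
  using inner[of p p] by (simp add: nrm_def)

lemma mv_X_le: "nrm s (mv d X c) \<le> sqrt (real s) * nrm d c"
proof (rule power2_le_imp_le)
  have "(nrm s (mv d X c))\<^sup>2 = (\<Sum>p<s. (dot d (X p) c)\<^sup>2)"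
    by (simp only: dot_self[symmetric]) (simp add: dot_def mv_def power2_eq_square)
  also have "\<dots> \<le> (\<Sum>p<s. (nrm d c)\<^sup>2)"
  proof (intro sum_mono)
    fix p assume "p \<in> {..<s}"
    hence "\<bar>dot d (X p) c\<bar> \<le> 1 * nrm d c"
      using X_nrm by (intro order_trans[OF abs_dot_le] mult_right_mono) auto
    thus "(dot d (X p) c)\<^sup>2 \<le> (nrm d c)\<^sup>2" by (intro abs_le_square_iff[THEN iffD1]) simp
  qed
  finally show "(nrm s (mv d X c))\<^sup>2 \<le> (sqrt (real s) * nrm d c)\<^sup>2"
    by (simp add: power_mult_distrib)
qed simp

definition "\<nu>1 = sqrt (real s * (1 + t)) + 1"
definition "\<tau>1 = sqrt (real s) * (real d * t + 1)"

lemma full_noise_mv: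
  "p < s \<Longrightarrow> mv s (full_noise d X E k) y p = mv s (edge_noise d X E k) y p - dot d (X p) (X p) * y p"
proof -
  assume p: "p < s"
  have "(\<Sum>q<s. of_bool (p = q) * dot d (X p) (X p) * y q) = (\<Sum>q<s. if q = p then dot d (X p) (X p) * y p else 0)"
    by (intro sum.cong) auto
  thus ?thesis using p by (simp add: mv_def full_noise_def left_diff_distrib sum_subtractf)
qed

lemma diag_le: "nrm s (\<lambda>p. dot d (X p) (X p) * y p) \<le> nrm s y"
proof -
  have "(\<Sum>p<s. (dot d (X p) (X p) * y p)\<^sup>2) \<le> (\<Sum>p<s. (y p)\<^sup>2)"
  proof (intro sum_mono)
    fix p assume "p \<in> {..<s}"
    hence "0 \<le> dot d (X p) (X p)" "dot d (X p) (X p) \<le> 1" using inner[of p p] by auto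
    hence "\<bar>dot d (X p) (X p) * y p\<bar> \<le> \<bar>y p\<bar>" by (simp add: abs_mult mult_left_le_one_le)
    thus "(dot d (X p) (X p) * y p)\<^sup>2 \<le> (y p)\<^sup>2" by (rule abs_le_square_iff[THEN iffD1])
  qed
  thus ?thesis by (simp add: nrm_L2_set L2_set_def)
qed

lemma full_noise_le: "k < m \<Longrightarrow> nrm s (mv s (full_noise d X E k) y) \<le> \<nu>1 * nrm s y"
proof -
  assume k: "k < m"
  have bd: "\<bar>edge_noise d X E k p q\<bar> \<le> 1" if "p < s" "q < s" for p q
    using inner[OF that] by (auto simp: edge_noise_def)
  have "nrm s (mv s (full_noise d X E k) y) = nrm s (\<lambda>p. mv s (edge_noise d X E k) y p - dot d (X p) (X p) * y p)"
    by (intro nrm_cong full_noise_mv)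
  also have "\<dots> \<le> nrm s (mv s (edge_noise d X E k) y) + nrm s (\<lambda>p. dot d (X p) (X p) * y p)"
    by (rule nrm_diff_le)
  also have "nrm s (mv s (edge_noise d X E k) y) \<le> sqrt (real s * (1 + t)) * nrm s y"
    by (rule operator_norm_from_square[OF edge_noise_sym bd noise_sq[OF k] t_nonneg])
  also have "nrm s (\<lambda>p. dot d (X p) (X p) * y p) \<le> nrm s y" by (rule diag_le)
  finally show ?thesis by (simp add: \<nu>1_def distrib_right)
qed

lemma full_noise_X_le: "k < m \<Longrightarrow> nrm s (mv s (full_noise d X E k) (mv d X c)) \<le> \<tau>1 * nrm d c"
proof -
  assume k: "k < m"
  have e: "mv s (edge_noise d X E k) (mv d X c) = (\<lambda>p. \<Sum>a<d. c a * (\<Sum>q<s. edge_noise d X E k p q * X q a))"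
    unfolding mv_def sum_distrib_left by (subst sum.swap) (simp add: ac_simps)
  have 1: "nrm s (\<lambda>p. \<Sum>q<s. edge_noise d X E k p q * X q a) \<le> sqrt (real s) * t" if a: "a < d" for a
  proof (rule power2_le_imp_le)
    have "(nrm s (\<lambda>p. \<Sum>q<s. edge_noise d X E k p q * X q a))\<^sup>2 = (\<Sum>p<s. (\<Sum>q<s. edge_noise d X E k p q * X q a)\<^sup>2)"
      by (simp only: dot_self[symmetric]) (simp add: dot_def power2_eq_square)
    also have "\<dots> \<le> (\<Sum>p<s. t\<^sup>2)"
    proof (intro sum_mono)
      fix p assume "p \<in> {..<s}"
      hence "\<bar>\<Sum>q<s. edge_noise d X E k p q * X q a\<bar> \<le> \<bar>t\<bar>" using noise_X[OF k _ a, of p] t_nonneg by simp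
      thus "(\<Sum>q<s. edge_noise d X E k p q * X q a)\<^sup>2 \<le> t\<^sup>2" by (rule abs_le_square_iff[THEN iffD1])
    qed
    finally show "(nrm s (\<lambda>p. \<Sum>q<s. edge_noise d X E k p q * X q a))\<^sup>2 \<le> (sqrt (real s) * t)\<^sup>2"
      by (simp add: power_mult_distrib)
  qed (use t_nonneg in simp)
  have "nrm s (mv s (full_noise d X E k) (mv d X c))
      = nrm s (\<lambda>p. mv s (edge_noise d X E k) (mv d X c) p - dot d (X p) (X p) * mv d X c p)"
    by (intro nrm_cong full_noise_mv)
  also have "\<dots> \<le> nrm s (mv s (edge_noise d X E k) (mv d X c)) + nrm s (\<lambda>p. dot d (X p) (X p) * mv d X c p)"
    by (rule nrm_diff_le)
  also have "nrm s (mv s (edge_noise d X E k) (mv d X c)) \<le> real d * (sqrt (real s) * t) * nrm d c"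
    unfolding e by (rule nrm_combination_le) (rule 1)
  also have "nrm s (\<lambda>p. dot d (X p) (X p) * mv d X c p) \<le> sqrt (real s) * nrm d c"
    by (rule order_trans[OF diag_le mv_X_le])
  finally show ?thesis by (simp add: \<tau>1_def algebra_simps)
qed

text \<open>Use (a + 1)^2 \<le> 2 a^2 + 2 with a^2 = s (1 + t); the term s sqrt s \<ll> dominates
  the others because s and \<ll> are at least 1.\<close>

lemma \<nu>1_sq: "\<nu>1\<^sup>2 \<le> 8 * (real s * sqrt (real s) * \<ll>)"
proof -
  define r where "r = sqrt (real s)"
  have r: "1 \<le> r" "real s = r * r" using s1 by (simp_all add: r_def)
  have rl: "1 \<le> r * \<ll>" using mult_mono[OF r(1) ll(1)] r by simp
  have "\<nu>1\<^sup>2 \<le> 2 * (sqrt (real s * (1 + t)))\<^sup>2 + 2 * 1\<^sup>2"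
    unfolding \<nu>1_def using sum_squares_bound[of "sqrt (real s * (1 + t))" 1] by (simp add: power2_sum)
  also have "(sqrt (real s * (1 + t)))\<^sup>2 = r * r * (1 + 2 * (r * \<ll>))"
    using t_nonneg unfolding ll(2) r_def by simp
  also have "2 * (r * r * (1 + 2 * (r * \<ll>))) + 2 * 1\<^sup>2 \<le> 8 * ((r * r) * (r * \<ll>))"
  proof -
    have a: "1 \<le> r * r" using mult_mono[OF r(1) r(1)] r by simp
    have "r * r * 1 \<le> r * r * (r * \<ll>)" using rl a by (intro mult_left_mono) auto
    thus ?thesis using a by (simp add: algebra_simps)
  qed
  also have "(r * r) * (r * \<ll>) = real s * sqrt (real s) * \<ll>" by (simp add: r_def)
  finally show ?thesis .
qed

lemma \<tau>1_le: "\<tau>1 \<le> 3 * real d * (real s * \<ll>)"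
proof -
  define r where "r = sqrt (real s)"
  have r: "1 \<le> r" "real s = r * r" using s1 by (simp_all add: r_def)
  have d1: "1 \<le> real d" using dm by simp
  have "1 \<le> r * \<ll>" using mult_mono[OF r(1) ll(1)] r by simp
  hence "1 \<le> real d * (r * \<ll>)" using mult_mono[OF d1, of 1 "r * \<ll>"] by simp
  hence "r * 1 \<le> r * (real d * (r * \<ll>))" using r by (intro mult_left_mono) auto
  moreover have "\<tau>1 = r * (real d * (2 * (r * \<ll>)) + 1)" unfolding \<tau>1_def r_def using ll(2) by simp
  ultimately show ?thesis unfolding r(2) by (simp add: algebra_simps)
qed

definition "\<nu>2 = (real m)\<^sup>2 * \<nu>1"
definition "\<tau>2 = (real m)\<^sup>2 * \<tau>1"

lemma \<nu>2_sq: "\<nu>2\<^sup>2 \<le> 8 * real m ^ 4 * (real s * sqrt (real s) * \<ll>)"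
proof -
  have "\<nu>2\<^sup>2 = real m ^ 4 * \<nu>1\<^sup>2" by (simp add: \<nu>2_def power_mult_distrib flip: power_mult)
  also have "\<dots> \<le> real m ^ 4 * (8 * (real s * sqrt (real s) * \<ll>))"
    by (intro mult_left_mono \<nu>1_sq) simp
  finally show ?thesis by simp
qed

text \<open>After squaring, 8 m^4 s sqrt(s) \<ll> has to stay below g^2 s^2 / 4, which explains the
  constant 32 in \<open>large\<close>.\<close>

lemma \<nu>2_less: "\<nu>2 < g * s / 2"
proof (rule power2_less_imp_less)
  have "\<nu>2\<^sup>2 \<le> (32 * real m ^ 4 * \<ll>) * (real s * sqrt (real s)) / 4"
    using \<nu>2_sq by (simp add: ac_simps)
  also have "\<dots> < (g\<^sup>2 * sqrt (real s)) * (real s * sqrt (real s)) / 4"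
    using large(3) s1 by (intro divide_strict_right_mono mult_strict_right_mono) auto
  also have "\<dots> = (g * s / 2)\<^sup>2"
  proof -
    have "(g\<^sup>2 * sqrt (real s)) * (real s * sqrt (real s)) = g\<^sup>2 * real s * (sqrt (real s) * sqrt (real s))"
      by (simp only: ac_simps)
    thus ?thesis by (simp add: power2_eq_square)
  qed
  finally show "\<nu>2\<^sup>2 < (g * s / 2)\<^sup>2" .
qed (use pos in simp)

definition "b = sqrt ((real m)\<^sup>2 + g)"

text \<open>The three facts share one proof because all refer to the eigenbasis behind
  \<open>Z\<close>, which exists only inside it; the conclusions mention \<open>Z\<close> and
  \<open>w\<close> alone.\<close>

lemma embedding:
  shows orthonormal_w: "\<And>a b. a < d \<Longrightarrow> b < d \<Longrightarrow> dot d (w a) (w b) = of_bool (a = b)"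
    and near_w: "\<And>i a. i < m \<Longrightarrow> a < d \<Longrightarrow>
      nrm s (\<lambda>p. Z $$ (i * s + p, a) - dot d (X p) (w a)) \<le> alignment_const d m g K * \<ll>"
    and column_Z: "\<And>i a. i < m \<Longrightarrow> a < d \<Longrightarrow> nrm s (\<lambda>p. Z $$ (i * s + p, a)) \<le> b * sqrt (real s)"
proof -
  have dN: "d \<le> m * s" using large(2) dm by (metis One_nat_def Suc_leI le_trans mult_le_mono1 nat_mult_1)
  have "is_ASE d (omni_adj m s E) Z" by (rule ASE_omni_adj[OF ase dN])
  then obtain u \<sigma> where
    orth: "\<And>a b. a < m * s \<Longrightarrow> b < m * s \<Longrightarrow> dot (m * s) (u a) (u b) = of_bool (a = b)"
    and complete: "\<And>i j. i < m * s \<Longrightarrow> j < m * s \<Longrightarrow> (\<Sum>a<m * s. u a i * u a j) = of_bool (i = j)"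
    and eig: "\<And>a i. a < m * s \<Longrightarrow> i < m * s \<Longrightarrow>
           mv (m * s) (\<lambda>i j. omni_adj m s E $$ (i, j)) (mv (m * s) (\<lambda>i j. omni_adj m s E $$ (i, j)) (u a)) i
             = (\<sigma> a)\<^sup>2 * u a i"
    and \<sigma>0: "\<And>a. a < m * s \<Longrightarrow> 0 \<le> \<sigma> a"
    and mono: "\<And>a b. a \<le> b \<Longrightarrow> b < m * s \<Longrightarrow> \<sigma> b \<le> \<sigma> a"
    and Zi: "\<And>i a. i < m * s \<Longrightarrow> a < d \<Longrightarrow> Z $$ (i, a) = u a i * sqrt (\<sigma> a)"
    by (rule is_ASE_cases[OF _ omni_adj_carrier omni_adj_symmetric dN]) blast
  let ?X = "\<lambda>P. X (P mod s)"
  have blockX: "(\<lambda>p. mv d ?X c (j * s + p)) p = mv d X c p" if "p < s" for c j p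
    using that by (simp add: mv_def)
  have nX: "nrm s (\<lambda>p. mv d ?X c (j * s + p)) = nrm s (mv d X c)" for c j
    by (intro nrm_cong) (rule blockX)
  \<comment> \<open>Stacking m copies of X can only increase |X c|^2, so the lower constant g s of a
    single block serves; the upper constant m sqrt s is that of
    \<open>nrm_blocks_le\<close>.\<close>
  interpret S: spectral_perturbation "m * s" d "\<lambda>i j. omni_adj m s E $$ (i, j)" "omni_noise d s X E" ?X u \<sigma>
      "g * s" "m * sqrt (real s)" \<nu>2 \<tau>2
  proof (unfold_locales, goal_cases)
    case (4 i j) show ?case by (rule omni_noise_sym)
  next
    case (10 c)
    have "1 * (nrm s (mv d X c))\<^sup>2 \<le> real m * (nrm s (mv d X c))\<^sup>2" using dm by (intro mult_right_mono) auto
    thus ?case using gram[of c] by (simp add: nrm_blocks_sq nX)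
  next
    case (11 c)
    have "nrm (m * s) (mv d ?X c) \<le> m * (sqrt (real s) * nrm d c)"
      by (intro nrm_blocks_le) (auto simp: nX mv_X_le)
    thus ?case by simp
  next
    case (12 v)
    have "nrm (m * s) (mv (m * s) (omni_noise d s X E) v) \<le> (real m)\<^sup>2 * (\<nu>1 * nrm (m * s) v)"
    proof (rule nrm_omni_noise_le)
      have \<nu>1: "0 \<le> \<nu>1" using t_nonneg by (simp add: \<nu>1_def)
      thus "0 \<le> \<nu>1 * nrm (m * s) v" by simp
      fix k j assume "k < m" "j < m"
      thus "nrm s (mv s (full_noise d X E k) (\<lambda>q. v (j * s + q))) \<le> \<nu>1 * nrm (m * s) v"
        using \<nu>1 by (intro order_trans[OF full_noise_le] mult_left_mono nrm_block_le) auto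
    qed (use s1 in auto)
    thus ?case by (simp add: \<nu>2_def mult.assoc)
  next
    case (13 c)
    have "nrm (m * s) (mv (m * s) (omni_noise d s X E) (mv d ?X c)) \<le> (real m)\<^sup>2 * (\<tau>1 * nrm d c)"
    proof (rule nrm_omni_noise_le)
      show "0 \<le> \<tau>1 * nrm d c" using t_nonneg by (simp add: \<tau>1_def)
      fix k j assume "k < m" "j < m"
      moreover have "mv s (full_noise d X E k) (\<lambda>q. mv d ?X c (j * s + q)) = mv s (full_noise d X E k) (mv d X c)"
        by (intro mv_cong) (rule blockX)
      ultimately show "nrm s (mv s (full_noise d X E k) (\<lambda>q. mv d ?X c (j * s + q))) \<le> \<tau>1 * nrm d c"
        using full_noise_X_le by simp
    qed (use s1 in auto)
    thus ?case by (simp add: \<tau>2_def mult.assoc)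
  next
    case 14 show ?case using t_nonneg by (simp add: \<nu>2_def \<nu>1_def)
  next
    case 15 show ?case using t_nonneg by (simp add: \<tau>2_def \<tau>1_def)
  next
    case 17 show ?case by (rule \<nu>2_less)
  qed (use dm dN orth complete eig \<sigma>0 mono omni_adj_noise in auto)
  have \<rho>: "S.\<rho> \<le> residual_const d m g * \<ll>"
  proof -
    have "\<tau>2 * (m * sqrt (real s)) \<le> ((real m)\<^sup>2 * (3 * real d * (real s * \<ll>))) * (m * sqrt (real s))"
      unfolding \<tau>2_def by (intro mult_right_mono mult_left_mono \<tau>1_le) auto
    also have "\<dots> = 3 * real d * real m ^ 3 * (real s * sqrt (real s) * \<ll>)"
      by (simp add: power2_eq_square power3_eq_cube)
    finally have "\<tau>2 * (m * sqrt (real s)) + \<nu>2\<^sup>2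
        \<le> (3 * real d * real m ^ 3 + 8 * real m ^ 4) * (real s * sqrt (real s) * \<ll>)"
      using \<nu>2_sq by (simp add: distrib_right)
    \<comment> \<open>Numerator and denominator both carry s sqrt s; dividing leaves a multiple of
      \<ll>.\<close>
    moreover have "g * s / 2 * sqrt (g * s / 2) = (g / 2 * sqrt (g / 2)) * (real s * sqrt (real s))"
      using real_sqrt_mult[of "g / 2" "real s"] by simp
    ultimately have "S.\<rho> \<le> (3 * real d * real m ^ 3 + 8 * real m ^ 4) * (real s * sqrt (real s) * \<ll>)
        / ((g / 2 * sqrt (g / 2)) * (real s * sqrt (real s)))"
      unfolding S.\<rho>_def using pos s1 S.bounds(2) by (intro divide_mono) auto
    also have "\<dots> = residual_const d m g * \<ll>"
      using s1 by (simp add: residual_const_def)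
    finally show ?thesis .
  qed
  have rc: "0 \<le> residual_const d m g" using pos by (simp add: residual_const_def)
  have sq: "sqrt (g * s / 2) = sqrt (g / 2) * sqrt (real s)"
    using real_sqrt_mult[of "g / 2" "real s"] by simp
  have sg: "0 < sqrt (g / 2) * sqrt (real s)" using pos s1 by simp
  have small: "S.\<rho> / sqrt (g * s / 2) \<le> \<eta>\<^sub>0"
    unfolding sq using \<rho> large(4) sg by (subst pos_divide_le_eq) (auto simp: mult.assoc)
  \<comment> \<open>The columns of \<open>Z\<close> are the scaled eigenvectors, and their squared
    norms return the eigenvalues, so the explicit frame agrees with the one built from
    \<open>S.h\<close>.\<close>
  have w_eq: "w a = gram_schmidt_vec d S.h a" if a: "a < d" for a
    unfolding frame_def
  proof (rule gram_schmidt_vec_cong)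
    fix c assume "c \<le> a"
    hence c: "c < d" using a by simp
    have z: "Z $$ (P, c) = S.z c P" if "P < m * s" for P
      using Zi[OF that c] by (simp add: S.z_def)
    have "(\<Sum>P<m * s. (Z $$ (P, c))\<^sup>2) = dot (m * s) (S.z c) (S.z c)"
      by (simp add: dot_def z power2_eq_square)
    also have "\<dots> = \<sigma> c" using S.dot_z[OF c c] by simp
    finally show "frame_coeff m s X Z c = S.h c"
      by (simp add: fun_eq_iff frame_coeff_def S.h_def S.Xt_def mv_def z)
  qed
  show "dot d (w a) (w b) = of_bool (a = b)" if "a < d" "b < d" for a b
    unfolding w_eq[OF that(1)] w_eq[OF that(2)] by (rule S.aligned(1)[OF gs small that])
  fix i a assume i: "i < m" and a: "a < d"
  have idx: "i * s + p < m * s" if "p < s" for p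
  proof -
    have "i * s + p < Suc i * s" using that by simp
    also have "\<dots> \<le> m * s" using i by (intro mult_le_mono1) simp
    finally show ?thesis .
  qed
  have "nrm s (\<lambda>p. Z $$ (i * s + p, a) - dot d (X p) (w a))
      = nrm s (\<lambda>p. S.z a (i * s + p) - mv d ?X (gram_schmidt_vec d S.h a) (i * s + p))"
    by (intro nrm_cong) (simp add: Zi idx a S.z_def w_eq mv_def dot_def)
  also have "\<dots> \<le> nrm (m * s) (\<lambda>P. S.z a P - mv d ?X (gram_schmidt_vec d S.h a) P)"
    using i by (rule nrm_block_le)
  also have "\<dots> \<le> S.\<rho> + m * sqrt (real s) * (K * (S.\<rho> / sqrt (g * s / 2)))"
    by (rule S.aligned(2)[OF gs small a])
  also have "\<dots> = S.\<rho> * (1 + m * K / sqrt (g / 2))"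
    unfolding sq using s1 pos by (simp add: field_simps)
  also have "\<dots> \<le> residual_const d m g * \<ll> * (1 + m * K / sqrt (g / 2))"
    using \<rho> pos by (intro mult_right_mono) auto
  finally show "nrm s (\<lambda>p. Z $$ (i * s + p, a) - dot d (X p) (w a)) \<le> alignment_const d m g K * \<ll>"
    by (simp add: alignment_const_def ac_simps)
  have "nrm s (\<lambda>p. Z $$ (i * s + p, a)) = nrm s (\<lambda>p. S.z a (i * s + p))"
    by (intro nrm_cong) (simp add: Zi idx a S.z_def)
  also have "\<dots> \<le> nrm (m * s) (S.z a)" using i by (rule nrm_block_le)
  also have "\<dots> = sqrt (\<sigma> a)" by (rule S.nrm_z[OF a])
  also have "\<dots> \<le> sqrt ((m * sqrt (real s))\<^sup>2 + \<nu>2)"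
    by (intro real_sqrt_le_mono S.\<sigma>_upper a)
  also have "\<dots> \<le> sqrt (((real m)\<^sup>2 + g) * s)"
  proof (intro real_sqrt_le_mono)
    have "\<nu>2 \<le> g * s" using \<nu>2_less pos mult_nonneg_nonneg[of g "real s"] by linarith
    thus "(m * sqrt (real s))\<^sup>2 + \<nu>2 \<le> ((real m)\<^sup>2 + g) * s"
      by (simp add: power_mult_distrib distrib_right)
  qed
  also have "\<dots> = b * sqrt (real s)" by (simp add: b_def real_sqrt_mult)
  finally show "nrm s (\<lambda>p. Z $$ (i * s + p, a)) \<le> b * sqrt (real s)" .
qed

text \<open>The bound on the cross noise is a hypothesis of its own because its coefficients, the
  columns of \<open>Z\<close>, are random. Noise and design error both contribute order sqrt(s)
  \<ll>, and the squared lower bound on \<open>Z\<close> is g s / 4; the quotient is of order \<ll>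
  / sqrt s.\<close>

lemma oos_error:
  assumes Q: "\<And>k. k < m \<Longrightarrow> Q k \<in> perm_mats u" and i: "i < m" and v: "v < u"
    and x: "nrm d (X (s + v)) \<le> 1"
    and noise: "\<And>a. a < d \<Longrightarrow> \<bar>\<Sum>p<s. Z $$ (i * s + p, a) * edge_noise d X E i p (s + v)\<bar> \<le> 2 * b * sqrt (real s) * \<ll>"
  defines "Y \<equiv> (Q i)\<^sup>T * oos_embedding ase d m s (observed s u Q E) i"
  shows "Y \<in> carrier_mat u d"
    and "nrm d (\<lambda>a. Y $$ (v, a) - dot d (w a) (X (s + v)))
      \<le> 4 * real d * (2 * b + b * (d * alignment_const d m g K)) / g * (\<ll> / sqrt (real s))"
proof -
  let ?\<rho> = "alignment_const d m g K * \<ll>"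
  let ?Z = "\<lambda>p a. Z $$ (i * s + p, a)"
  have ac: "0 \<le> alignment_const d m g K"
    using pos by (simp add: alignment_const_def residual_const_def)
  have \<rho>0: "0 \<le> ?\<rho>" using ac ll by simp
  define \<kappa> where "\<kappa> = sqrt g * sqrt (real s)"
  have \<kappa>: "0 < \<kappa>" using pos s1 by (simp add: \<kappa>_def)
  have \<kappa>2: "\<kappa>\<^sup>2 = g * s" using pos by (simp add: \<kappa>_def power_mult_distrib)
  have gr: "\<kappa> * nrm d c \<le> nrm s (mv d X c)" for c
    by (rule power2_le_imp_le) (use gram[of c] in \<open>auto simp: power_mult_distrib \<kappa>2\<close>)
  have \<kappa>': "\<kappa> / 2 \<le> \<kappa> - d * ?\<rho>"
    using large(5) by (simp add: \<kappa>_def)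
  have inj: "nrm d c = 0" if "nrm s (mv d ?Z c) = 0" for c
  proof -
    have "\<kappa> / 2 * nrm d c \<le> (\<kappa> - d * ?\<rho>) * nrm d c" using \<kappa>' by (intro mult_right_mono) auto
    also have "\<dots> \<le> nrm s (mv d ?Z c)"
      by (rule least_squares_lower[OF orthonormal_w near_w[OF i] gr])
    finally have "nrm d c \<le> 0" using that \<kappa> by (simp add: mult_le_0_iff)
    thus ?thesis using nrm_nonneg[of d c] by linarith
  qed
  show "Y \<in> carrier_mat u d"
    unfolding Y_def by (rule oos_normal_equations(1)[OF Q i v inj])
  have adj: "adj E i p (s + v) = dot d (X p) (X (s + v)) + edge_noise d X E i p (s + v)" if "p < s" for p
    using that by (simp add: adj_noise[where d = d and X = X] full_noise_def)
  have "nrm d (\<lambda>a. Y $$ (v, a) - dot d (w a) (X (s + v)))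
      \<le> d * (2 * b * sqrt (real s) * \<ll> + b * sqrt (real s) * (d * ?\<rho>)) / (\<kappa> / 2)\<^sup>2"
  proof (rule least_squares_error[OF orthonormal_w near_w[OF i] gr _ \<kappa>' \<rho>0 column_Z[OF i] _ x])
    show "0 < \<kappa> / 2" using \<kappa> by simp
    show "\<bar>dot s (\<lambda>p. ?Z p a) (\<lambda>p. edge_noise d X E i p (s + v))\<bar> \<le> 2 * b * sqrt (real s) * \<ll>" if "a < d" for a
      using noise[OF that] by (simp add: dot_def)
    fix a assume a: "a < d"
    have "dot s (\<lambda>p. ?Z p a) (mv d ?Z (\<lambda>a. Y $$ (v, a))) = dot s (\<lambda>p. ?Z p a) (\<lambda>p. adj E i p (s + v))"
      unfolding Y_def by (rule oos_normal_equations(2)[OF Q i v inj a])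
    also have "\<dots> = dot s (\<lambda>p. ?Z p a) (\<lambda>p. dot d (X p) (X (s + v)) + edge_noise d X E i p (s + v))"
      by (intro dot_cong) (simp_all add: adj)
    finally show "dot s (\<lambda>p. ?Z p a) (mv d ?Z (\<lambda>a. Y $$ (v, a)))
        = dot s (\<lambda>p. ?Z p a) (\<lambda>p. dot d (X p) (X (s + v)) + edge_noise d X E i p (s + v))" .
  qed
  also have "\<dots> = 4 * real d * (2 * b + b * (d * alignment_const d m g K)) / g * (\<ll> / sqrt (real s))"
  proof -
    define r where "r = sqrt (real s)"
    have "(\<kappa> / 2)\<^sup>2 = g * (r * r) / 4" by (simp add: power_divide \<kappa>2 r_def)
    moreover have "0 < r" using s1 by (simp add: r_def)
    ultimately show ?thesis using pos unfolding r_def[symmetric] by (simp add: field_simps)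
  qed
  finally show "nrm d (\<lambda>a. Y $$ (v, a) - dot d (w a) (X (s + v)))
      \<le> 4 * real d * (2 * b + b * (d * alignment_const d m g K)) / g * (\<ll> / sqrt (real s))" .
qed

end

section \<open>The good event has high probability\<close>

text \<open>The normal form of an undirected edge: \<open>edge_slots\<close> lists each edge once,
  with the smaller vertex first.\<close>

definition slot :: "nat \<Rightarrow> nat \<Rightarrow> nat \<Rightarrow> nat \<times> nat \<times> nat" where
  "slot k p q = (k, min p q, max p q)"

lemma slot_in: "k < m \<Longrightarrow> p < n \<Longrightarrow> q < n \<Longrightarrow> p \<noteq> q \<Longrightarrow> slot k p q \<in> edge_slots n m"
  by (auto simp: slot_def edge_slots_def min_def max_def)

lemma slot_eq_iff: "slot k p q = slot k' p' q' \<longleftrightarrow> k = k' \<and> (p = p' \<and> q = q' \<or> p = q' \<and> q = p')"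
  by (auto simp: slot_def min_def max_def split: if_splits)

lemma scalar_prod_vec: "vec d x \<bullet> vec d y = dot d x y"
  by (simp add: scalar_prod_def dot_def atLeast0LessThan)

definition edge_prob :: "nat \<Rightarrow> (nat \<Rightarrow> nat \<Rightarrow> real) \<Rightarrow> nat \<times> nat \<times> nat \<Rightarrow> real" where
  "edge_prob d X = (\<lambda>(k, i, j). dot d (X i) (X j))"

lemma edge_prob_slot: "edge_prob d X (slot k p q) = dot d (X p) (X q)"
  by (simp add: edge_prob_def slot_def min_def max_def dot_commute)

lemma edge_pmf_eq:
  "edge_pmf d n m X = Pi_pmf (edge_slots n m) False (\<lambda>e. bernoulli_pmf (edge_prob d X e))"
  unfolding edge_pmf_def edge_prob_def by (rule arg_cong[where f = "Pi_pmf _ _"]) (auto simp: scalar_prod_vec)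

lemma edge_noise_slot:
  "p \<noteq> q \<Longrightarrow> edge_noise d X E k p q = of_bool (E (slot k p q)) - edge_prob d X (slot k p q)"
  by (simp add: edge_noise_def edge_prob_slot) (simp add: slot_def)

lemma edge_noise_cong:
  "p = q \<or> E (slot k p q) = E' (slot k p q) \<Longrightarrow> edge_noise d X E k p q = edge_noise d X E' k p q"
  by (auto simp: edge_noise_def slot_def)

context
  fixes d m n :: nat and X :: "nat \<Rightarrow> nat \<Rightarrow> real"
  assumes inner: "\<And>p q. p < n \<Longrightarrow> q < n \<Longrightarrow> dot d (X p) (X q) \<in> {0..1}"
begin

text \<open>The edges from one vertex c to different vertices occupy different slots and are
  independent. All deviations considered below are weighted sums over such a star.\<close>

lemma edge_tail:
  assumes e: "inj_on (slot k c) R" "k < m" "c < n" "R \<subseteq> {..<n} - {c}"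
    and a: "\<And>E E'. (\<And>i. i \<notin> slot k c ` R \<Longrightarrow> E i = E' i) \<Longrightarrow> a E = a E'"
    and V: "\<And>E. (\<Sum>r\<in>R. (a E r)\<^sup>2) \<le> V" and "0 < V" "0 < t"
  shows "measure_pmf.prob (edge_pmf d n m X) {E. t \<le> \<bar>\<Sum>r\<in>R. a E r * edge_noise d X E k c r\<bar>}
    \<le> 2 * exp (- 2 * t\<^sup>2 / V)"
proof -
  have eq: "(\<Sum>r\<in>R. a E r * edge_noise d X E k c r)
      = (\<Sum>r\<in>R. a E r * (of_bool (E (slot k c r)) - edge_prob d X (slot k c r)))" for E
  proof (intro sum.cong refl)
    fix r assume "r \<in> R"
    hence "c \<noteq> r" using e(4) by auto
    thus "a E r * edge_noise d X E k c r = a E r * (of_bool (E (slot k c r)) - edge_prob d X (slot k c r))"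
      by (simp add: edge_noise_slot)
  qed
  have "measure_pmf.prob (edge_pmf d n m X)
      {E. t \<le> \<bar>\<Sum>r\<in>R. a E r * (of_bool (E (slot k c r)) - edge_prob d X (slot k c r))\<bar>}
    \<le> 2 * exp (- 2 * t\<^sup>2 / V)"
    unfolding edge_pmf_eq
  proof (rule hoeffding_indexed[OF finite_edge_slots e(1) _ _ a V \<open>0 < V\<close> \<open>0 < t\<close>])
    show "slot k c ` R \<subseteq> edge_slots n m"
    proof (rule image_subsetI)
      fix r assume "r \<in> R"
      thus "slot k c r \<in> edge_slots n m" using e by (intro slot_in) auto
    qed
    show "edge_prob d X (slot k c r) \<in> {0..1}" if "r \<in> R" for r
      unfolding edge_prob_slot using e that by (intro inner) auto
  qed
  thus ?thesis by (simp only: eq)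
qed

lemma slot_inj: "inj_on (slot k c) R"
  by (auto simp: inj_on_def slot_eq_iff)

lemma coordinate_le: "q < n \<Longrightarrow> a < d \<Longrightarrow> \<bar>X q a\<bar> \<le> 1"
  using abs_le_nrm[of a d "X q"] inner[of q q] by (simp add: nrm_def) (meson order_trans real_sqrt_le_1_iff)

lemma noise_X_tail:
  assumes "k < m" "p < s" "a < d" "s \<le> n" "0 < t"
  shows "measure_pmf.prob (edge_pmf d n m X) {E. t \<le> \<bar>\<Sum>q<s. edge_noise d X E k p q * X q a\<bar>}
    \<le> 2 * exp (- 2 * t\<^sup>2 / s)"
proof -
  have eq: "(\<Sum>q<s. edge_noise d X E k p q * X q a) = (\<Sum>q\<in>{..<s} - {p}. X q a * edge_noise d X E k p q)" for E
    by (subst sum.mono_neutral_cong_right[of "{..<s}" "{..<s} - {p}"]) (auto simp: edge_noise_def)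
  have V: "(\<Sum>q\<in>{..<s} - {p}. (X q a)\<^sup>2) \<le> s"
  proof -
    have "(\<Sum>q\<in>{..<s} - {p}. (X q a)\<^sup>2) \<le> (\<Sum>q\<in>{..<s} - {p}. 1)"
      by (intro sum_mono) (use assms coordinate_le in \<open>auto simp: abs_square_le_1\<close>)
    also have "\<dots> \<le> (\<Sum>q\<in>{..<s}. 1)" by (intro sum_mono2) auto
    finally show ?thesis by simp
  qed
  have "measure_pmf.prob (edge_pmf d n m X) {E. t \<le> \<bar>\<Sum>q\<in>{..<s} - {p}. X q a * edge_noise d X E k p q\<bar>}
    \<le> 2 * exp (- 2 * t\<^sup>2 / s)"
    by (rule edge_tail[where a = "\<lambda>_ q. X q a", OF slot_inj assms(1) _ _ refl V]) (use assms in auto)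
  thus ?thesis by (simp only: eq)
qed

text \<open>A quadratic sum treated as a linear one: the edges at q are the variables and the edges
  at p their coefficients. The terms r = p and r = q vanish with the diagonal, and without them the
  two stars share no slot.\<close>

lemma noise_sq_tail:
  assumes k: "k < m" and p: "p < s" and q: "q < s" and pq: "p \<noteq> q" and s: "s \<le> n" and t: "0 < t"
  shows "measure_pmf.prob (edge_pmf d n m X) {E. t \<le> \<bar>\<Sum>r<s. edge_noise d X E k p r * edge_noise d X E k r q\<bar>}
    \<le> 2 * exp (- 2 * t\<^sup>2 / s)"
proof -
  let ?R = "{..<s} - {p, q}"
  have eq: "(\<Sum>r<s. edge_noise d X E k p r * edge_noise d X E k r q)
      = (\<Sum>r\<in>?R. edge_noise d X E k p r * edge_noise d X E k q r)" for E
    by (subst sum.mono_neutral_cong_right[of "{..<s}" ?R]) (auto simp: edge_noise_def min.commute max.commute dot_commute)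
  have a: "(\<lambda>r. edge_noise d X E k p r) = (\<lambda>r. edge_noise d X E' k p r)"
    if "\<And>i. i \<notin> slot k q ` ?R \<Longrightarrow> E i = E' i" for E E'
  proof
    fix r
    have "slot k p r \<notin> slot k q ` ?R" using pq by (auto simp: slot_eq_iff)
    thus "edge_noise d X E k p r = edge_noise d X E' k p r" by (intro edge_noise_cong disjI2 that)
  qed
  have V: "(\<Sum>r\<in>?R. (edge_noise d X E k p r)\<^sup>2) \<le> s" for E
  proof -
    have "\<bar>edge_noise d X E k p r\<bar> \<le> 1" if "r < s" for r
      using inner[of p r] p s that by (auto simp: edge_noise_def)
    hence "(\<Sum>r\<in>?R. (edge_noise d X E k p r)\<^sup>2) \<le> (\<Sum>r\<in>?R. 1)"
      by (intro sum_mono) (auto simp: abs_square_le_1)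
    also have "\<dots> \<le> (\<Sum>r\<in>{..<s}. 1)" by (intro sum_mono2) auto
    finally show ?thesis by simp
  qed
  have "measure_pmf.prob (edge_pmf d n m X) {E. t \<le> \<bar>\<Sum>r\<in>?R. edge_noise d X E k p r * edge_noise d X E k q r\<bar>}
    \<le> 2 * exp (- 2 * t\<^sup>2 / s)"
    by (rule edge_tail[OF slot_inj k _ _ a V]) (use p q s t in auto)
  thus ?thesis by (simp only: eq)
qed

lemma omni_adj_cong:
  assumes "\<And>k p q. k < m \<Longrightarrow> p < s \<Longrightarrow> q < s \<Longrightarrow> E (slot k p q) = E' (slot k p q)"
  shows "omni_adj m s E = omni_adj m s E'"
  using assms omni_adj_carrier[of m s E] omni_adj_carrier[of m s E']
  by (intro eq_matI) (auto simp: omni_adj_index adj_def mod_div_less slot_def)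

text \<open>The seed embedding is a function of edges among seeds, none of which lies in the star of
  vertex s + v. The variance bound is part of the event because Hoeffding asks for a deterministic
  V.\<close>

lemma regression_noise_tail:
  assumes i: "i < m" and v: "s + v < n" and V: "0 < V" and t: "0 < t"
  shows "measure_pmf.prob (edge_pmf d n m X)
      {E. (\<Sum>p<s. (ase (omni_adj m s E) $$ (i * s + p, a))\<^sup>2) \<le> V \<and>
        t \<le> \<bar>\<Sum>p<s. ase (omni_adj m s E) $$ (i * s + p, a) * edge_noise d X E i p (s + v)\<bar>}
    \<le> 2 * exp (- 2 * t\<^sup>2 / V)"
proof -
  define z where "z = (\<lambda>E p. ase (omni_adj m s E) $$ (i * s + p, a))"
  \<comment> \<open>Truncation: where the column is too long the coefficients are replaced by 0, so
    that V bounds their squares for every E; on the event nothing changes.\<close>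
  define c where "c = (\<lambda>E p. if (\<Sum>p<s. (z E p)\<^sup>2) \<le> V then z E p else 0)"
  have z: "z E = z E'" if "\<And>e. e \<notin> slot i (s + v) ` {..<s} \<Longrightarrow> E e = E' e" for E E'
  proof -
    have "omni_adj m s E = omni_adj m s E'"
      by (intro omni_adj_cong that) (auto simp: slot_eq_iff)
    thus ?thesis by (simp add: z_def)
  qed
  have cc: "c E = c E'" if "\<And>e. e \<notin> slot i (s + v) ` {..<s} \<Longrightarrow> E e = E' e" for E E'
  proof -
    have "z E = z E'" by (rule z) (rule that)
    thus ?thesis
      unfolding c_def by (rule arg_cong[where f = "\<lambda>z p. if (\<Sum>p<s. (z p)\<^sup>2) \<le> V then z p else 0"])
  qed
  have cV: "(\<Sum>p<s. (c E p)\<^sup>2) \<le> V" for E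
    using V by (cases "(\<Sum>p<s. (z E p)\<^sup>2) \<le> V") (simp_all add: c_def)
  have "{E. (\<Sum>p<s. (z E p)\<^sup>2) \<le> V \<and> t \<le> \<bar>\<Sum>p<s. z E p * edge_noise d X E i p (s + v)\<bar>}
      \<subseteq> {E. t \<le> \<bar>\<Sum>p<s. c E p * edge_noise d X E i (s + v) p\<bar>}"
    using edge_noise_sym by (auto simp: c_def)
  hence "measure_pmf.prob (edge_pmf d n m X)
      {E. (\<Sum>p<s. (z E p)\<^sup>2) \<le> V \<and> t \<le> \<bar>\<Sum>p<s. z E p * edge_noise d X E i p (s + v)\<bar>}
    \<le> measure_pmf.prob (edge_pmf d n m X) {E. t \<le> \<bar>\<Sum>p<s. c E p * edge_noise d X E i (s + v) p\<bar>}"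
    by (intro measure_pmf.finite_measure_mono) auto
  also have "\<dots> \<le> 2 * exp (- 2 * t\<^sup>2 / V)"
    by (rule edge_tail[OF slot_inj i v _ cc cV V t]) (use v in auto)
  finally show ?thesis by (simp add: z_def)
qed

end

definition oos_const :: "nat \<Rightarrow> nat \<Rightarrow> real \<Rightarrow> real \<Rightarrow> real" where
  "oos_const d m g K = 4 * real d * (2 * sqrt ((real m)\<^sup>2 + g)
      + sqrt ((real m)\<^sup>2 + g) * (d * alignment_const d m g K)) / g"

definition oos_good where
  "oos_good d m s u ase Q i v X c E \<longleftrightarrow>
    (\<forall>a<d. \<forall>b<d. dot d (frame d m s X (ase (omni_adj m s E)) a) (frame d m s X (ase (omni_adj m s E)) b) = of_bool (a = b)) \<and>
    (Q i)\<^sup>T * oos_embedding ase d m s (observed s u Q E) i \<in> carrier_mat u d \<and>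
    nrm d (\<lambda>a. ((Q i)\<^sup>T * oos_embedding ase d m s (observed s u Q E) i) $$ (v, a)
       - dot d (frame d m s X (ase (omni_adj m s E)) a) (X (s + v))) \<le> c"

text \<open>The thresholds are matched to the variances: 2 sqrt(s) \<ll> for variance s, and 2 b
  sqrt(s) \<ll> for variance b^2 s. All m s d + m s^2 + d bad events then have the same tail 2
  exp(-8 \<ll>^2).\<close>

lemma oos_conditional_probability:
  assumes dm: "0 < d" "0 < m" and ll: "1 \<le> \<ll>"
    and inner: "\<And>p q. p < s + u \<Longrightarrow> q < s + u \<Longrightarrow> dot d (X p) (X q) \<in> {0..1}"
    and gram: "\<And>c. g * s * (nrm d c)\<^sup>2 \<le> (nrm s (mv d X c))\<^sup>2"
    and ase: "ASE_choice d ase"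
    and gs: "gram_schmidt_modulus d d K \<eta>\<^sub>0" and pos: "0 < g" "0 < K" "0 < \<eta>\<^sub>0"
    and large: "1 \<le> s" "d \<le> s" "32 * real m ^ 4 * \<ll> < g\<^sup>2 * sqrt (real s)"
      "residual_const d m g * \<ll> \<le> \<eta>\<^sub>0 * sqrt (g / 2) * sqrt (real s)"
      "2 * real d * alignment_const d m g K * \<ll> \<le> sqrt g * sqrt (real s)"
    and Q: "\<And>k. k < m \<Longrightarrow> Q k \<in> perm_mats u" and i: "i < m" and v: "v < u"
  shows "measure_pmf.prob (edge_pmf d (s + u) m X)
      {E. \<not> oos_good d m s u ase Q i v X (oos_const d m g K * (\<ll> / sqrt (real s))) E}
    \<le> (real m * s * d + real m * s * s + d) * (2 * exp (- 8 * \<ll>\<^sup>2))"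
proof -
  define t where "t = 2 * sqrt (real s) * \<ll>"
  define b where "b = sqrt ((real m)\<^sup>2 + g)"
  let ?P = "measure_pmf.prob (edge_pmf d (s + u) m X)"
  let ?\<epsilon> = "2 * exp (- 8 * \<ll>\<^sup>2)"
  define A where "A = (\<lambda>(k, p, a). {E. t \<le> \<bar>\<Sum>q<s. edge_noise d X E k p q * X q a\<bar>})"
  define B where "B = (\<lambda>(k, p, q). if p = q then {} else
     {E. t \<le> \<bar>\<Sum>r<s. edge_noise d X E k p r * edge_noise d X E k r q\<bar>})"
  define C where "C = (\<lambda>a. {E. (\<Sum>p<s. (ase (omni_adj m s E) $$ (i * s + p, a))\<^sup>2) \<le> b\<^sup>2 * s \<and>
     2 * b * sqrt (real s) * \<ll> \<le> \<bar>\<Sum>p<s. ase (omni_adj m s E) $$ (i * s + p, a) * edge_noise d X E i p (s + v)\<bar>})"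
  have s0: "0 < real s" using large by simp
  have b0: "0 < b" using pos by (simp add: b_def add_nonneg_pos)
  have t0: "0 < t" using ll s0 by (simp add: t_def)
  have te: "2 * exp (- 2 * t\<^sup>2 / s) = ?\<epsilon>"
    using s0 by (simp add: t_def power_mult_distrib)
  have te2: "2 * exp (- 2 * (2 * b * sqrt (real s) * \<ll>)\<^sup>2 / (b\<^sup>2 * s)) = ?\<epsilon>"
    using s0 b0 by (simp add: power_mult_distrib)
  have PA: "?P (A x) \<le> ?\<epsilon>" if x0: "x \<in> {..<m} \<times> {..<s} \<times> {..<d}" for x
  proof -
    obtain k p a where x: "x = (k, p, a)" "k < m" "p < s" "a < d" using x0 by auto
    have "?P (A x) \<le> 2 * exp (- 2 * t\<^sup>2 / s)"
      unfolding x A_def prod.case by (rule noise_X_tail) (use inner x t0 in auto)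
    thus ?thesis unfolding te .
  qed
  have PB: "?P (B x) \<le> ?\<epsilon>" if x0: "x \<in> {..<m} \<times> {..<s} \<times> {..<s}" for x
  proof -
    obtain k p q where x: "x = (k, p, q)" "k < m" "p < s" "q < s" using x0 by auto
    have "?P (B x) \<le> 2 * exp (- 2 * t\<^sup>2 / s)" if "p \<noteq> q"
      using that unfolding x B_def prod.case if_not_P[OF that] by (intro noise_sq_tail) (use inner x t0 in auto)
    moreover have "?P (B x) \<le> ?\<epsilon>" if "p = q" using that by (simp add: x B_def)
    ultimately show ?thesis unfolding te by blast
  qed
  have PC: "?P (C a) \<le> ?\<epsilon>" for a
  proof -
    have "?P (C a) \<le> 2 * exp (- 2 * (2 * b * sqrt (real s) * \<ll>)\<^sup>2 / (b\<^sup>2 * s))"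
      unfolding C_def by (rule regression_noise_tail) (use inner i v b0 s0 ll in auto)
    thus ?thesis unfolding te2 .
  qed
  let ?bad = "(\<Union>x\<in>{..<m} \<times> {..<s} \<times> {..<d}. A x) \<union> (\<Union>x\<in>{..<m} \<times> {..<s} \<times> {..<s}. B x) \<union> (\<Union>a\<in>{..<d}. C a)"
  have sub: "{E. \<not> oos_good d m s u ase Q i v X (oos_const d m g K * (\<ll> / sqrt (real s))) E} \<subseteq> ?bad"
  proof (rule subsetI, rule ccontr)
    fix E assume nb: "E \<notin> ?bad" and "E \<in> {E. \<not> oos_good d m s u ase Q i v X (oos_const d m g K * (\<ll> / sqrt (real s))) E}"
    hence ng: "\<not> oos_good d m s u ase Q i v X (oos_const d m g K * (\<ll> / sqrt (real s))) E" by simp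
    have nA: "\<bar>\<Sum>q<s. edge_noise d X E k p q * X q a\<bar> \<le> t" if "k < m" "p < s" "a < d" for k p a
    proof -
      have "E \<notin> A (k, p, a)" using nb that by blast
      thus ?thesis by (simp add: A_def)
    qed
    have nB: "\<bar>\<Sum>r<s. edge_noise d X E k p r * edge_noise d X E k r q\<bar> \<le> t" if "k < m" "p < s" "q < s" "p \<noteq> q" for k p q
    proof -
      have "E \<notin> B (k, p, q)" using nb that by blast
      thus ?thesis using that by (simp add: B_def)
    qed
    interpret G: good_sample d m s X E ase g K \<eta>\<^sub>0 \<ll> t
      by unfold_locales (use dm ll inner gram nA nB ase gs pos large t_def in auto)
    have Gb: "G.b = b" by (simp add: G.b_def b_def)
    \<comment> \<open>Outside \<open>A\<close> and \<open>B\<close> the columns of the embedding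
      already obey the length bound built into \<open>C\<close>, so avoiding \<open>C\<close> bounds
      the cross noise itself.\<close>
    have N: "\<bar>\<Sum>p<s. ase (omni_adj m s E) $$ (i * s + p, a) * edge_noise d X E i p (s + v)\<bar> \<le> 2 * G.b * sqrt (real s) * \<ll>"
      if a: "a < d" for a
    proof -
      have "(\<Sum>p<s. (ase (omni_adj m s E) $$ (i * s + p, a))\<^sup>2) = (nrm s (\<lambda>p. ase (omni_adj m s E) $$ (i * s + p, a)))\<^sup>2"
        unfolding dot_self[symmetric] by (simp add: dot_def power2_eq_square)
      also have "\<dots> \<le> (b * sqrt (real s))\<^sup>2"
        using G.column_Z[OF i a] unfolding Gb by (intro power_mono) auto
      finally have "(\<Sum>p<s. (ase (omni_adj m s E) $$ (i * s + p, a))\<^sup>2) \<le> b\<^sup>2 * s"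
        by (simp add: power_mult_distrib)
      moreover have "E \<notin> C a" using nb a by blast
      ultimately show ?thesis by (simp add: C_def Gb)
    qed
    have x: "nrm d (X (s + v)) \<le> 1" using inner[of "s + v" "s + v"] v by (simp add: nrm_def)
    have 1: "(Q i)\<^sup>T * oos_embedding ase d m s (observed s u Q E) i \<in> carrier_mat u d"
      using G.oos_error(1)[of Q u i v] Q i v x N by blast
    have 2: "nrm d (\<lambda>a. ((Q i)\<^sup>T * oos_embedding ase d m s (observed s u Q E) i) $$ (v, a)
        - dot d (frame d m s X (ase (omni_adj m s E)) a) (X (s + v)))
      \<le> 4 * real d * (2 * G.b + G.b * (d * alignment_const d m g K)) / g * (\<ll> / sqrt (real s))"
      using G.oos_error(2)[of Q u i v] Q i v x N by blast
    have "oos_good d m s u ase Q i v X (oos_const d m g K * (\<ll> / sqrt (real s))) E"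
      using 1 2 G.orthonormal_w unfolding oos_good_def oos_const_def Gb b_def by blast
    thus False using ng by simp
  qed
  have "?P {E. \<not> oos_good d m s u ase Q i v X (oos_const d m g K * (\<ll> / sqrt (real s))) E} \<le> ?P ?bad"
    using sub by (intro measure_pmf.finite_measure_mono) auto
  also have "\<dots> \<le> ?P (\<Union>x\<in>{..<m} \<times> {..<s} \<times> {..<d}. A x) + ?P (\<Union>x\<in>{..<m} \<times> {..<s} \<times> {..<s}. B x) + ?P (\<Union>a\<in>{..<d}. C a)"
    by (intro order_trans[OF measure_Un_le] add_mono measure_Un_le) auto
  also have "\<dots> \<le> (\<Sum>x\<in>{..<m} \<times> {..<s} \<times> {..<d}. ?P (A x)) + (\<Sum>x\<in>{..<m} \<times> {..<s} \<times> {..<s}. ?P (B x)) + (\<Sum>a\<in>{..<d}. ?P (C a))"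
    by (intro add_mono measure_UNION_le) auto
  also have "\<dots> \<le> (\<Sum>x\<in>{..<m} \<times> {..<s} \<times> {..<d}. ?\<epsilon>) + (\<Sum>x\<in>{..<m} \<times> {..<s} \<times> {..<s}. ?\<epsilon>) + (\<Sum>a\<in>{..<d}. ?\<epsilon>)"
    by (intro add_mono sum_mono PA PB PC)
  also have "\<dots> = (real m * s * d + real m * s * s + d) * ?\<epsilon>"
    by (simp add: distrib_right mult.assoc)
  finally show ?thesis .
qed

section \<open>Latent positions\<close>

lemma sum_abs_sq_le: "(\<Sum>a<d. \<bar>c a\<bar>)\<^sup>2 \<le> real d * (nrm d c)\<^sup>2"
proof -
  have "(\<Sum>a<d. \<bar>c a\<bar>)\<^sup>2 \<le> (sqrt (real d) * nrm d c)\<^sup>2"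
    by (intro power_mono sum_abs_le_nrm sum_nonneg) auto
  thus ?thesis by (simp add: power_mult_distrib)
qed

text \<open>An entrywise error \<theta> changes the form by at most \<theta> (sum of |c a|)^2 \<le>
  \<theta> d |c|^2. The tolerance \<mu> / (2 d) therefore costs half of \<mu>.\<close>

lemma gram_from_moments:
  assumes \<Delta>: "\<And>c. \<mu> * (nrm d c)\<^sup>2 \<le> (\<Sum>a<d. \<Sum>b<d. c a * c b * \<Delta> a b)"
    and close: "\<And>a b. a < d \<Longrightarrow> b < d \<Longrightarrow> \<bar>(\<Sum>p<s. X p a * X p b) - s * \<Delta> a b\<bar> \<le> s * (\<mu> / (2 * real d))"
    and "0 < \<mu>" "0 < d"
  shows "\<mu> / 2 * s * (nrm d c)\<^sup>2 \<le> (nrm s (mv d X c))\<^sup>2"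
proof -
  let ?\<theta> = "s * (\<mu> / (2 * real d))"
  have "(nrm s (mv d X c))\<^sup>2 = (\<Sum>p<s. (\<Sum>a<d. X p a * c a) * (\<Sum>b<d. X p b * c b))"
    unfolding dot_self[symmetric] by (simp add: dot_def mv_def)
  also have "\<dots> = (\<Sum>p<s. \<Sum>a<d. \<Sum>b<d. c a * c b * (X p a * X p b))"
    unfolding sum_product by (intro sum.cong refl) (simp add: ac_simps)
  also have "\<dots> = (\<Sum>a<d. \<Sum>b<d. c a * c b * (\<Sum>p<s. X p a * X p b))"
    by (subst sum.swap, rule sum.cong[OF refl], subst sum.swap) (simp add: sum_distrib_left)
  also have "\<dots> = (\<Sum>a<d. \<Sum>b<d. s * (c a * c b * \<Delta> a b)) + (\<Sum>a<d. \<Sum>b<d. c a * c b * ((\<Sum>p<s. X p a * X p b) - s * \<Delta> a b))"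
    unfolding sum.distrib[symmetric] by (intro sum.cong refl) (simp add: algebra_simps)
  also have "\<dots> \<ge> s * (\<mu> * (nrm d c)\<^sup>2) + - (?\<theta> * (d * (nrm d c)\<^sup>2))"
  proof (rule add_mono)
    show "s * (\<mu> * (nrm d c)\<^sup>2) \<le> (\<Sum>a<d. \<Sum>b<d. s * (c a * c b * \<Delta> a b))"
      unfolding sum_distrib_left[symmetric] by (intro mult_left_mono \<Delta>) auto
    have "- (\<Sum>a<d. \<Sum>b<d. c a * c b * ((\<Sum>p<s. X p a * X p b) - s * \<Delta> a b))
        \<le> (\<Sum>a<d. \<Sum>b<d. \<bar>c a\<bar> * \<bar>c b\<bar> * ?\<theta>)"
      unfolding sum_negf[symmetric]
    proof (intro sum_mono)
      fix a b assume ab: "a \<in> {..<d}" "b \<in> {..<d}"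
      have "- (c a * c b * ((\<Sum>p<s. X p a * X p b) - s * \<Delta> a b))
          \<le> \<bar>c a * c b * ((\<Sum>p<s. X p a * X p b) - s * \<Delta> a b)\<bar>" by linarith
      also have "\<dots> \<le> \<bar>c a\<bar> * \<bar>c b\<bar> * ?\<theta>"
        unfolding abs_mult using ab by (intro mult_left_mono close) auto
      finally show "- (c a * c b * ((\<Sum>p<s. X p a * X p b) - s * \<Delta> a b)) \<le> \<bar>c a\<bar> * \<bar>c b\<bar> * ?\<theta>" .
    qed
    also have "\<dots> = ?\<theta> * (\<Sum>a<d. \<bar>c a\<bar>)\<^sup>2"
      unfolding power2_eq_square sum_product unfolding sum_distrib_left by (intro sum.cong refl) (simp only: ac_simps)
    also have "\<dots> \<le> ?\<theta> * (d * (nrm d c)\<^sup>2)"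
      using \<open>0 < \<mu>\<close> by (intro mult_left_mono sum_abs_sq_le) auto
    finally show "- (?\<theta> * (d * (nrm d c)\<^sup>2)) \<le> (\<Sum>a<d. \<Sum>b<d. c a * c b * ((\<Sum>p<s. X p a * X p b) - s * \<Delta> a b))"
      by linarith
  qed
  finally have "s * (\<mu> * (nrm d c)\<^sup>2) + - (?\<theta> * (d * (nrm d c)\<^sup>2)) \<le> (nrm s (mv d X c))\<^sup>2" .
  moreover have "?\<theta> * (d * (nrm d c)\<^sup>2) = s * \<mu> * (nrm d c)\<^sup>2 / 2"
    using \<open>0 < d\<close> by (simp add: field_simps)
  moreover have "\<mu> / 2 * s * (nrm d c)\<^sup>2 = s * (\<mu> * (nrm d c)\<^sup>2) - s * \<mu> * (nrm d c)\<^sup>2 / 2"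
    by (simp add: field_simps)
  ultimately show ?thesis by linarith
qed

text \<open>An invertible positive semidefinite form is definite: evaluate it at \<open>x - (1/\<beta>) \<Delta>\<^sup>-\<^sup>1 x\<close>, where \<open>\<beta>\<close>
  bounds the quadratic form of the inverse.\<close>

lemma psd_invertible_lower:
  assumes D: "D \<in> carrier_mat d d" and det: "det D \<noteq> 0"
    and sym: "\<And>a b. a < d \<Longrightarrow> b < d \<Longrightarrow> D $$ (a, b) = D $$ (b, a)"
    and psd: "\<And>c. 0 \<le> dot d c (mv d (\<lambda>a b. D $$ (a, b)) c)"
  shows "\<exists>\<mu>>0. \<forall>c. \<mu> * (nrm d c)\<^sup>2 \<le> dot d c (mv d (\<lambda>a b. D $$ (a, b)) c)"
proof -
  let ?D = "\<lambda>a b. D $$ (a, b)"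
  have "D \<in> Units (ring_mat TYPE(real) d ())" by (rule det_non_zero_imp_unit[OF D det])
  then obtain B where B: "B \<in> carrier_mat d d" "D * B = 1\<^sub>m d"
    unfolding Units_def ring_mat_def by auto
  let ?B = "\<lambda>a b. B $$ (a, b)"
  define \<beta> where "\<beta> = 1 + (\<Sum>a<d. \<Sum>b<d. \<bar>B $$ (a, b)\<bar>)"
  have \<beta>: "0 < \<beta>" unfolding \<beta>_def by (intro add_pos_nonneg sum_nonneg) auto
  have DB: "mv d ?D (mv d ?B c) a = c a" if "a < d" for c a
  proof -
    have "mv d ?D (mv d ?B c) a = (\<Sum>j<d. (D * B) $$ (a, j) * c j)"
    proof -
      have DBi: "(D * B) $$ (a, j) = (\<Sum>k<d. D $$ (a, k) * B $$ (k, j))" if "j < d" for j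
        using that \<open>a < d\<close> B(1) D by (simp add: scalar_prod_def atLeast0LessThan)
      have "mv d ?D (mv d ?B c) a = (\<Sum>j<d. (\<Sum>k<d. D $$ (a, k) * B $$ (k, j)) * c j)"
        unfolding mv_def sum_distrib_left sum_distrib_right by (subst sum.swap) (simp add: mult.assoc)
      also have "\<dots> = (\<Sum>j<d. (D * B) $$ (a, j) * c j)" by (intro sum.cong refl) (simp add: DBi)
      finally show ?thesis .
    qed
    also have "\<dots> = (\<Sum>j<d. if j = a then c j else 0)"
      unfolding B by (intro sum.cong) (use that in auto)
    finally show ?thesis using that by simp
  qed
  have Bq: "dot d c (mv d ?B c) \<le> \<beta> * (nrm d c)\<^sup>2" for c
  proof -
    have "dot d c (mv d ?B c) = (\<Sum>a<d. \<Sum>b<d. c a * (B $$ (a, b) * c b))"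
      by (simp add: dot_def mv_def sum_distrib_left)
    also have "\<dots> \<le> (\<Sum>a<d. \<Sum>b<d. \<bar>B $$ (a, b)\<bar> * (nrm d c * nrm d c))"
    proof (intro sum_mono)
      fix a b assume ab: "a \<in> {..<d}" "b \<in> {..<d}"
      have "c a * (B $$ (a, b) * c b) \<le> \<bar>B $$ (a, b)\<bar> * (\<bar>c a\<bar> * \<bar>c b\<bar>)"
        using abs_ge_self[of "c a * (B $$ (a, b) * c b)"] by (simp add: abs_mult ac_simps)
      also have "\<dots> \<le> \<bar>B $$ (a, b)\<bar> * (nrm d c * nrm d c)"
        using ab by (intro mult_left_mono mult_mono abs_le_nrm) auto
      finally show "c a * (B $$ (a, b) * c b) \<le> \<bar>B $$ (a, b)\<bar> * (nrm d c * nrm d c)" .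
    qed
    also have "\<dots> = (\<Sum>a<d. \<Sum>b<d. \<bar>B $$ (a, b)\<bar>) * (nrm d c)\<^sup>2"
      by (simp add: sum_distrib_right power2_eq_square)
    also have "\<dots> \<le> \<beta> * (nrm d c)\<^sup>2"
      by (intro mult_right_mono) (auto simp: \<beta>_def)
    finally show ?thesis .
  qed
  have "1 / \<beta> * (nrm d c)\<^sup>2 \<le> dot d c (mv d ?D c)" for c
  proof -
    define y where "y = mv d ?B c"
    define e where "e = (\<lambda>i. c i - 1 / \<beta> * y i)"
    have De: "mv d ?D e a = mv d ?D c a - 1 / \<beta> * c a" if "a < d" for a
      unfolding e_def mv_diff mv_scale y_def DB[OF that] ..
    have yD: "dot d y (mv d ?D c) = (nrm d c)\<^sup>2"
    proof -
      have "dot d y (mv d ?D c) = dot d (mv d ?D y) c" using mv_sym[OF sym] by simp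
      also have "\<dots> = dot d c c" by (intro dot_cong) (simp_all add: y_def DB)
      finally show ?thesis by (simp add: dot_self)
    qed
    have "0 \<le> dot d e (mv d ?D e)" by (rule psd)
    also have "\<dots> = dot d e (\<lambda>a. mv d ?D c a - 1 / \<beta> * c a)"
      by (intro dot_cong) (simp_all add: De)
    also have "\<dots> = dot d c (mv d ?D c) - 1 / \<beta> * (nrm d c)\<^sup>2 - 1 / \<beta> * ((nrm d c)\<^sup>2 - 1 / \<beta> * dot d c y)"
      unfolding e_def dot_diff_left dot_diff_right dot_scale_left dot_scale_right yD dot_self dot_commute[of d y c]
      by (simp only: right_diff_distrib)
    finally have 1: "0 \<le> dot d c (mv d ?D c) - 1 / \<beta> * (nrm d c)\<^sup>2 - 1 / \<beta> * ((nrm d c)\<^sup>2 - 1 / \<beta> * dot d c y)" .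
    have "1 / \<beta> * dot d c y \<le> 1 / \<beta> * (\<beta> * (nrm d c)\<^sup>2)"
      unfolding y_def using \<beta> by (intro mult_left_mono Bq) auto
    hence "0 \<le> 1 / \<beta> * ((nrm d c)\<^sup>2 - 1 / \<beta> * dot d c y)" using \<beta> by simp
    thus ?thesis using 1 by linarith
  qed
  thus ?thesis using \<beta> by (intro exI[of _ "1 / \<beta>"]) simp
qed

section \<open>Moments and concentration of the latent positions\<close>

context
  fixes d :: nat and F :: "(nat \<Rightarrow> real) measure"
  assumes ipd: "inner_product_distribution d F"
begin

lemma F_prob: "prob_space F" and F_sets: "sets F = sets (Rd d)"
  using ipd by (auto simp: inner_product_distribution_def)

lemma F_space: "space F = space (Rd d)"
  using F_sets by (rule sets_eq_imp_space_eq)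

lemma coordinate_measurable: "a < d \<Longrightarrow> (\<lambda>x. x a) \<in> borel_measurable F"
  by (subst measurable_cong_sets[OF F_sets refl]) auto

lemma latent_measurable:
  fixes n :: nat
  assumes "p < n" "a < d"
  shows "(\<lambda>X. X p a) \<in> borel_measurable (\<Pi>\<^sub>M i\<in>{..<n}. F)"
  by (rule measurable_compose[OF measurable_component_singleton[of p] coordinate_measurable]) (use assms in auto)

lemma prob_space_latent: "prob_space (\<Pi>\<^sub>M i\<in>{..<n}. F)" for n :: nat
  by (rule prob_space_PiM) (rule F_prob)

lemma AE_coordinate_bounded: "AE x in F. \<forall>a<d. \<bar>x a\<bar> \<le> 1"
proof -
  obtain \<X> where ae: "AE x in F. x \<in> \<X>" and \<X>: "\<And>x y. x \<in> \<X> \<Longrightarrow> y \<in> \<X> \<Longrightarrow> vec d x \<bullet> vec d y \<in> {0..1}"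
    using ipd by (auto simp: inner_product_distribution_def)
  show ?thesis
    using ae
  proof (eventually_elim, intro allI impI)
    fix x a assume "x \<in> \<X>" "a < d"
    hence "\<bar>x a\<bar> \<le> nrm d x" "dot d x x \<le> 1"
      using \<X>[of x x] abs_le_nrm[of a d x] by (auto simp: scalar_prod_vec)
    thus "\<bar>x a\<bar> \<le> 1" by (simp add: nrm_def) (meson order_trans real_sqrt_le_1_iff)
  qed
qed

lemma AE_latent_inner: "AE X in (\<Pi>\<^sub>M i\<in>{..<n}. F). \<forall>p<n. \<forall>q<n. dot d (X p) (X q) \<in> {0..1}" for n :: nat
proof -
  obtain \<X> where ae: "AE x in F. x \<in> \<X>" and \<X>: "\<And>x y. x \<in> \<X> \<Longrightarrow> y \<in> \<X> \<Longrightarrow> vec d x \<bullet> vec d y \<in> {0..1}"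
    using ipd by (auto simp: inner_product_distribution_def)
  have "AE X in (\<Pi>\<^sub>M i\<in>{..<n}. F). \<forall>p\<in>{..<n}. X p \<in> \<X>"
    by (rule AE_finite_allI) (use ae F_prob in \<open>auto intro!: AE_PiM_component\<close>)
  thus ?thesis by eventually_elim (use \<X> in \<open>auto simp: scalar_prod_vec\<close>)
qed

lemma moment_integrable: "a < d \<Longrightarrow> b < d \<Longrightarrow> integrable F (\<lambda>y. y a * y b)"
proof (rule finite_measure.integrable_const_bound[where B = 1])
  interpret prob_space F by (rule F_prob)
  show "finite_measure F" by unfold_locales
  assume ab: "a < d" "b < d"
  show "AE y in F. norm (y a * y b) \<le> 1"
    using AE_coordinate_bounded by eventually_elim (use ab in \<open>auto simp: abs_mult intro!: mult_le_one\<close>)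
  show "(\<lambda>y. y a * y b) \<in> borel_measurable F"
    using ab by (intro borel_measurable_times coordinate_measurable)
qed

abbreviation "moment a b \<equiv> second_moment d F $$ (a, b)"

lemma moment_eq: "a < d \<Longrightarrow> b < d \<Longrightarrow> moment a b = (\<integral>y. y a * y b \<partial>F)"
  by (simp add: second_moment_def)

text \<open>As a mean of squares the form is visibly positive semidefinite, which together with full
  rank makes it definite.\<close>

lemma moment_quadratic:
  "dot d c (mv d (\<lambda>a b. moment a b) c) = (\<integral>y. (dot d c y)\<^sup>2 \<partial>F)"
proof -
  have "(\<integral>y. (dot d c y)\<^sup>2 \<partial>F) = (\<integral>y. (\<Sum>a<d. \<Sum>b<d. c a * c b * (y a * y b)) \<partial>F)"
    by (intro Bochner_Integration.integral_cong refl)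
       (simp add: power2_eq_square dot_def sum_product ac_simps)
  also have "\<dots> = (\<Sum>a<d. \<Sum>b<d. c a * c b * (\<integral>y. y a * y b \<partial>F))"
  proof -
    have 1: "integrable F (\<lambda>y. c a * c b * (y a * y b))" if "a < d" "b < d" for a b
      using that by (intro integrable_mult_right moment_integrable)
    have "(\<integral>y. (\<Sum>a<d. \<Sum>b<d. c a * c b * (y a * y b)) \<partial>F) = (\<Sum>a<d. \<integral>y. (\<Sum>b<d. c a * c b * (y a * y b)) \<partial>F)"
      by (intro Bochner_Integration.integral_sum Bochner_Integration.integrable_sum 1) auto
    also have "\<dots> = (\<Sum>a<d. \<Sum>b<d. \<integral>y. c a * c b * (y a * y b) \<partial>F)"
      by (intro sum.cong refl Bochner_Integration.integral_sum 1) auto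
    finally show ?thesis by simp
  qed
  also have "\<dots> = dot d c (mv d (\<lambda>a b. moment a b) c)"
    by (simp add: dot_def mv_def moment_eq sum_distrib_left ac_simps)
  finally show ?thesis ..
qed

lemma moment_lower:
  assumes "vec_space.rank d (second_moment d F) = d"
  shows "\<exists>\<mu>>0. \<forall>c. \<mu> * (nrm d c)\<^sup>2 \<le> (\<Sum>a<d. \<Sum>b<d. c a * c b * moment a b)"
proof -
  have D: "second_moment d F \<in> carrier_mat d d" by (simp add: second_moment_def)
  have "\<exists>\<mu>>0. \<forall>c. \<mu> * (nrm d c)\<^sup>2 \<le> dot d c (mv d (\<lambda>a b. moment a b) c)"
  proof (rule psd_invertible_lower[OF D])
    show "det (second_moment d F) \<noteq> 0" using vec_space.det_rank_iff[OF D] assms by blast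
    show "0 \<le> dot d c (mv d (\<lambda>a b. moment a b) c)" for c
      unfolding moment_quadratic by simp
    show "moment a b = moment b a" if "a < d" "b < d" for a b
      using that by (simp add: moment_eq mult.commute)
  qed
  thus ?thesis by (simp add: dot_def mv_def sum_distrib_left ac_simps)
qed

lemma latent_indep:
  fixes n :: nat
  assumes "0 < n"
  shows "prob_space.indep_vars (\<Pi>\<^sub>M i\<in>{..<n}. F) (\<lambda>_. F) (\<lambda>p X. X p) {..<n}"
proof -
  interpret P: prob_space "\<Pi>\<^sub>M i\<in>{..<n}. F" by (rule prob_space_latent)
  have "distr (\<Pi>\<^sub>M i\<in>{..<n}. F) (\<Pi>\<^sub>M i\<in>{..<n}. F) (\<lambda>X. \<lambda>i\<in>{..<n}. X i)
      = distr (\<Pi>\<^sub>M i\<in>{..<n}. F) (\<Pi>\<^sub>M i\<in>{..<n}. F) (\<lambda>X. X)"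
    by (intro distr_cong) (auto simp: space_PiM PiE_def extensional_restrict)
  also have "\<dots> = (\<Pi>\<^sub>M i\<in>{..<n}. F)" by simp
  also have "\<dots> = (\<Pi>\<^sub>M i\<in>{..<n}. distr (\<Pi>\<^sub>M i\<in>{..<n}. F) F (\<lambda>X. X i))"
    by (intro PiM_cong refl) (simp add: distr_PiM_component[OF F_prob])
  finally show ?thesis
    using assms by (subst P.indep_vars_iff_distr_eq_PiM') auto
qed

lemma moment_concentration:
  fixes n s :: nat
  assumes ab: "a < d" "b < d" and s: "0 < s" "s \<le> n" and t: "0 \<le> t"
  shows "measure (\<Pi>\<^sub>M i\<in>{..<n}. F) {X \<in> space (\<Pi>\<^sub>M i\<in>{..<n}. F). t \<le> \<bar>(\<Sum>p<s. X p a * X p b) - s * moment a b\<bar>}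
    \<le> 2 * exp (- 2 * t\<^sup>2 / (4 * s))"
proof -
  let ?P = "\<Pi>\<^sub>M i\<in>{..<n}. F"
  interpret P: prob_space ?P by (rule prob_space_latent)
  have m: "(\<lambda>y. y a * y b) \<in> borel_measurable F"
    using ab by (intro borel_measurable_times coordinate_measurable)
  have ind: "P.indep_vars (\<lambda>_. borel) (\<lambda>p X. X p a * X p b) {..<s}"
    by (rule P.indep_vars_subset[of _ _ "{..<n}"], rule P.indep_vars_compose2[OF latent_indep m]) (use s in auto)
  have bd: "AE X in ?P. X p a * X p b \<in> {-1..1}" if p: "p \<in> {..<s}" for p
  proof -
    have "AE y in F. y a * y b \<in> {-1..1}"
      using AE_coordinate_bounded
    proof eventually_elim
      fix y assume "\<forall>a<d. \<bar>y a\<bar> \<le> (1 :: real)"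
      hence "\<bar>y a * y b\<bar> \<le> 1" using ab by (auto simp: abs_mult intro!: mult_le_one)
      thus "y a * y b \<in> {-1..1}" by (auto simp: abs_le_iff)
    qed
    thus ?thesis using s p F_prob by (intro AE_PiM_component[where P = "\<lambda>y. y a * y b \<in> {-1..1}"]) auto
  qed
  interpret H: indep_interval_bounded_random_variables ?P "{..<s}" "\<lambda>p X. X p a * X p b" "\<lambda>_. -1" "\<lambda>_. 1"
    by (unfold_locales, rule finite_lessThan, rule ind, rule bd)
  have ex: "P.expectation (\<lambda>X. X p a * X p b) = moment a b" if p: "p < s" for p
  proof -
    have "moment a b = (\<integral>y. y a * y b \<partial>distr ?P F (\<lambda>X. X p))"
      using s p by (subst distr_PiM_component[OF F_prob]) (auto simp: moment_eq ab)
    also have "\<dots> = P.expectation (\<lambda>X. X p a * X p b)"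
      by (rule integral_distr) (use s p m in auto)
    finally show ?thesis ..
  qed
  interpret H: Hoeffding_ineq ?P "{..<s}" "\<lambda>p X. X p a * X p b" "\<lambda>_. -1" "\<lambda>_. 1" "\<Sum>p<s. P.expectation (\<lambda>X. X p a * X p b)"
    by unfold_locales simp
  have \<mu>: "(\<Sum>p<s. P.expectation (\<lambda>X. X p a * X p b)) = s * moment a b" by (simp add: ex)
  show ?thesis using H.Hoeffding_ineq_abs_ge[OF t] s unfolding \<mu> by (simp add: power2_eq_square)
qed

text \<open>The tolerance is the one that \<open>gram_from_moments\<close> absorbs. The range of the
  inner products is included because it is guaranteed only almost surely.\<close>

definition good_latent :: "nat \<Rightarrow> nat \<Rightarrow> real \<Rightarrow> (nat \<Rightarrow> nat \<Rightarrow> real) set" where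
  "good_latent n s \<mu> = {X \<in> space (\<Pi>\<^sub>M i\<in>{..<n}. F). (\<forall>p<n. \<forall>q<n. dot d (X p) (X q) \<in> {0..1}) \<and>
     (\<forall>a<d. \<forall>b<d. \<bar>(\<Sum>p<s. X p a * X p b) - s * moment a b\<bar> \<le> s * (\<mu> / (2 * real d)))}"

lemma moment_sum_measurable:
  fixes n s :: nat
  assumes "a < d" "b < d" "s \<le> n"
  shows "(\<lambda>X. \<bar>(\<Sum>p<s. X p a * X p b) - s * moment a b\<bar>) \<in> borel_measurable (\<Pi>\<^sub>M i\<in>{..<n}. F)"
  using assms by (intro borel_measurable_abs borel_measurable_diff borel_measurable_sum borel_measurable_times latent_measurable) auto

lemma inner_measurable:
  fixes n :: nat
  assumes "p < n" "q < n"
  shows "(\<lambda>X. dot d (X p) (X q)) \<in> borel_measurable (\<Pi>\<^sub>M i\<in>{..<n}. F)"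
  unfolding dot_def using assms by (intro borel_measurable_sum borel_measurable_times latent_measurable) auto

lemma sets_good_latent: "s \<le> n \<Longrightarrow> good_latent n s \<mu> \<in> sets (\<Pi>\<^sub>M i\<in>{..<n}. F)"
proof -
  assume s: "s \<le> n"
  have 1: "{X \<in> space (\<Pi>\<^sub>M i\<in>{..<n}. F). dot d (X p) (X q) \<in> {0..1}} \<in> sets (\<Pi>\<^sub>M i\<in>{..<n}. F)"
    if "p \<in> {..<n}" "q \<in> {..<n}" for p q
    using measurable_sets[OF inner_measurable, of p n q "{0..1}"] that by (simp add: vimage_def Int_def conj_commute)
  have 2: "{X \<in> space (\<Pi>\<^sub>M i\<in>{..<n}. F). \<bar>(\<Sum>p<s. X p a * X p b) - s * moment a b\<bar> \<le> s * (\<mu> / (2 * real d))}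
      \<in> sets (\<Pi>\<^sub>M i\<in>{..<n}. F)"
    if "a \<in> {..<d}" "b \<in> {..<d}" for a b
    using that s by (intro borel_measurable_le moment_sum_measurable borel_measurable_const) auto
  define A where "A = (\<lambda>X :: nat \<Rightarrow> nat \<Rightarrow> real. \<forall>p<n. \<forall>q<n. dot d (X p) (X q) \<in> {0..1})"
  define B where "B = (\<lambda>X :: nat \<Rightarrow> nat \<Rightarrow> real. \<forall>a<d. \<forall>b<d.
    \<bar>(\<Sum>p<s. X p a * X p b) - s * moment a b\<bar> \<le> s * (\<mu> / (2 * real d)))"
  have A: "A = (\<lambda>X. \<forall>p\<in>{..<n}. \<forall>q\<in>{..<n}. dot d (X p) (X q) \<in> {0..1})"
    by (simp only: A_def Ball_def lessThan_iff)
  have B: "B = (\<lambda>X. \<forall>a\<in>{..<d}. \<forall>b\<in>{..<d}. \<bar>(\<Sum>p<s. X p a * X p b) - s * moment a b\<bar> \<le> s * (\<mu> / (2 * real d)))"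
    by (simp only: B_def Ball_def lessThan_iff)
  have "{X \<in> space (\<Pi>\<^sub>M i\<in>{..<n}. F). A X} \<in> sets (\<Pi>\<^sub>M i\<in>{..<n}. F)"
    unfolding A by (intro sets.sets_Collect_finite_All 1) auto
  moreover have "{X \<in> space (\<Pi>\<^sub>M i\<in>{..<n}. F). B X} \<in> sets (\<Pi>\<^sub>M i\<in>{..<n}. F)"
    unfolding B by (intro sets.sets_Collect_finite_All 2) auto
  ultimately have "{X \<in> space (\<Pi>\<^sub>M i\<in>{..<n}. F). A X \<and> B X} \<in> sets (\<Pi>\<^sub>M i\<in>{..<n}. F)"
    by (rule sets.sets_Collect_conj[rotated])
  moreover have "good_latent n s \<mu> = {X \<in> space (\<Pi>\<^sub>M i\<in>{..<n}. F). A X \<and> B X}"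
    by (simp only: good_latent_def A_def B_def)
  ultimately show ?thesis by simp
qed

lemma measure_good_latent:
  assumes "0 < d" "0 < s" "s \<le> n" "0 < \<mu>"
  shows "1 - real d * d * (2 * exp (- (s * \<mu>\<^sup>2 / (8 * (real d)\<^sup>2)))) \<le> measure (\<Pi>\<^sub>M i\<in>{..<n}. F) (good_latent n s \<mu>)"
proof -
  let ?P = "\<Pi>\<^sub>M i\<in>{..<n}. F"
  interpret P: prob_space ?P by (rule prob_space_latent)
  define \<theta> where "\<theta> = s * (\<mu> / (2 * real d))"
  define I where "I = {X \<in> space ?P. \<forall>p<n. \<forall>q<n. dot d (X p) (X q) \<in> {0..1}}"
  define B where "B = (\<lambda>(a, b). {X \<in> space ?P. \<theta> \<le> \<bar>(\<Sum>p<s. X p a * X p b) - s * moment a b\<bar>})"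
  have Bs: "B x \<in> sets ?P" if x0: "x \<in> {..<d} \<times> {..<d}" for x
  proof -
    obtain a b where x: "x = (a, b)" "a < d" "b < d" using x0 by auto
    show ?thesis
      unfolding x B_def prod.case
      by (intro borel_measurable_le moment_sum_measurable borel_measurable_const x assms)
  qed
  have PB: "P.prob (B x) \<le> 2 * exp (- (s * \<mu>\<^sup>2 / (8 * (real d)\<^sup>2)))" if x0: "x \<in> {..<d} \<times> {..<d}" for x
  proof -
    obtain a b where x: "x = (a, b)" "a < d" "b < d" using x0 by auto
    have "P.prob (B x) \<le> 2 * exp (- 2 * \<theta>\<^sup>2 / (4 * s))"
      unfolding x B_def prod.case using assms by (intro moment_concentration x) (auto simp: \<theta>_def)
    also have "- 2 * \<theta>\<^sup>2 / (4 * s) = - (s * \<mu>\<^sup>2 / (8 * (real d)\<^sup>2))"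
      using assms by (simp add: \<theta>_def field_simps power2_eq_square)
    finally show ?thesis .
  qed
  have PU: "P.prob (\<Union>x\<in>{..<d} \<times> {..<d}. B x) \<le> real d * d * (2 * exp (- (s * \<mu>\<^sup>2 / (8 * (real d)\<^sup>2))))"
  proof -
    have "P.prob (\<Union>x\<in>{..<d} \<times> {..<d}. B x) \<le> (\<Sum>x\<in>{..<d} \<times> {..<d}. P.prob (B x))"
      by (intro measure_UNION_le Bs) auto
    also have "\<dots> \<le> (\<Sum>x\<in>{..<d} \<times> {..<d}. 2 * exp (- (s * \<mu>\<^sup>2 / (8 * (real d)\<^sup>2))))"
      by (intro sum_mono PB)
    finally show ?thesis by (simp add: mult.assoc)
  qed
  have U: "(\<Union>x\<in>{..<d} \<times> {..<d}. B x) \<in> sets ?P" by (intro sets.finite_UN Bs) auto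
  have "1 - P.prob (\<Union>x\<in>{..<d} \<times> {..<d}. B x) = P.prob (space ?P - (\<Union>x\<in>{..<d} \<times> {..<d}. B x))"
    using P.prob_compl[OF U] by simp
  also have "\<dots> \<le> P.prob (good_latent n s \<mu>)"
  \<comment> \<open>The inclusion holds up to a null set, on which inner products may leave the unit
    interval.\<close>
  proof (rule P.finite_measure_mono_AE)
    show "AE X in ?P. X \<in> space ?P - (\<Union>x\<in>{..<d} \<times> {..<d}. B x) \<longrightarrow> X \<in> good_latent n s \<mu>"
      using AE_latent_inner[of n]
    proof (eventually_elim, intro impI)
      fix X assume I: "\<forall>p<n. \<forall>q<n. dot d (X p) (X q) \<in> {0..1}"
        and X: "X \<in> space ?P - (\<Union>x\<in>{..<d} \<times> {..<d}. B x)"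
      have "\<bar>(\<Sum>p<s. X p a * X p b) - s * moment a b\<bar> \<le> s * (\<mu> / (2 * real d))" if "a < d" "b < d" for a b
      proof -
        have "X \<notin> B (a, b)" using X that by blast
        thus ?thesis using X unfolding B_def prod.case \<theta>_def by auto
      qed
      with I X show "X \<in> good_latent n s \<mu>" unfolding good_latent_def by blast
    qed
  qed (use sets_good_latent assms in auto)
  finally show ?thesis using PU by linarith
qed

section \<open>The joint law as a mixture over the latent positions\<close>

lemma JRDPG_eq:
  "JRDPG d F n m = (\<Pi>\<^sub>M i\<in>{..<n}. F) \<bind> (\<lambda>X. distr (measure_pmf (edge_pmf d n m X))
     (count_space UNIV \<Otimes>\<^sub>M (\<Pi>\<^sub>M i\<in>{..<n}. F)) (\<lambda>E. (E, X)))"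
proof -
  let ?P = "\<Pi>\<^sub>M i\<in>{..<n}. F"
  have "measure_pmf (edge_pmf d n m X) \<bind> (\<lambda>E. return (count_space UNIV \<Otimes>\<^sub>M ?P) (E, X))
      = distr (measure_pmf (edge_pmf d n m X)) (count_space UNIV \<Otimes>\<^sub>M ?P) (\<lambda>E. (E, X))" if "X \<in> space ?P" for X
    using that by (intro bind_return_distr') (auto simp: measurable_def space_pair_measure)
  thus ?thesis unfolding JRDPG_def by (intro bind_cong refl) auto
qed

lemma JRDPG_kernel:
  "(\<lambda>X. distr (measure_pmf (edge_pmf d n m X)) (count_space UNIV \<Otimes>\<^sub>M (\<Pi>\<^sub>M i\<in>{..<n}. F)) (\<lambda>E. (E, X)))
    \<in> measurable (\<Pi>\<^sub>M i\<in>{..<n}. F) (subprob_algebra (count_space UNIV \<Otimes>\<^sub>M (\<Pi>\<^sub>M i\<in>{..<n}. F)))"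
proof -
  let ?P = "\<Pi>\<^sub>M i\<in>{..<n}. F"
  have "(\<lambda>X. measure_pmf (edge_pmf d n m X) \<bind> (\<lambda>E. return (count_space UNIV \<Otimes>\<^sub>M ?P) (E, X)))
      \<in> measurable ?P (subprob_algebra (count_space UNIV \<Otimes>\<^sub>M ?P))"
    by (rule measurable_bind[OF measurable_edge_pmf[OF F_sets]]) (auto simp: measurable_pair_swap)
  also have "?this \<longleftrightarrow> ?thesis"
    by (intro measurable_cong bind_return_distr') (auto simp: measurable_def space_pair_measure)
  finally show ?thesis .
qed

lemma emeasure_JRDPG:
  assumes B: "B \<in> sets (JRDPG d F n m)"
  shows "emeasure (JRDPG d F n m) B
    = (\<integral>\<^sup>+X. emeasure (measure_pmf (edge_pmf d n m X)) {E. (E, X) \<in> B} \<partial>(\<Pi>\<^sub>M i\<in>{..<n}. F))"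
proof -
  let ?P = "\<Pi>\<^sub>M i\<in>{..<n}. F"
  interpret P: prob_space ?P by (rule prob_space_latent)
  have Bs: "B \<in> sets (count_space UNIV \<Otimes>\<^sub>M ?P)" using B sets_JRDPG[OF ipd] by blast
  have "emeasure (JRDPG d F n m) B = (\<integral>\<^sup>+X. emeasure (distr (measure_pmf (edge_pmf d n m X))
     (count_space UNIV \<Otimes>\<^sub>M ?P) (\<lambda>E. (E, X))) B \<partial>?P)"
    unfolding JRDPG_eq by (rule emeasure_bind[OF P.not_empty JRDPG_kernel Bs])
  also have "\<dots> = (\<integral>\<^sup>+X. emeasure (measure_pmf (edge_pmf d n m X)) {E. (E, X) \<in> B} \<partial>?P)"
    using Bs by (intro nn_integral_cong) (subst emeasure_distr, auto simp: measurable_def space_pair_measure vimage_def)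
  finally show ?thesis .
qed

lemma space_JRDPG: "space (JRDPG d F n m) = UNIV \<times> space (\<Pi>\<^sub>M i\<in>{..<n}. F)"
  using sets_eq_imp_space_eq[OF sets_JRDPG[OF ipd]] by (simp add: space_pair_measure)

text \<open>Integrate the conditional probability of the complement over the positions: it is at
  most \<epsilon> on \<open>G\<close> and at most 1 elsewhere.\<close>

lemma measure_JRDPG_ge:
  assumes B: "B \<in> sets (JRDPG d F n m)" and G: "G \<in> sets (\<Pi>\<^sub>M i\<in>{..<n}. F)"
    and PG: "1 - \<delta> \<le> measure (\<Pi>\<^sub>M i\<in>{..<n}. F) G" and \<epsilon>: "0 \<le> \<epsilon>"
    and PE: "\<And>X. X \<in> G \<Longrightarrow> measure_pmf.prob (edge_pmf d n m X) {E. (E, X) \<notin> B} \<le> \<epsilon>"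
  shows "1 - \<delta> - \<epsilon> \<le> measure (JRDPG d F n m) B"
proof -
  let ?P = "\<Pi>\<^sub>M i\<in>{..<n}. F" and ?J = "JRDPG d F n m"
  interpret P: prob_space ?P by (rule prob_space_latent)
  interpret J: prob_space ?J by (rule prob_space_JRDPG[OF ipd])
  have Bc: "space ?J - B \<in> sets ?J" using B by auto
  have "emeasure ?J (space ?J - B) = (\<integral>\<^sup>+X. emeasure (measure_pmf (edge_pmf d n m X)) {E. (E, X) \<in> space ?J - B} \<partial>?P)"
    by (rule emeasure_JRDPG[OF Bc])
  also have "\<dots> \<le> (\<integral>\<^sup>+X. indicator (space ?P - G) X + ennreal \<epsilon> \<partial>?P)"
  proof (rule nn_integral_mono)
    fix X assume X: "X \<in> space ?P"
    show "emeasure (measure_pmf (edge_pmf d n m X)) {E. (E, X) \<in> space ?J - B} \<le> indicator (space ?P - G) X + ennreal \<epsilon>"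
    proof (cases "X \<in> G")
      case True
      have "{E. (E, X) \<in> space ?J - B} = {E. (E, X) \<notin> B}" using X by (auto simp: space_JRDPG)
      thus ?thesis using PE[OF True] True \<epsilon> by (simp add: measure_pmf.emeasure_eq_measure ennreal_leI)
    next
      case False
      have "emeasure (measure_pmf (edge_pmf d n m X)) {E. (E, X) \<in> space ?J - B} \<le> 1"
        by (rule measure_pmf.emeasure_le_1)
      also have "\<dots> \<le> indicator (space ?P - G) X + ennreal \<epsilon>" using X False by simp
      finally show ?thesis .
    qed
  qed
  also have "\<dots> = emeasure ?P (space ?P - G) + ennreal \<epsilon>"
    using G by (subst nn_integral_add) (auto simp: P.emeasure_space_1)
  also have "\<dots> = ennreal (P.prob (space ?P - G) + \<epsilon>)"
    using \<epsilon> by (simp add: P.emeasure_eq_measure ennreal_plus)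
  finally have "ennreal (J.prob (space ?J - B)) \<le> ennreal (P.prob (space ?P - G) + \<epsilon>)"
    unfolding J.emeasure_eq_measure .
  hence "J.prob (space ?J - B) \<le> P.prob (space ?P - G) + \<epsilon>"
    using \<epsilon> by (subst (asm) ennreal_le_iff) auto
  thus ?thesis using PG P.prob_compl[OF G] J.prob_compl[OF B] by linarith
qed

end

section \<open>The out-of-sample error bound\<close>

text \<open>The identity is the default on samples where the frame fails to be orthonormal, since
  \<open>OOS_bound\<close> asks for an orthogonal matrix at every sample point. Frame vectors are
  the columns.\<close>

definition frame_mat :: "nat \<Rightarrow> nat \<Rightarrow> nat \<Rightarrow> (nat \<Rightarrow> nat \<Rightarrow> real) \<Rightarrow> real mat \<Rightarrow> real mat" where
  "frame_mat d m s X Z =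
    (if \<forall>a<d. \<forall>b<d. dot d (frame d m s X Z a) (frame d m s X Z b) = of_bool (a = b)
     then mat d d (\<lambda>(c, a). frame d m s X Z a c) else 1\<^sub>m d)"

lemma frame_mat_orthogonal: "frame_mat d m s X Z \<in> orthogonal_mats d"
proof (cases "\<forall>a<d. \<forall>b<d. dot d (frame d m s X Z a) (frame d m s X Z b) = of_bool (a = b)")
  case True
  have "(mat d d (\<lambda>(c, a). frame d m s X Z a c))\<^sup>T * mat d d (\<lambda>(c, a). frame d m s X Z a c) = 1\<^sub>m d"
  proof (rule eq_matI)
    fix a b assume "a < dim_row (1\<^sub>m d :: real mat)" "b < dim_col (1\<^sub>m d :: real mat)"
    hence ab: "a < d" "b < d" by auto
    have "((mat d d (\<lambda>(c, a). frame d m s X Z a c))\<^sup>T * mat d d (\<lambda>(c, a). frame d m s X Z a c)) $$ (a, b)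
        = dot d (frame d m s X Z a) (frame d m s X Z b)"
      using ab by (simp add: scalar_prod_def dot_def atLeast0LessThan)
    also have "\<dots> = (1\<^sub>m d) $$ (a, b)" using True ab by simp
    finally show "((mat d d (\<lambda>(c, a). frame d m s X Z a c))\<^sup>T * mat d d (\<lambda>(c, a). frame d m s X Z a c)) $$ (a, b) = (1\<^sub>m d) $$ (a, b)" .
  qed auto
  thus ?thesis using True unfolding frame_mat_def orthogonal_mats_def by simp
next
  case False
  thus ?thesis unfolding frame_mat_def orthogonal_mats_def by (simp only: if_False) simp
qed

lemma vnorm_nrm: "vnorm x = nrm (dim_vec x) (\<lambda>i. x $ i)"
  by (simp add: vnorm_def scalar_prod_def nrm_def dot_def atLeast0LessThan)

lemma vnorm_diff_mult:
  assumes "W \<in> carrier_mat d d"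
  shows "vnorm (y - W\<^sup>T *\<^sub>v vec d x) = nrm d (\<lambda>a. y $ a - (\<Sum>c<d. W $$ (c, a) * x c))"
proof -
  have "(W\<^sup>T *\<^sub>v vec d x) $ a = (\<Sum>c<d. W $$ (c, a) * x c)" if "a < d" for a
    using that assms by (simp add: scalar_prod_def atLeast0LessThan)
  moreover have dim: "dim_vec (W\<^sup>T *\<^sub>v vec d x) = d" "dim_vec (y - W\<^sup>T *\<^sub>v vec d x) = d" using assms by auto
  ultimately show ?thesis unfolding vnorm_nrm dim by (intro nrm_cong) (simp only: index_minus_vec dim)
qed

lemma vnorm_frame_mat:
  assumes "\<forall>a<d. \<forall>b<d. dot d (frame d m s X Z a) (frame d m s X Z b) = of_bool (a = b)"
    and Y: "Y \<in> carrier_mat u d" "v < u"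
  shows "vnorm (row Y v - (frame_mat d m s X Z)\<^sup>T *\<^sub>v vec d x) = nrm d (\<lambda>a. Y $$ (v, a) - dot d (frame d m s X Z a) x)"
proof -
  have W: "frame_mat d m s X Z \<in> carrier_mat d d"
    using frame_mat_orthogonal[of d m s X Z] by (simp add: orthogonal_mats_def)
  have Wi: "frame_mat d m s X Z $$ (c, a) = frame d m s X Z a c" if "c < d" "a < d" for c a
    unfolding frame_mat_def if_P[OF assms(1)] using that by simp
  show ?thesis
    unfolding vnorm_diff_mult[OF W] using Y by (intro nrm_cong) (simp add: Wi dot_def)
qed

lemma dot_measurable:
  assumes "\<And>c. c < d \<Longrightarrow> (\<lambda>\<omega>. f \<omega> c) \<in> borel_measurable M" "\<And>c. c < d \<Longrightarrow> (\<lambda>\<omega>. g \<omega> c) \<in> borel_measurable M"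
  shows "(\<lambda>\<omega>. dot d (f \<omega>) (g \<omega>)) \<in> borel_measurable M"
  unfolding dot_def using assms by (intro borel_measurable_sum borel_measurable_times) auto

lemma nrm_measurable:
  assumes "\<And>c. c < d \<Longrightarrow> (\<lambda>\<omega>. f \<omega> c) \<in> borel_measurable M"
  shows "(\<lambda>\<omega>. nrm d (f \<omega>)) \<in> borel_measurable M"
  unfolding nrm_def by (rule measurable_compose[OF dot_measurable[OF assms assms] borel_measurable_sqrt])

lemma gram_schmidt_vec_measurable:
  assumes "\<And>a c. c < d \<Longrightarrow> (\<lambda>\<omega>. h \<omega> a c) \<in> borel_measurable M"
  shows "c < d \<Longrightarrow> (\<lambda>\<omega>. gram_schmidt_vec d (h \<omega>) a c) \<in> borel_measurable M"
proof (induction a arbitrary: c rule: less_induct)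
  case (less a)
  have num: "(\<lambda>\<omega>. h \<omega> a c - (\<Sum>b<a. dot d (gram_schmidt_vec d (h \<omega>) b) (h \<omega> a) * gram_schmidt_vec d (h \<omega>) b c))
      \<in> borel_measurable M" if "c < d" for c
    using that by (intro borel_measurable_diff borel_measurable_sum borel_measurable_times dot_measurable less.IH assms) auto
  show ?case
    by (subst gram_schmidt_vec.simps) (intro borel_measurable_divide num less.prems nrm_measurable)
qed

lemma eventually_log_le_sqrt: "\<exists>s\<^sub>0. \<forall>s\<ge>s\<^sub>0. A * ln (real s) \<le> sqrt (real s)"
proof -
  have "((\<lambda>s::nat. ln (real s) / sqrt (real s)) \<longlongrightarrow> 0) at_top" by real_asymp
  hence "eventually (\<lambda>s::nat. ln (real s) / sqrt (real s) < 1 / (\<bar>A\<bar> + 1)) at_top"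
    by (rule order_tendstoD) simp
  hence "eventually (\<lambda>s::nat. A * ln (real s) \<le> sqrt (real s)) at_top"
    using eventually_gt_at_top[of 0]
  proof eventually_elim
    fix s :: nat assume s: "0 < s" and *: "ln (real s) / sqrt (real s) < 1 / (\<bar>A\<bar> + 1)"
    hence "(\<bar>A\<bar> + 1) * ln (real s) \<le> sqrt (real s)" by (simp add: field_simps)
    moreover have "A * ln (real s) \<le> (\<bar>A\<bar> + 1) * ln (real s)" using s by (intro mult_right_mono) auto
    ultimately show "A * ln (real s) \<le> sqrt (real s)" by linarith
  qed
  thus ?thesis by (simp add: eventually_at_top_linorder)
qed

lemma exp_neg_le:
  assumes "0 < (x :: real)"
  shows "exp (- x) \<le> 2 / x\<^sup>2"
proof -
  have "x\<^sup>2 / 2 \<le> exp x" using exp_lower_Taylor_quadratic[of x] assms by linarith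
  thus ?thesis using assms by (simp add: exp_minus field_simps)
qed

text \<open>The exponent 4 is what a union bound over order s^2 events needs in order to end at
  s^(-2).\<close>

lemma exp_neg_log_sq_le:
  assumes "1 \<le> ln (real s)" "0 < s"
  shows "exp (- 8 * (ln (real s))\<^sup>2) \<le> 1 / real s ^ 4"
proof -
  have "ln (real s) * 1 \<le> ln (real s) * ln (real s)" using assms by (intro mult_left_mono) auto
  hence "exp (- 8 * (ln (real s))\<^sup>2) \<le> exp (- (real 4 * ln (real s)))"
    using assms by (simp add: power2_eq_square)
  also have "\<dots> = 1 / real s ^ 4"
    using assms by (simp only: exp_minus exp_of_nat_mult exp_ln of_nat_0_less_iff) (simp add: inverse_eq_divide)
  finally show ?thesis .
qed

section \<open>Measurability of the aligning matrix and the probability of the out-of-sample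
  event\<close>

context
  fixes d :: nat and F :: "(nat \<Rightarrow> real) measure"
  assumes ipd: "inner_product_distribution d F"
begin

abbreviation sample_space :: "nat \<Rightarrow> sample measure" where
  "sample_space n \<equiv> count_space UNIV \<Otimes>\<^sub>M (\<Pi>\<^sub>M i\<in>{..<n}. F)"

text \<open>The edge factor carries the full power set as sigma-algebra. This covers
  \<open>ase\<close>, which is an arbitrary selection of eigenvectors.\<close>

lemma edge_function_measurable: "(\<lambda>\<omega>. (f (fst \<omega>) :: real)) \<in> borel_measurable (sample_space n)"
  by (rule measurable_compose[OF measurable_fst]) simp

lemma position_measurable:
  "p < n \<Longrightarrow> c < d \<Longrightarrow> (\<lambda>\<omega>. snd \<omega> p c) \<in> borel_measurable (sample_space n)"
  by (rule measurable_compose[OF measurable_snd latent_measurable[OF ipd]])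

lemma frame_measurable:
  assumes "s \<le> n" "c < d"
  shows "(\<lambda>\<omega>. frame d m s (snd \<omega>) (Z (fst \<omega>)) a c) \<in> borel_measurable (sample_space n)"
  unfolding frame_def
proof (rule gram_schmidt_vec_measurable[OF _ assms(2)])
  fix a c assume c: "c < d"
  have "(\<lambda>\<omega>. snd \<omega> (P mod s) c * (Z (fst \<omega>) $$ (P, a))) \<in> borel_measurable (sample_space n)" if "P < m * s" for P
  proof (intro borel_measurable_times position_measurable c)
    show "P mod s < n" using mod_div_less[OF that] assms by auto
    show "(\<lambda>\<omega>. Z (fst \<omega>) $$ (P, a)) \<in> borel_measurable (sample_space n)"
      by (rule edge_function_measurable[of "\<lambda>E. Z E $$ (P, a)"])
  qed
  moreover have den: "(\<lambda>\<omega>. \<Sum>P<m * s. (Z (fst \<omega>) $$ (P, a))\<^sup>2) \<in> borel_measurable (sample_space n)"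
    by (rule edge_function_measurable[of "\<lambda>E. \<Sum>P<m * s. (Z E $$ (P, a))\<^sup>2"])
  ultimately show "(\<lambda>\<omega>. frame_coeff m s (snd \<omega>) (Z (fst \<omega>)) a c) \<in> borel_measurable (sample_space n)"
    unfolding frame_coeff_def by (intro den borel_measurable_divide borel_measurable_sum) auto
qed

lemma frame_mat_measurable:
  assumes "s \<le> n" "a < d" "b < d"
  shows "(\<lambda>\<omega>. frame_mat d m s (snd \<omega>) (Z (fst \<omega>)) $$ (a, b)) \<in> borel_measurable (sample_space n)"
proof -
  let ?w = "\<lambda>\<omega>. frame d m s (snd \<omega>) (Z (fst \<omega>))"
  have 1: "{\<omega> \<in> space (sample_space n). dot d (?w \<omega> a) (?w \<omega> b) = of_bool (a = b)} \<in> sets (sample_space n)" for a b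
    by (intro borel_measurable_eq dot_measurable frame_measurable assms(1) borel_measurable_const)
  have "Measurable.pred (sample_space n) (\<lambda>\<omega>. \<forall>a\<in>{..<d}. \<forall>b\<in>{..<d}. dot d (?w \<omega> a) (?w \<omega> b) = of_bool (a = b))"
    unfolding pred_def by (intro sets.sets_Collect_finite_All 1) auto
  hence p: "Measurable.pred (sample_space n) (\<lambda>\<omega>. \<forall>a<d. \<forall>b<d. dot d (?w \<omega> a) (?w \<omega> b) = of_bool (a = b))"
    by (simp only: Ball_def lessThan_iff)
  have "(\<lambda>\<omega>. frame_mat d m s (snd \<omega>) (Z (fst \<omega>)) $$ (a, b))
      = (\<lambda>\<omega>. if \<forall>a<d. \<forall>b<d. dot d (?w \<omega> a) (?w \<omega> b) = of_bool (a = b) then ?w \<omega> b a else (1\<^sub>m d) $$ (a, b))"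
  proof
    fix \<omega>
    show "frame_mat d m s (snd \<omega>) (Z (fst \<omega>)) $$ (a, b)
        = (if \<forall>a<d. \<forall>b<d. dot d (?w \<omega> a) (?w \<omega> b) = of_bool (a = b) then ?w \<omega> b a else (1\<^sub>m d) $$ (a, b))"
    proof (cases "\<forall>a<d. \<forall>b<d. dot d (?w \<omega> a) (?w \<omega> b) = of_bool (a = b)")
      case True
      show ?thesis unfolding frame_mat_def if_P[OF True] using assms by simp
    next
      case False
      show ?thesis unfolding frame_mat_def if_not_P[OF False] ..
    qed
  qed
  also have "\<dots> \<in> borel_measurable (sample_space n)"
    by (intro measurable_If p[unfolded pred_def] frame_measurable assms borel_measurable_const)
  finally show ?thesis .
qed

text \<open>The dimension condition is part of the event because \<open>the (mat_inverse G)\<close> is an arbitrary matrix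
  of unknown size when \<open>G\<close> is singular.\<close>

definition oos_event where
  "oos_event n m s u ase Q i v \<epsilon> = {\<omega> \<in> space (JRDPG d F n m).
     (Q i)\<^sup>T * oos_embedding ase d m s (observed s u Q (fst \<omega>)) i \<in> carrier_mat u d \<and>
     vnorm (row ((Q i)\<^sup>T * oos_embedding ase d m s (observed s u Q (fst \<omega>)) i) v
       - (frame_mat d m s (snd \<omega>) (ase (omni_adj m s (fst \<omega>))))\<^sup>T *\<^sub>v vec d (snd \<omega> (s + v))) \<le> \<epsilon>}"

lemma JRDPG_measurable_eq: "borel_measurable (JRDPG d F n m) = borel_measurable (sample_space n)"
  by (rule measurable_cong_sets[OF sets_JRDPG[OF ipd] refl])

lemma vnorm_measurable:
  assumes "s \<le> n" "s + v < n"
  shows "(\<lambda>\<omega>. vnorm (y (fst \<omega>) - (frame_mat d m s (snd \<omega>) (Z (fst \<omega>)))\<^sup>T *\<^sub>v vec d (snd \<omega> (s + v))))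
    \<in> borel_measurable (JRDPG d F n m)"
proof -
  have W: "frame_mat d m s X Z \<in> carrier_mat d d" for X Z
    using frame_mat_orthogonal[of d m s X Z] by (simp add: orthogonal_mats_def)
  have y: "(\<lambda>\<omega>. y (fst \<omega>) $ a) \<in> borel_measurable (sample_space n)" for a
    by (rule edge_function_measurable[of "\<lambda>E. y E $ a"])
  show ?thesis
    unfolding JRDPG_measurable_eq vnorm_diff_mult[OF W]
    by (intro nrm_measurable borel_measurable_diff borel_measurable_sum borel_measurable_times y
        frame_mat_measurable position_measurable assms) auto
qed

lemma edge_event_measurable: "{\<omega> \<in> space (JRDPG d F n m). P (fst \<omega>)} \<in> sets (JRDPG d F n m)"
proof -
  have "Measurable.pred (sample_space n) (\<lambda>\<omega>. P (fst \<omega>))"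
    by (rule measurable_compose[OF measurable_fst]) simp
  thus ?thesis
    using sets_JRDPG[OF ipd, of n m] sets_eq_imp_space_eq[OF sets_JRDPG[OF ipd, of n m]] by (simp add: pred_def)
qed

lemma sets_oos_event:
  assumes "s \<le> n" "s + v < n"
  shows "oos_event n m s u ase Q i v \<epsilon> \<in> sets (JRDPG d F n m)"
  unfolding oos_event_def
  by (intro sets.sets_Collect_conj edge_event_measurable borel_measurable_le vnorm_measurable assms borel_measurable_const)

text \<open>The constants are fixed by \<mu>, by the Gram-Schmidt constants and by d and m, before
  u, the shuffling and the choice of eigenvectors enter.\<close>

lemma oos_event_probability:
  assumes dm: "0 < d" "0 < m" and rank: "vec_space.rank d (second_moment d F) = d"
  shows "\<exists>D>0. \<exists>D'>0. \<exists>s1. \<forall>s u Q ase i v. s1 \<le> s \<and> (\<forall>k<m. Q k \<in> perm_mats u) \<and> ASE_choice d ase \<and> i < m \<and> v < u \<longrightarrow>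
    1 - D' / (real s)\<^sup>2 \<le> measure (JRDPG d F (s + u) m)
      (oos_event (s + u) m s u ase Q i v (D * sqrt (real m) * ln (real (m * s)) / sqrt (real s)))"
proof -
  obtain \<mu> where \<mu>: "0 < \<mu>" "\<And>c. \<mu> * (nrm d c)\<^sup>2 \<le> (\<Sum>a<d. \<Sum>b<d. c a * c b * second_moment d F $$ (a, b))"
    using moment_lower[OF ipd rank] by blast
  obtain K \<eta>\<^sub>0 where K: "0 < K" "0 < \<eta>\<^sub>0" and gs: "gram_schmidt_modulus d d K \<eta>\<^sub>0"
    using gram_schmidt_modulus_exists by blast
  define g where "g = \<mu> / 2"
  have g: "0 < g" using \<mu> by (simp add: g_def)
  define D where "D = oos_const d m g K"
  have rc: "0 \<le> residual_const d m g" using g by (simp add: residual_const_def)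
  have ac: "0 \<le> alignment_const d m g K" using rc g K by (simp add: alignment_const_def)
  have D: "0 < D"
    unfolding D_def oos_const_def using dm g ac
    by (intro divide_pos_pos mult_pos_pos add_pos_nonneg mult_nonneg_nonneg) (auto simp: add_nonneg_pos)
  \<comment> \<open>The first summand pays for the Gram matrix, by exp(-x) \<le> 2 / x^2 with x = s
    \<mu>^2 / (8 d^2); the second is the union bound over edge events, of order s^2 times
    s^(-4).\<close>
  define D' where "D' = 256 * real d ^ 6 / \<mu> ^ 4 + 2 * (real m * d + m + d)"
  have D': "0 < D'" using dm \<mu> by (simp add: D'_def add_nonneg_pos)
  \<comment> \<open>The three conditions on large s, solved for sqrt(s) / log s. The constant 33 in
    place of 32 turns a weak inequality into the strict one required.\<close>
  define A1 where "A1 = 33 * real m ^ 4 / g\<^sup>2"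
  define A2 where "A2 = residual_const d m g / (\<eta>\<^sub>0 * sqrt (g / 2))"
  define A3 where "A3 = 2 * real d * alignment_const d m g K / sqrt g"
  have A: "0 \<le> A1" "0 \<le> A2" "0 \<le> A3" using rc ac g K by (auto simp: A1_def A2_def A3_def)
  obtain s\<^sub>0 where s\<^sub>0: "\<And>s. s\<^sub>0 \<le> s \<Longrightarrow> (A1 + A2 + A3) * ln (real s) \<le> sqrt (real s)"
    using eventually_log_le_sqrt by blast
  \<comment> \<open>From 3 on, ln s is at least 1; d guarantees as many seeds as dimensions.\<close>
  define s1 where "s1 = max (max 3 d) s\<^sub>0"
  have "1 - D' / (real s)\<^sup>2 \<le> measure (JRDPG d F (s + u) m)
      (oos_event (s + u) m s u ase Q i v (D * sqrt (real m) * ln (real (m * s)) / sqrt (real s)))"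
    if s: "s1 \<le> s" and Q: "\<forall>k<m. Q k \<in> perm_mats u" and ase: "ASE_choice d ase" and iv: "i < m" "v < u"
    for s u Q ase i v
  proof -
    define \<ll> where "\<ll> = ln (real s)"
    have s3: "3 \<le> s" "d \<le> s" "s\<^sub>0 \<le> s" using s by (auto simp: s1_def)
    have sr: "0 < real s" "0 < sqrt (real s)" "1 \<le> real s" using s3 by auto
    have ll: "1 \<le> \<ll>"
    proof -
      have "exp 1 \<le> real s" using exp_le s3(1) by linarith
      thus ?thesis unfolding \<ll>_def using sr by (subst ln_ge_iff) auto
    qed
    have AA: "A * \<ll> \<le> sqrt (real s)" if "A \<in> {A1, A2, A3}" for A
    proof -
      have "A * \<ll> \<le> (A1 + A2 + A3) * \<ll>" using that A ll by (intro mult_right_mono) auto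
      thus ?thesis using s\<^sub>0[OF s3(3)] by (simp add: \<ll>_def)
    qed
    have L1: "32 * real m ^ 4 * \<ll> < g\<^sup>2 * sqrt (real s)"
    proof -
      have "33 * real m ^ 4 * \<ll> \<le> g\<^sup>2 * sqrt (real s)"
        using AA[of A1] g by (simp add: A1_def field_simps)
      moreover have "0 < real m ^ 4 * \<ll>" using dm ll by simp
      ultimately show ?thesis by linarith
    qed
    have L2: "residual_const d m g * \<ll> \<le> \<eta>\<^sub>0 * sqrt (g / 2) * sqrt (real s)"
    proof -
      have "0 < \<eta>\<^sub>0 * sqrt (g / 2)" using g K by simp
      thus ?thesis using AA[of A2] by (simp add: A2_def pos_divide_le_eq mult.commute)
    qed
    have L3: "2 * real d * alignment_const d m g K * \<ll> \<le> sqrt g * sqrt (real s)"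
    proof -
      have "0 < sqrt g" using g by simp
      thus ?thesis using AA[of A3] by (simp add: A3_def pos_divide_le_eq mult.commute)
    qed
    let ?\<epsilon> = "D * sqrt (real m) * ln (real (m * s)) / sqrt (real s)"
    let ?B = "oos_event (s + u) m s u ase Q i v ?\<epsilon>"
    let ?e = "(real m * s * d + real m * s * s + d) * (2 * exp (- 8 * \<ll>\<^sup>2))"
    let ?\<delta> = "real d * d * (2 * exp (- (s * \<mu>\<^sup>2 / (8 * (real d)\<^sup>2))))"
    \<comment> \<open>The argument yields D log(s) / sqrt s with m absorbed in D; the prescribed
      form with sqrt m and log(m s) is larger since m \<ge> 1.\<close>
    have \<epsilon>: "D * (\<ll> / sqrt (real s)) \<le> ?\<epsilon>"
    proof -
      have m1: "1 \<le> sqrt (real m)" using dm by simp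
      have "ln (real s) \<le> ln (real (m * s))" using dm sr by (subst ln_le_cancel_iff) auto
      hence "1 * \<ll> \<le> sqrt (real m) * ln (real (m * s))"
        using m1 ll by (intro mult_mono) (auto simp: \<ll>_def)
      hence "D * \<ll> \<le> D * (sqrt (real m) * ln (real (m * s)))" using D by (intro mult_left_mono) auto
      thus ?thesis using sr by (simp add: divide_right_mono mult.assoc)
    qed
    have PE: "measure_pmf.prob (edge_pmf d (s + u) m X) {E. (E, X) \<notin> ?B} \<le> ?e" if X: "X \<in> good_latent d F (s + u) s \<mu>" for X
    proof -
      have Xs: "X \<in> space (\<Pi>\<^sub>M i\<in>{..<s + u}. F)" using X by (simp add: good_latent_def[OF ipd])
      have inner: "dot d (X p) (X q) \<in> {0..1}" if "p < s + u" "q < s + u" for p q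
        using X that unfolding good_latent_def[OF ipd] by blast
      have close: "\<bar>(\<Sum>p<s. X p a * X p b) - s * second_moment d F $$ (a, b)\<bar> \<le> s * (\<mu> / (2 * real d))" if "a < d" "b < d" for a b
        using X that unfolding good_latent_def[OF ipd] by blast
      have gram: "g * s * (nrm d c)\<^sup>2 \<le> (nrm s (mv d X c))\<^sup>2" for c
        unfolding g_def by (rule gram_from_moments[OF \<mu>(2) close \<mu>(1) dm(1)])
      have "{E. (E, X) \<notin> ?B} \<subseteq> {E. \<not> oos_good d m s u ase Q i v X (oos_const d m g K * (\<ll> / sqrt (real s))) E}"
      proof (intro Collect_mono impI notI)
        fix E assume nB: "(E, X) \<notin> ?B" and good: "oos_good d m s u ase Q i v X (oos_const d m g K * (\<ll> / sqrt (real s))) E"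
        let ?Y = "(Q i)\<^sup>T * oos_embedding ase d m s (observed s u Q E) i"
        have o: "\<forall>a<d. \<forall>b<d. dot d (frame d m s X (ase (omni_adj m s E)) a) (frame d m s X (ase (omni_adj m s E)) b) = of_bool (a = b)"
          and Y: "?Y \<in> carrier_mat u d"
          and n: "nrm d (\<lambda>a. ?Y $$ (v, a) - dot d (frame d m s X (ase (omni_adj m s E)) a) (X (s + v))) \<le> D * (\<ll> / sqrt (real s))"
          using good unfolding oos_good_def D_def by blast+
        have "vnorm (row ?Y v - (frame_mat d m s X (ase (omni_adj m s E)))\<^sup>T *\<^sub>v vec d (X (s + v))) \<le> ?\<epsilon>"
          unfolding vnorm_frame_mat[OF o Y iv(2)] using n \<epsilon> by linarith
        hence "(E, X) \<in> ?B" using Xs Y unfolding oos_event_def space_JRDPG[OF ipd] by simp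
        thus False using nB by blast
      qed
      hence "measure_pmf.prob (edge_pmf d (s + u) m X) {E. (E, X) \<notin> ?B}
          \<le> measure_pmf.prob (edge_pmf d (s + u) m X) {E. \<not> oos_good d m s u ase Q i v X (oos_const d m g K * (\<ll> / sqrt (real s))) E}"
        by (intro measure_pmf.finite_measure_mono) auto
      also have "\<dots> \<le> ?e"
        by (rule oos_conditional_probability[OF dm ll inner gram ase gs g K _ s3(2) L1 L2 L3])
           (use s3 Q iv in auto)
      finally show ?thesis .
    qed
    have "1 - ?\<delta> - ?e \<le> measure (JRDPG d F (s + u) m) ?B"
    proof (rule measure_JRDPG_ge[OF ipd _ _ _ _ PE])
      show "?B \<in> sets (JRDPG d F (s + u) m)" using iv by (intro sets_oos_event) auto
      show "good_latent d F (s + u) s \<mu> \<in> sets (\<Pi>\<^sub>M i\<in>{..<s + u}. F)" by (rule sets_good_latent[OF ipd]) simp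
      show "1 - ?\<delta> \<le> measure (\<Pi>\<^sub>M i\<in>{..<s + u}. F) (good_latent d F (s + u) s \<mu>)"
        using s3 dm \<mu> by (intro measure_good_latent[OF ipd]) auto
    qed auto
    moreover have "?\<delta> \<le> 256 * real d ^ 6 / \<mu> ^ 4 / (real s)\<^sup>2"
    proof -
      have "exp (- (s * \<mu>\<^sup>2 / (8 * (real d)\<^sup>2))) \<le> 2 / (s * \<mu>\<^sup>2 / (8 * (real d)\<^sup>2))\<^sup>2"
        using sr dm \<mu> by (intro exp_neg_le) simp
      hence "?\<delta> \<le> real d * d * (2 * (2 / (s * \<mu>\<^sup>2 / (8 * (real d)\<^sup>2))\<^sup>2))"
        by (intro mult_left_mono) auto
      also have "\<dots> = 256 * real d ^ 6 / \<mu> ^ 4 / (real s)\<^sup>2"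
        using sr dm \<mu> by (simp add: field_simps eval_nat_numeral)
      finally show ?thesis .
    qed
    moreover have "?e \<le> 2 * (real m * d + m + d) / (real s)\<^sup>2"
    proof -
      have "real m * s * d + real m * s * s + d \<le> (real m * d + m + d) * (real s * real s)"
      proof -
        have a: "1 * 1 \<le> real s * real s" using sr by (intro mult_mono) auto
        have b: "real s * 1 \<le> real s * real s" using sr by (intro mult_left_mono) auto
        have "real m * d * (real s * 1) \<le> real m * d * (real s * real s)" using b by (rule mult_left_mono) simp
        moreover have "real d * (1 * 1) \<le> real d * (real s * real s)" using a by (rule mult_left_mono) simp
        ultimately show ?thesis by (simp add: algebra_simps)
      qed
      hence "?e \<le> (real m * d + m + d) * (real s * real s) * (2 * (1 / real s ^ 4))"
        using exp_neg_log_sq_le[of s] ll s3 unfolding \<ll>_def by (intro mult_mono) auto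
      also have "\<dots> = 2 * (real m * d + m + d) / (real s)\<^sup>2"
        using sr by (simp add: field_simps eval_nat_numeral)
      finally show ?thesis .
    qed
    moreover have "D' / (real s)\<^sup>2 = 256 * real d ^ 6 / \<mu> ^ 4 / (real s)\<^sup>2 + 2 * (real m * d + m + d) / (real s)\<^sup>2"
      by (simp add: D'_def add_divide_distrib)
    ultimately show ?thesis by linarith
  qed
  thus ?thesis using D D' by blast
qed

text \<open>The event in \<open>OOS_bound\<close> lacks the dimension condition and so contains
  \<open>oos_event\<close>; being measurable, it has at least the same probability.\<close>

lemma OOS_bound_from_events:
  assumes "\<And>s u Q ase i v. s1 \<le> s \<Longrightarrow> (\<forall>k<m. Q k \<in> perm_mats u) \<Longrightarrow> ASE_choice d ase \<Longrightarrow> i < m \<Longrightarrow> v < u \<Longrightarrow>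
    1 - D' / (real s)\<^sup>2 \<le> measure (JRDPG d F (s + u) m)
      (oos_event (s + u) m s u ase Q i v (D * sqrt (real m) * ln (real (m * s)) / sqrt (real s)))"
  shows "OOS_bound d F m D D' s1"
  unfolding OOS_bound_def Let_def
proof (intro allI impI, elim conjE)
  fix s u Q ase
  assume s: "s1 \<le> s" and Q: "\<forall>k<m. Q k \<in> perm_mats u" and ase: "ASE_choice d ase"
  let ?J = "JRDPG d F (s + u) m"
  define W where "W = (\<lambda>\<omega> :: sample. frame_mat d m s (snd \<omega>) (ase (omni_adj m s (fst \<omega>))))"
  let ?\<epsilon> = "D * sqrt (real m) * ln (real (m * s)) / sqrt (real s)"
  interpret J: prob_space ?J by (rule prob_space_JRDPG[OF ipd])
  have "1 - D' / (real s)\<^sup>2 \<le> J.prob {\<omega> \<in> space ?J. case \<omega> of (E, X) \<Rightarrow>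
      vnorm (row ((Q i)\<^sup>T * oos_embedding ase d m s (observed s u Q E) i) v - (W \<omega>)\<^sup>T *\<^sub>v vec d (X (s + v))) \<le> ?\<epsilon>}"
    if iv: "i < m" "v < u" for i v
  proof -
    let ?n = "\<lambda>\<omega>. vnorm (row ((Q i)\<^sup>T * oos_embedding ase d m s (observed s u Q (fst \<omega>)) i) v
    - (frame_mat d m s (snd \<omega>) (ase (omni_adj m s (fst \<omega>))))\<^sup>T *\<^sub>v vec d (snd \<omega> (s + v)))"
    have eq: "{\<omega> \<in> space ?J. case \<omega> of (E, X) \<Rightarrow>
        vnorm (row ((Q i)\<^sup>T * oos_embedding ase d m s (observed s u Q E) i) v - (W \<omega>)\<^sup>T *\<^sub>v vec d (X (s + v))) \<le> ?\<epsilon>}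
      = {\<omega> \<in> space ?J. ?n \<omega> \<le> ?\<epsilon>}"
      by (simp add: W_def case_prod_unfold)
    have "J.prob (oos_event (s + u) m s u ase Q i v ?\<epsilon>) \<le> J.prob {\<omega> \<in> space ?J. ?n \<omega> \<le> ?\<epsilon>}"
    proof (rule J.finite_measure_mono)
      show "{\<omega> \<in> space ?J. ?n \<omega> \<le> ?\<epsilon>} \<in> sets ?J"
        using iv vnorm_measurable[of s "s + u" v "\<lambda>E. row ((Q i)\<^sup>T * oos_embedding ase d m s (observed s u Q E) i) v"
          m "\<lambda>E. ase (omni_adj m s E)"]
        by (intro borel_measurable_le borel_measurable_const) auto
    qed (auto simp: oos_event_def)
    thus ?thesis unfolding eq using assms[OF s Q ase iv] by linarith
  qed
  moreover have "(\<lambda>\<omega>. W \<omega> $$ (a, b)) \<in> borel_measurable ?J" if "a < d" "b < d" for a b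
    unfolding JRDPG_measurable_eq W_def using that by (intro frame_mat_measurable) auto
  ultimately show "\<exists>W. (\<forall>\<omega>\<in>space ?J. W \<omega> \<in> orthogonal_mats d) \<and>
      (\<forall>a<d. \<forall>b<d. (\<lambda>\<omega>. W \<omega> $$ (a, b)) \<in> borel_measurable ?J) \<and>
      (\<forall>v<u. \<forall>i<m. 1 - D' / (real s)\<^sup>2 \<le> J.prob {\<omega> \<in> space ?J. case \<omega> of (E, X) \<Rightarrow>
        vnorm (row ((Q i)\<^sup>T * oos_embedding ase d m s (observed s u Q E) i) v - (W \<omega>)\<^sup>T *\<^sub>v vec d (X (s + v))) \<le> ?\<epsilon>})"
    by (intro exI[of _ W]) (auto simp: W_def frame_mat_orthogonal)
qed

end

section \<open>Separation of latent positions\<close>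

context
  fixes d :: nat and F :: "(nat \<Rightarrow> real) measure"
  assumes ipd: "inner_product_distribution d F"
begin

lemma vnorm_vec_diff: "vnorm (vec d x - vec d y) = nrm d (\<lambda>a. x a - y a)"
  unfolding vnorm_nrm by (simp, intro nrm_cong) simp

lemma sets_Rd_ball: "Rd_ball d x r \<in> sets F"
proof -
  have "{y \<in> space F. nrm d (\<lambda>a. y a - x a) < r} \<in> sets F"
    by (intro borel_measurable_less nrm_measurable borel_measurable_diff coordinate_measurable[OF ipd] borel_measurable_const)
  thus ?thesis by (simp add: Rd_ball_def vnorm_vec_diff F_space[OF ipd])
qed

text \<open>The complement of the support is covered by countably many null balls with rational centres
  and radii.\<close>

lemma AE_support: "AE x in F. x \<in> Rd_support d F"
proof -
  interpret prob_space F by (rule F_prob[OF ipd])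
  define C where "C = {(q, \<rho>). q \<in> ({..<d} \<rightarrow>\<^sub>E \<rat>) \<and> \<rho> \<in> (\<rat> :: real set) \<and> measure F (Rd_ball d q \<rho>) = 0}"
  have "countable (({..<d} \<rightarrow>\<^sub>E \<rat>) \<times> (\<rat> :: real set))"
    by (intro countable_SIGMA countable_PiE countable_rat) auto
  hence C: "countable C" by (rule countable_subset[rotated]) (unfold C_def, blast)
  have null: "(\<Union>x\<in>C. Rd_ball d (fst x) (snd x)) \<in> null_sets F"
  proof (rule null_sets_UN'[OF C])
    fix x assume "x \<in> C"
    hence "measure F (Rd_ball d (fst x) (snd x)) = 0" unfolding C_def by (simp add: case_prod_unfold)
    thus "Rd_ball d (fst x) (snd x) \<in> null_sets F"
      unfolding null_sets_def by (simp add: emeasure_eq_measure sets_Rd_ball)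
  qed
  show ?thesis
  proof (rule AE_I'[OF null], intro subsetI)
    fix x assume "x \<in> {x \<in> space F. x \<notin> Rd_support d F}"
    hence xs: "x \<in> space (Rd d)" and "x \<notin> Rd_support d F" by (auto simp: F_space[OF ipd])
    then obtain r where r: "0 < r" "measure F (Rd_ball d x r) = 0"
      by (auto simp: Rd_support_def not_less) (metis measure_nonneg order_antisym)
    obtain \<rho> where \<rho>: "\<rho> \<in> \<rat>" "0 < \<rho>" "\<rho> < r / 2" using Rats_dense_in_real[of 0 "r / 2"] r by auto
    \<comment> \<open>Dividing by d + 1 keeps the sum of the d coordinate errors strictly below
      \<rho>, also for d = 0.\<close>
    define \<delta> where "\<delta> = \<rho> / (real d + 1)"
    have \<delta>: "0 < \<delta>" using \<rho> by (simp add: \<delta>_def)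
    have "\<forall>a. \<exists>q\<in>\<rat>. x a < q \<and> q < x a + \<delta>" using Rats_dense_in_real \<delta> by auto
    then obtain q' where q': "\<And>a. q' a \<in> \<rat>" "\<And>a. x a < q' a" "\<And>a. q' a < x a + \<delta>" by metis
    define q where "q = restrict q' {..<d}"
    have q: "q \<in> {..<d} \<rightarrow>\<^sub>E \<rat>" using q' by (auto simp: q_def)
    have "nrm d (\<lambda>a. x a - q a) \<le> (\<Sum>a<d. \<bar>x a - q a\<bar>)" by (rule nrm_le_sum_abs)
    also have "\<dots> \<le> (\<Sum>a<d. \<delta>)"
    proof (intro sum_mono)
      fix a assume "a \<in> {..<d}"
      thus "\<bar>x a - q a\<bar> \<le> \<delta>" using q'(2,3)[of a] by (simp add: q_def abs_le_iff)
    qed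
    also have "\<dots> < \<rho>" using \<rho> by (simp add: \<delta>_def field_simps)
    finally have xq: "nrm d (\<lambda>a. x a - q a) < \<rho>" .
    have "Rd_ball d q \<rho> \<subseteq> Rd_ball d x r"
    proof
      fix y assume "y \<in> Rd_ball d q \<rho>"
      hence y: "y \<in> space (Rd d)" "nrm d (\<lambda>a. y a - q a) < \<rho>" by (auto simp: Rd_ball_def vnorm_vec_diff)
      have "nrm d (\<lambda>a. y a - x a) \<le> nrm d (\<lambda>a. y a - q a) + nrm d (\<lambda>a. q a - x a)" by (rule nrm_triangle_diff)
      also have "\<dots> < r" using y xq \<rho> by (simp add: nrm_minus_commute[of d q x])
      finally show "y \<in> Rd_ball d x r" using y by (simp add: Rd_ball_def vnorm_vec_diff)
    qed
    hence "measure F (Rd_ball d q \<rho>) \<le> measure F (Rd_ball d x r)"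
      by (intro finite_measure_mono sets_Rd_ball)
    hence "measure F (Rd_ball d q \<rho>) = 0" using r by (simp add: measure_le_0_iff)
    hence "(q, \<rho>) \<in> C" using q \<rho> by (simp add: C_def)
    moreover have "x \<in> Rd_ball d q \<rho>" using xs xq by (simp add: Rd_ball_def vnorm_vec_diff)
    ultimately show "x \<in> (\<Union>x\<in>C. Rd_ball d (fst x) (snd x))" by force
  qed
qed

text \<open>Two positions are independent with law F. Fixing the first at x, the slice of the event
  is the ball of radius r about x, and almost every x lies in the support, where the ball bound
  holds.\<close>

lemma latent_close_probability:
  fixes n p q :: nat
  assumes ball: "\<And>x. x \<in> Rd_support d F \<Longrightarrow> measure F (Rd_ball d x r) \<le> b" and b: "0 \<le> b"
    and pq: "p < n" "q < n" "p \<noteq> q"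
  shows "{X \<in> space (\<Pi>\<^sub>M i\<in>{..<n}. F). nrm d (\<lambda>a. X p a - X q a) < r} \<in> sets (\<Pi>\<^sub>M i\<in>{..<n}. F)"
    and "measure (\<Pi>\<^sub>M i\<in>{..<n}. F) {X \<in> space (\<Pi>\<^sub>M i\<in>{..<n}. F). nrm d (\<lambda>a. X p a - X q a) < r} \<le> b"
proof -
  let ?P = "\<Pi>\<^sub>M i\<in>{..<n}. F"
  interpret F: prob_space F by (rule F_prob[OF ipd])
  interpret P: prob_space ?P by (rule prob_space_latent[OF ipd])
  show S: "{X \<in> space ?P. nrm d (\<lambda>a. X p a - X q a) < r} \<in> sets ?P"
    using pq by (intro borel_measurable_less nrm_measurable borel_measurable_diff latent_measurable[OF ipd] borel_measurable_const)
  have ind: "P.indep_vars (\<lambda>_. F) (\<lambda>p X. X p) {..<n}" using pq by (intro latent_indep[OF ipd]) auto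
  have "P.indep_var F ((\<lambda>f. f p) \<circ> (\<lambda>X. restrict (\<lambda>i. X i) {p})) F ((\<lambda>f. f q) \<circ> (\<lambda>X. restrict (\<lambda>i. X i) {q}))"
    using pq by (intro P.indep_var_compose[OF P.indep_var_restrict[OF ind]]) auto
  hence "P.indep_var F (\<lambda>X. X p) F (\<lambda>X. X q)" by (simp add: comp_def)
  hence joint: "distr ?P F (\<lambda>X. X p) \<Otimes>\<^sub>M distr ?P F (\<lambda>X. X q) = distr ?P (F \<Otimes>\<^sub>M F) (\<lambda>X. (X p, X q))"
    unfolding P.indep_var_distribution_eq by blast
  have comp: "distr ?P F (\<lambda>X. X i) = F" if "i < n" for i
    using that by (intro distr_PiM_component F_prob[OF ipd]) auto
  let ?T = "{z \<in> space (F \<Otimes>\<^sub>M F). nrm d (\<lambda>a. fst z a - snd z a) < r}"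
  have T: "?T \<in> sets (F \<Otimes>\<^sub>M F)"
    by (intro borel_measurable_less nrm_measurable borel_measurable_diff borel_measurable_const
        measurable_compose[OF measurable_fst coordinate_measurable[OF ipd]]
        measurable_compose[OF measurable_snd coordinate_measurable[OF ipd]])
  have mp: "(\<lambda>X. (X p, X q)) \<in> measurable ?P (F \<Otimes>\<^sub>M F)" using pq by (intro measurable_Pair) auto
  have "emeasure ?P {X \<in> space ?P. nrm d (\<lambda>a. X p a - X q a) < r} = emeasure (distr ?P (F \<Otimes>\<^sub>M F) (\<lambda>X. (X p, X q))) ?T"
    unfolding emeasure_distr[OF mp T]
    by (rule arg_cong[where f = "emeasure ?P"]) (use measurable_space[OF mp] in \<open>auto simp: space_pair_measure\<close>)
  also have "\<dots> = emeasure (F \<Otimes>\<^sub>M F) ?T"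
    unfolding joint[symmetric] comp[OF pq(1)] comp[OF pq(2)] ..
  also have "\<dots> = (\<integral>\<^sup>+x. emeasure F (Pair x -` ?T) \<partial>F)" by (rule F.emeasure_pair_measure_alt[OF T])
  also have "\<dots> \<le> (\<integral>\<^sup>+x. ennreal b \<partial>F)"
  proof (rule nn_integral_mono_AE)
    show "AE x in F. emeasure F (Pair x -` ?T) \<le> ennreal b"
      using AE_support
    proof eventually_elim
      fix x assume x: "x \<in> Rd_support d F"
      have "nrm d (\<lambda>a. x a - y a) = nrm d (\<lambda>a. y a - x a)" for y by (rule nrm_minus_commute)
      hence "Pair x -` ?T = Rd_ball d x r"
        using x by (auto simp: space_pair_measure F_space[OF ipd] Rd_ball_def Rd_support_def vnorm_vec_diff)
      thus "emeasure F (Pair x -` ?T) \<le> ennreal b"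
        using ball[OF x] by (simp add: F.emeasure_eq_measure ennreal_leI)
    qed
  qed
  also have "\<dots> = ennreal b" by (simp add: F.emeasure_space_1)
  finally show "P.prob {X \<in> space ?P. nrm d (\<lambda>a. X p a - X q a) < r} \<le> b"
    using b by (simp add: P.emeasure_eq_measure ennreal_le_iff)
qed

lemma JRDPG_latent_marginal:
  assumes G: "G \<in> sets (\<Pi>\<^sub>M i\<in>{..<n}. F)"
  shows "{\<omega> \<in> space (JRDPG d F n m). snd \<omega> \<in> G} \<in> sets (JRDPG d F n m)"
    and "measure (JRDPG d F n m) {\<omega> \<in> space (JRDPG d F n m). snd \<omega> \<in> G} = measure (\<Pi>\<^sub>M i\<in>{..<n}. F) G"
proof -
  let ?P = "\<Pi>\<^sub>M i\<in>{..<n}. F" and ?J = "JRDPG d F n m"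
  interpret P: prob_space ?P by (rule prob_space_latent[OF ipd])
  interpret J: prob_space ?J by (rule prob_space_JRDPG[OF ipd])
  have eq: "{\<omega> \<in> space ?J. snd \<omega> \<in> G} = UNIV \<times> G"
    using sets.sets_into_space[OF G] by (auto simp: space_JRDPG[OF ipd])
  show S: "{\<omega> \<in> space ?J. snd \<omega> \<in> G} \<in> sets ?J"
    unfolding eq sets_JRDPG[OF ipd] using G by (intro pair_measureI) auto
  have "emeasure ?J {\<omega> \<in> space ?J. snd \<omega> \<in> G}
      = (\<integral>\<^sup>+X. emeasure (measure_pmf (edge_pmf d n m X)) {E. (E, X) \<in> UNIV \<times> G} \<partial>?P)"
    unfolding eq by (rule emeasure_JRDPG[OF ipd S[unfolded eq]])
  also have "\<dots> = (\<integral>\<^sup>+X. indicator G X \<partial>?P)"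
    by (intro nn_integral_cong) (simp add: measure_pmf.emeasure_space_1[simplified] split: split_indicator)
  also have "\<dots> = emeasure ?P G" using G by simp
  finally show "J.prob {\<omega> \<in> space ?J. snd \<omega> \<in> G} = P.prob G"
    by (simp add: J.emeasure_eq_measure P.emeasure_eq_measure)
qed

end

section \<open>The assignment problem\<close>

definition perm_mat :: "nat \<Rightarrow> (nat \<Rightarrow> nat) \<Rightarrow> real mat" where
  "perm_mat u \<pi> = mat u u (\<lambda>(i, j). if \<pi> i = j then 1 else 0)"

lemma perm_mats_iff: "Q \<in> perm_mats u \<longleftrightarrow> (\<exists>\<pi>. \<pi> permutes {..<u} \<and> Q = perm_mat u \<pi>)"
  by (auto simp: perm_mats_def perm_mat_def)

lemma perm_mat_mult_transpose:
  assumes "\<pi> permutes {..<u}" "\<pi>' permutes {..<u}"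
  shows "perm_mat u \<pi>' * (perm_mat u \<pi>)\<^sup>T = perm_mat u (inv_into UNIV \<pi> \<circ> \<pi>')"
proof (rule eq_matI)
  fix q p assume "q < dim_row (perm_mat u (inv_into UNIV \<pi> \<circ> \<pi>'))" "p < dim_col (perm_mat u (inv_into UNIV \<pi> \<circ> \<pi>'))"
  hence qp: "q < u" "p < u" by (auto simp: perm_mat_def)
  have "(perm_mat u \<pi>' * (perm_mat u \<pi>)\<^sup>T) $$ (q, p) = (\<Sum>v<u. (if \<pi>' q = v then 1 else 0) * (if \<pi> p = v then 1 else 0))"
    using qp by (simp add: perm_mat_def scalar_prod_def atLeast0LessThan)
  also have "\<dots> = (\<Sum>v<u. if v = \<pi>' q then (if \<pi> p = \<pi>' q then 1 else 0) else 0)"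
    by (intro sum.cong) auto
  also have "\<dots> = (if \<pi> p = \<pi>' q then 1 else 0)"
    using permutes_in_image[OF assms(2), of q] qp by simp
  also have "\<dots> = (if inv_into UNIV \<pi> (\<pi>' q) = p then 1 else 0)"
    using permutes_inverses[OF assms(1)] by metis
  finally show "(perm_mat u \<pi>' * (perm_mat u \<pi>)\<^sup>T) $$ (q, p) = perm_mat u (inv_into UNIV \<pi> \<circ> \<pi>') $$ (q, p)"
    using qp by (simp add: perm_mat_def)
qed (auto simp: perm_mat_def)

lemma mtrace_perm_mat:
  assumes "\<rho> permutes {..<u}" "C \<in> carrier_mat u u"
  shows "mtrace (C * perm_mat u \<rho>) = (\<Sum>q<u. C $$ (\<rho> q, q))"
proof -
  have "mtrace (C * perm_mat u \<rho>) = (\<Sum>p<u. \<Sum>q<u. C $$ (p, q) * (if \<rho> q = p then 1 else 0))"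
    using assms(2) by (simp add: mtrace_def perm_mat_def scalar_prod_def atLeast0LessThan)
  also have "\<dots> = (\<Sum>q<u. \<Sum>p<u. if p = \<rho> q then C $$ (\<rho> q, q) else 0)"
    by (subst sum.swap) (intro sum.cong refl, auto)
  also have "\<dots> = (\<Sum>q<u. C $$ (\<rho> q, q))"
    using permutes_in_image[OF assms(1)] by (intro sum.cong) auto
  finally show ?thesis .
qed

text \<open>After relabelling by true vertices the correct assignment uses only diagonal costs. It
  is optimal term by term, with a strict gain at every wrongly matched index, so no rearrangement
  argument is involved.\<close>

lemma assignment_argmin_unique:
  assumes \<pi>: "\<pi> permutes {..<u}" "\<pi>' permutes {..<u}"
    and C: "C \<in> carrier_mat u u" "\<And>p q. p < u \<Longrightarrow> q < u \<Longrightarrow> C $$ (p, q) = K (\<pi> p) (\<pi>' q)"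
    and diag: "\<And>v. v < u \<Longrightarrow> K v v \<le> (\<theta> :: real)"
    and off: "\<And>v w. v < u \<Longrightarrow> w < u \<Longrightarrow> v \<noteq> w \<Longrightarrow> \<theta> < K v w"
  shows "assignment_argmin u C = {perm_mat u \<pi>' * (perm_mat u \<pi>)\<^sup>T}"
proof -
  \<comment> \<open>Column index q of the cost matrix stands for the true vertex \<pi>' q; its
    partner is the row index p with \<pi> p = \<pi>' q.\<close>
  define \<rho>\<^sub>0 where "\<rho>\<^sub>0 = inv_into UNIV \<pi> \<circ> \<pi>'"
  have \<rho>\<^sub>0: "\<rho>\<^sub>0 permutes {..<u}" unfolding \<rho>\<^sub>0_def by (intro permutes_compose permutes_inv \<pi>)
  have in_u: "\<rho> q < u" if "\<rho> permutes {..<u}" "q < u" for \<rho> q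
    using permutes_in_image[OF that(1), of q] that(2) by simp
  have \<pi>\<rho>\<^sub>0: "\<pi> (\<rho>\<^sub>0 q) = \<pi>' q" for q by (simp add: \<rho>\<^sub>0_def permutes_inverses[OF \<pi>(1)])
  have tr: "mtrace (C * perm_mat u \<rho>) = (\<Sum>q<u. K (\<pi> (\<rho> q)) (\<pi>' q))" if "\<rho> permutes {..<u}" for \<rho>
    unfolding mtrace_perm_mat[OF that C(1)] by (intro sum.cong refl C(2)) (auto simp: in_u that)
  have le: "K (\<pi> (\<rho>\<^sub>0 q)) (\<pi>' q) \<le> K (\<pi> (\<rho> q)) (\<pi>' q)"
    and less: "\<pi> (\<rho> q) \<noteq> \<pi>' q \<Longrightarrow> K (\<pi> (\<rho>\<^sub>0 q)) (\<pi>' q) < K (\<pi> (\<rho> q)) (\<pi>' q)"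
    if "\<rho> permutes {..<u}" "q < u" for \<rho> q
  proof -
    have q: "\<pi>' q < u" "\<pi> (\<rho> q) < u" using in_u[OF \<pi>(2) that(2)] in_u[OF \<pi>(1) in_u[OF that]] by blast+
    show less: "K (\<pi> (\<rho>\<^sub>0 q)) (\<pi>' q) < K (\<pi> (\<rho> q)) (\<pi>' q)" if "\<pi> (\<rho> q) \<noteq> \<pi>' q"
      unfolding \<pi>\<rho>\<^sub>0 using diag[OF q(1)] off[OF q(2,1) that] by linarith
    show "K (\<pi> (\<rho>\<^sub>0 q)) (\<pi>' q) \<le> K (\<pi> (\<rho> q)) (\<pi>' q)"
    proof (cases "\<pi> (\<rho> q) = \<pi>' q")
      case True
      thus ?thesis by (simp only: \<pi>\<rho>\<^sub>0 order_refl)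
    qed (rule less_imp_le, rule less)
  qed
  have min: "mtrace (C * perm_mat u \<rho>\<^sub>0) \<le> mtrace (C * perm_mat u \<rho>)" if "\<rho> permutes {..<u}" for \<rho>
    unfolding tr[OF \<rho>\<^sub>0] tr[OF that] by (intro sum_mono le that) auto
  have strict: "mtrace (C * perm_mat u \<rho>\<^sub>0) < mtrace (C * perm_mat u \<rho>)"
    if \<rho>: "\<rho> permutes {..<u}" and ne: "perm_mat u \<rho> \<noteq> perm_mat u \<rho>\<^sub>0" for \<rho>
  proof -
    have "\<exists>q<u. \<rho> q \<noteq> \<rho>\<^sub>0 q"
    proof (rule ccontr)
      assume "\<not> (\<exists>q<u. \<rho> q \<noteq> \<rho>\<^sub>0 q)"
      hence "perm_mat u \<rho> = perm_mat u \<rho>\<^sub>0" unfolding perm_mat_def by (intro eq_matI) auto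
      thus False using ne by simp
    qed
    then obtain q where q: "q < u" "\<rho> q \<noteq> \<rho>\<^sub>0 q" by blast
    have "\<pi> (\<rho> q) \<noteq> \<pi>' q" using q(2) permutes_inj[OF \<pi>(1)] \<pi>\<rho>\<^sub>0[of q] by (metis injD)
    thus ?thesis
      unfolding tr[OF \<rho>\<^sub>0] tr[OF \<rho>] using q \<rho> by (intro sum_strict_mono_ex1) (auto intro!: le less bexI[of _ q])
  qed
  show ?thesis
    unfolding perm_mat_mult_transpose[OF \<pi>] \<rho>\<^sub>0_def[symmetric]
  proof (intro equalityI subsetI)
    fix P assume "P \<in> assignment_argmin u C"
    then obtain \<rho> where \<rho>: "\<rho> permutes {..<u}" "P = perm_mat u \<rho>"
      and m: "\<not> (\<exists>Q. Q \<in> perm_mats u \<and> mtrace (C * Q) < mtrace (C * P))"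
      by (auto simp: assignment_argmin_def is_arg_min_def perm_mats_iff)
    have "perm_mat u \<rho>\<^sub>0 \<in> perm_mats u" using \<rho>\<^sub>0 by (auto simp: perm_mats_iff)
    thus "P \<in> {perm_mat u \<rho>\<^sub>0}" using strict[OF \<rho>(1)] m \<rho>(2) by blast
  next
    fix P assume "P \<in> {perm_mat u \<rho>\<^sub>0}"
    thus "P \<in> assignment_argmin u C"
      using \<rho>\<^sub>0 min by (auto simp: assignment_argmin_def is_arg_min_def perm_mats_iff not_less)
  qed
qed

text \<open>A correct match costs at most \<open>(2\<epsilon>)\<^sup>2\<close>, a wrong one more than \<open>(4\<epsilon> - 2\<epsilon>)\<^sup>2\<close>.\<close>

lemma perfect_alignment:
  assumes Q: "Qi \<in> perm_mats u" "Qj \<in> perm_mats u"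
    and O: "Oi \<in> carrier_mat u d" "Oj \<in> carrier_mat u d"
    and W: "W \<in> orthogonal_mats d"
    and close: "\<And>v. v < u \<Longrightarrow> vnorm (row (Qi\<^sup>T * Oi) v - W\<^sup>T *\<^sub>v vec d (x v)) \<le> \<epsilon>"
      "\<And>v. v < u \<Longrightarrow> vnorm (row (Qj\<^sup>T * Oj) v - W\<^sup>T *\<^sub>v vec d (x v)) \<le> \<epsilon>"
    and gap: "\<And>v w. v < u \<Longrightarrow> w < u \<Longrightarrow> v \<noteq> w \<Longrightarrow> 4 * \<epsilon> < nrm d (\<lambda>a. x v a - x w a)"
  shows "assignment_argmin u (mat u u (\<lambda>(v, w). (vnorm (row Oi v - row Oj w))\<^sup>2)) = {Qj * Qi\<^sup>T}"
proof -
  obtain \<pi> where \<pi>: "\<pi> permutes {..<u}" "Qi = perm_mat u \<pi>" using Q(1) by (auto simp: perm_mats_iff)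
  obtain \<pi>' where \<pi>': "\<pi>' permutes {..<u}" "Qj = perm_mat u \<pi>'" using Q(2) by (auto simp: perm_mats_iff)
  define y where "y = (\<lambda>(Qk, Ok) v a. (Qk\<^sup>T * Ok) $$ (v, a) :: real)"
  define x' where "x' = (\<lambda>v a. \<Sum>c<d. W $$ (c, a) * x v c)"
  define K where "K = (\<lambda>v w. (nrm d (\<lambda>a. y (Qi, Oi) v a - y (Qj, Oj) w a))\<^sup>2)"
  have Wc: "W \<in> carrier_mat d d" and WW: "W\<^sup>T * W = 1\<^sub>m d" using W by (auto simp: orthogonal_mats_def)
  \<comment> \<open>Row p of an observed embedding is row \<pi> p of the unshuffled one.\<close>
  have y: "Ok $$ (p, a) = y (Qk, Ok) (\<rho> p) a"
    if \<rho>: "\<rho> permutes {..<u}" "Qk = perm_mat u \<rho>" and Ok: "Ok \<in> carrier_mat u d" and pa: "p < u" "a < d" for Qk Ok \<rho> p a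
  proof -
    have "\<rho> p < u" using permutes_in_image[OF \<rho>(1), of p] pa by simp
    hence "y (Qk, Ok) (\<rho> p) a = (\<Sum>q<u. (if \<rho> q = \<rho> p then 1 else 0) * Ok $$ (q, a))"
      using pa Ok by (simp add: y_def \<rho>(2) perm_mat_def scalar_prod_def atLeast0LessThan)
    also have "\<dots> = (\<Sum>q<u. if q = p then Ok $$ (q, a) else 0)"
      using permutes_inj[OF \<rho>(1)] by (intro sum.cong) (auto simp: inj_eq)
    finally show ?thesis using pa by simp
  qed
  have near: "nrm d (\<lambda>a. y (Qk, Ok) v a - x' v a) \<le> \<epsilon>"
    if "Qk \<in> carrier_mat u u" "Ok \<in> carrier_mat u d" "v < u" "vnorm (row (Qk\<^sup>T * Ok) v - W\<^sup>T *\<^sub>v vec d (x v)) \<le> \<epsilon>" for Qk Ok v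
  proof -
    have "nrm d (\<lambda>a. y (Qk, Ok) v a - x' v a) = nrm d (\<lambda>a. row (Qk\<^sup>T * Ok) v $ a - (\<Sum>c<d. W $$ (c, a) * x v c))"
      using that by (intro nrm_cong) (simp add: y_def x'_def)
    thus ?thesis using that(4) unfolding vnorm_diff_mult[OF Wc] by simp
  qed
  \<comment> \<open>Here x' v = W^T x v is a combination of the rows of W. Orthogonality is given
    for its columns, and completeness transfers it to the rows.\<close>
  have isom: "nrm d (\<lambda>a. x' v a - x' w a) = nrm d (\<lambda>a. x v a - x w a)" for v w
  proof -
    have orth: "dot d (\<lambda>c. W $$ (a, c)) (\<lambda>c. W $$ (b, c)) = of_bool (a = b)" if "a < d" "b < d" for a b
    proof -
      have "dot d (\<lambda>c. W $$ (c, a)) (\<lambda>c. W $$ (c, b)) = of_bool (a = b)" if "a < d" "b < d" for a b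
      proof -
        have "(W\<^sup>T * W) $$ (a, b) = dot d (\<lambda>c. W $$ (c, a)) (\<lambda>c. W $$ (c, b))"
          using that Wc by (simp add: scalar_prod_def dot_def atLeast0LessThan)
        thus ?thesis using that unfolding WW by (cases "a = b") simp_all
      qed
      from orthonormal_complete[of d "\<lambda>a c. W $$ (c, a)", OF this that]
      show ?thesis by (simp add: dot_def)
    qed
    have "nrm d (\<lambda>a. x' v a - x' w a) = nrm d (\<lambda>a. \<Sum>c<d. (x v c - x w c) * W $$ (c, a))"
      by (intro nrm_cong) (simp add: x'_def sum_subtractf[symmetric] algebra_simps)
    also have "\<dots> = nrm d (\<lambda>a. x v a - x w a)"
      by (rule nrm_orthonormal_combination[where w = "\<lambda>c a. W $$ (c, a)"]) (rule orth)
    finally show ?thesis .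
  qed
  have ci: "nrm d (\<lambda>a. y (Qi, Oi) v a - x' v a) \<le> \<epsilon>" and cj: "nrm d (\<lambda>a. y (Qj, Oj) v a - x' v a) \<le> \<epsilon>" if "v < u" for v
    using near[OF perm_mats_carrier[OF Q(1)] O(1) that close(1)[OF that]]
      near[OF perm_mats_carrier[OF Q(2)] O(2) that close(2)[OF that]] by blast+
  show ?thesis
    unfolding \<pi>(2) \<pi>'(2)
  proof (rule assignment_argmin_unique[OF \<pi>(1) \<pi>'(1), where K = K and \<theta> = "(2 * \<epsilon>)\<^sup>2"])
    show "mat u u (\<lambda>(v, w). (vnorm (row Oi v - row Oj w))\<^sup>2) $$ (p, q) = K (\<pi> p) (\<pi>' q)" if pq: "p < u" "q < u" for p q
    proof -
      have "vnorm (row Oi p - row Oj q) = nrm d (\<lambda>a. Oi $$ (p, a) - Oj $$ (q, a))"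
        unfolding vnorm_nrm using pq O by (simp, intro nrm_cong) simp
      also have "\<dots> = nrm d (\<lambda>a. y (Qi, Oi) (\<pi> p) a - y (Qj, Oj) (\<pi>' q) a)"
        using pq by (intro nrm_cong) (simp only: y[OF \<pi> O(1)] y[OF \<pi>' O(2)])
      finally show ?thesis using pq by (simp add: K_def)
    qed
    show "K v v \<le> (2 * \<epsilon>)\<^sup>2" if "v < u" for v
    proof -
      have "nrm d (\<lambda>a. y (Qi, Oi) v a - y (Qj, Oj) v a) \<le> 2 * \<epsilon>"
        using nrm_triangle_diff[of d "y (Qi, Oi) v" "y (Qj, Oj) v" "x' v"] ci[OF that] cj[OF that]
          nrm_minus_commute[of d "y (Qj, Oj) v" "x' v"] by linarith
      thus ?thesis unfolding K_def by (intro power_mono) auto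
    qed
    show "(2 * \<epsilon>)\<^sup>2 < K v w" if "v < u" "w < u" "v \<noteq> w" for v w
    proof -
      have "nrm d (\<lambda>a. x' v a - x' w a) \<le> nrm d (\<lambda>a. x' v a - y (Qi, Oi) v a) + nrm d (\<lambda>a. y (Qi, Oi) v a - x' w a)"
        by (rule nrm_triangle_diff)
      moreover have "nrm d (\<lambda>a. y (Qi, Oi) v a - x' w a)
          \<le> nrm d (\<lambda>a. y (Qi, Oi) v a - y (Qj, Oj) w a) + nrm d (\<lambda>a. y (Qj, Oj) w a - x' w a)"
        by (rule nrm_triangle_diff)
      ultimately have "2 * \<epsilon> < nrm d (\<lambda>a. y (Qi, Oi) v a - y (Qj, Oj) w a)"
        using gap[OF that] ci[OF that(1)] cj[OF that(2)] nrm_minus_commute[of d "x' v" "y (Qi, Oi) v"]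
        unfolding isom by linarith
      moreover have "0 \<le> \<epsilon>" using ci[OF that(1)] nrm_nonneg order_trans by blast
      ultimately show ?thesis unfolding K_def by (intro power_strict_mono) auto
    qed
  qed simp
qed

text \<open>The row count is correct even if the Gram matrix is singular, as the inverse only
  affects columns; the column count has to come from the event.\<close>

lemma dim_row_oos_embedding:
  assumes "Q i \<in> perm_mats u"
  shows "dim_row (oos_embedding ase d m s (observed s u Q E) i) = u"
  unfolding oos_embedding_def Let_def cross_block_observed[of Q i u, OF assms]
  using perm_mats_carrier[OF assms] by simp

lemma sqrt_power_eq_powr:
  assumes "0 < (x :: real)"
  shows "sqrt x ^ d = x powr (real d / 2)"
proof -
  have "sqrt x ^ d = (x powr (1 / 2)) powr real d"
    using assms by (simp add: powr_half_sqrt powr_realpow)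
  thus ?thesis by (simp add: powr_powr)
qed

text \<open>D and D' are determined by the second moment of F, while c enters only through the
  separation of positions. Hence c may be quantified after D and D', and C = 1 serves every
  d.\<close>

theorem theorem1:
  shows "\<exists>C>0. \<forall>d m F. 0 < d \<and> 0 < m \<and> inner_product_distribution d F \<and> (\<exists>c. assumption1 d F c) \<longrightarrow>
    (\<exists>D>0. \<exists>D'>0. \<exists>s0::nat. 0 < s0 \<and> (\<exists>s1. OOS_bound d F m D D' s1) \<and>
      (\<forall>c s u Q ase. assumption1 d F c \<and> 0 < s \<and> 0 < u \<and> s0 \<le> s \<and>
          (\<forall>k<m. Q k \<in> perm_mats u) \<and> ASE_choice d ase \<longrightarrow>
        measure (JRDPG d F (s + u) m)
          {\<omega> \<in> space (JRDPG d F (s + u) m). case \<omega> of (E, X) \<Rightarrow>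
            \<forall>i<m. \<forall>j<m. assignment_argmin u (cost_mat ase d m s u (observed s u Q E) i j)
              = {Q j * (Q i)\<^sup>T}}
        \<ge> 1 - C * c * 10 ^ d * D ^ d * real m powr (real d / 2) * (real u)\<^sup>2
                * (ln (real (m * s)) ^ (2 * d) / real s powr (real d / 2))
            - D' * real m * real u / (real s)\<^sup>2))"
proof (rule exI[of _ 1], intro conjI allI impI, simp, goal_cases)
  case (1 d m F)
  hence A: "0 < d \<and> 0 < m \<and> inner_product_distribution d F \<and> (\<exists>c. assumption1 d F c)" .
  hence dm: "0 < d" "0 < m" and ipd: "inner_product_distribution d F"
    and rank: "vec_space.rank d (second_moment d F) = d" by (auto simp: assumption1_def)
  obtain D D' s1 where D: "0 < D" and D': "0 < D'" and oos: "\<forall>s u Q ase i v.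
      s1 \<le> s \<and> (\<forall>k<m. Q k \<in> perm_mats u) \<and> ASE_choice d ase \<and> i < m \<and> v < u \<longrightarrow>
      1 - D' / (real s)\<^sup>2 \<le> measure (JRDPG d F (s + u) m)
        (oos_event d F (s + u) m s u ase Q i v (D * sqrt (real m) * ln (real (m * s)) / sqrt (real s)))"
    using oos_event_probability[OF ipd dm rank] by blast
  have OOS: "OOS_bound d F m D D' s1"
    by (rule OOS_bound_from_events[OF ipd]) (use oos in blast)
  \<comment> \<open>The bound 3 ensures log(m s) \<ge> 1, which makes \<epsilon> positive and allows
    raising the power of the logarithm.\<close>
  define s0 where "s0 = max s1 3"
  have main: "1 - 1 * c * 10 ^ d * D ^ d * real m powr (real d / 2) * (real u)\<^sup>2
                * (ln (real (m * s)) ^ (2 * d) / real s powr (real d / 2))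
            - D' * real m * real u / (real s)\<^sup>2
      \<le> measure (JRDPG d F (s + u) m)
          {\<omega> \<in> space (JRDPG d F (s + u) m). case \<omega> of (E, X) \<Rightarrow>
            \<forall>i<m. \<forall>j<m. assignment_argmin u (cost_mat ase d m s u (observed s u Q E) i j)
              = {Q j * (Q i)\<^sup>T}}"
    if c: "assumption1 d F c" and s: "s0 \<le> s" and Q: "\<forall>k<m. Q k \<in> perm_mats u" and ase: "ASE_choice d ase"
    for c s u Q ase
  proof -
    let ?J = "JRDPG d F (s + u) m" and ?P = "\<Pi>\<^sub>M i\<in>{..<s + u}. F"
    interpret J: prob_space ?J by (rule prob_space_JRDPG[OF ipd])
    define L where "L = ln (real (m * s))"
    define \<epsilon> where "\<epsilon> = D * sqrt (real m) * L / sqrt (real s)"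
    \<comment> \<open>The radius 10 \<epsilon> exceeds the gap 4 \<epsilon> that the matching asks
      for; it produces exactly the factors 10^d and D^d of the claim, with C = 1.\<close>
    define b where "b = c * (10 * \<epsilon>) ^ d"
    have sr: "0 < real s" "s1 \<le> s" "3 \<le> s" using s by (auto simp: s0_def)
    have L1: "1 \<le> L"
    proof -
      have "exp 1 \<le> (3 :: real)" by (rule exp_le)
      also have "3 \<le> real (m * s)"
      proof -
        have "3 \<le> m * s" using sr dm mult_le_mono[of 1 m 3 s] by simp
        hence "real 3 \<le> real (m * s)" by (simp only: of_nat_le_iff)
        thus ?thesis by (simp only: of_nat_numeral)
      qed
      finally show ?thesis unfolding L_def using sr dm by (subst ln_ge_iff) auto
    qed
    have \<epsilon>0: "0 < \<epsilon>" using D dm sr L1 by (simp add: \<epsilon>_def)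
    have c0: "0 < c" and ball: "\<And>x r. x \<in> Rd_support d F \<Longrightarrow> 0 < r \<Longrightarrow> measure F (Rd_ball d x r) \<le> c * r ^ d"
      using c by (auto simp: assumption1_def)
    have b0: "0 \<le> b" using c0 \<epsilon>0 by (simp add: b_def)
    let ?Ev = "\<lambda>i v. oos_event d F (s + u) m s u ase Q i v \<epsilon>"
    let ?G = "\<lambda>v w. {X \<in> space ?P. nrm d (\<lambda>a. X (s + v) a - X (s + w) a) < 10 * \<epsilon>}"
    define Off where "Off = {(v, w). v < u \<and> w < u \<and> v \<noteq> w}"
    have Off_sub: "Off \<subseteq> {..<u} \<times> {..<u}" by (auto simp: Off_def)
    hence Off_fin: "finite Off" by (rule finite_subset) auto
    define B1 where "B1 = (\<Union>x\<in>{..<m} \<times> {..<u}. space ?J - ?Ev (fst x) (snd x))"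
    define B2 where "B2 = (\<Union>x\<in>Off. {\<omega> \<in> space ?J. snd \<omega> \<in> ?G (fst x) (snd x)})"
    have Ev: "?Ev i v \<in> sets ?J" if "v < u" for i v using that by (intro sets_oos_event[OF ipd]) auto
    have G: "?G v w \<in> sets ?P" "measure ?P (?G v w) \<le> b" if "(v, w) \<in> Off" for v w
    proof -
      have "s + v < s + u" "s + w < s + u" "s + v \<noteq> s + w" using that by (auto simp: Off_def)
      note * = latent_close_probability[OF ipd _ b0 this, of "10 * \<epsilon>"]
      have "measure F (Rd_ball d x (10 * \<epsilon>)) \<le> b" if "x \<in> Rd_support d F" for x
        unfolding b_def using ball[OF that, of "10 * \<epsilon>"] \<epsilon>0 by simp
      thus "?G v w \<in> sets ?P" "measure ?P (?G v w) \<le> b" using * by blast+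
    qed
    have B1: "B1 \<in> sets ?J" "J.prob B1 \<le> real m * u * (D' / (real s)\<^sup>2)"
    proof -
      show "B1 \<in> sets ?J" unfolding B1_def by (intro sets.finite_UN sets.Diff sets.top Ev) auto
      have "J.prob B1 \<le> (\<Sum>x\<in>{..<m} \<times> {..<u}. J.prob (space ?J - ?Ev (fst x) (snd x)))"
        unfolding B1_def by (intro measure_UNION_le sets.Diff sets.top Ev) auto
      also have "\<dots> \<le> (\<Sum>x\<in>{..<m} \<times> {..<u}. D' / (real s)\<^sup>2)"
      proof (intro sum_mono)
        fix x assume "x \<in> {..<m} \<times> {..<u}"
        hence x: "fst x < m" "snd x < u" by auto
        have "1 - D' / (real s)\<^sup>2 \<le> J.prob (?Ev (fst x) (snd x))"
          using oos sr(2) Q ase x unfolding \<epsilon>_def L_def by blast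
        thus "J.prob (space ?J - ?Ev (fst x) (snd x)) \<le> D' / (real s)\<^sup>2"
          using J.prob_compl[OF Ev[OF x(2), of "fst x"]] by linarith
      qed
      finally show "J.prob B1 \<le> real m * u * (D' / (real s)\<^sup>2)" by simp
    qed
    have B2: "B2 \<in> sets ?J" "J.prob B2 \<le> (real u)\<^sup>2 * b"
    proof -
      have S: "{\<omega> \<in> space ?J. snd \<omega> \<in> ?G (fst x) (snd x)} \<in> sets ?J"
        and Pr: "J.prob {\<omega> \<in> space ?J. snd \<omega> \<in> ?G (fst x) (snd x)} \<le> b" if "x \<in> Off" for x
        using JRDPG_latent_marginal[OF ipd G(1)[of "fst x" "snd x"]] G(2)[of "fst x" "snd x"] that by auto
      show "B2 \<in> sets ?J" unfolding B2_def by (intro sets.finite_UN Off_fin S)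
      have "J.prob B2 \<le> (\<Sum>x\<in>Off. J.prob {\<omega> \<in> space ?J. snd \<omega> \<in> ?G (fst x) (snd x)})"
        unfolding B2_def by (intro measure_UNION_le Off_fin S)
      also have "\<dots> \<le> (\<Sum>x\<in>Off. b)" by (intro sum_mono Pr)
      also have "\<dots> \<le> (\<Sum>x\<in>{..<u} \<times> {..<u}. b)" using Off_sub b0 by (intro sum_mono2) auto
      finally show "J.prob B2 \<le> (real u)\<^sup>2 * b" by (simp add: power2_eq_square)
    qed
    define good where "good = (\<lambda>E. \<forall>i<m. \<forall>j<m.
      assignment_argmin u (cost_mat ase d m s u (observed s u Q E) i j) = {Q j * (Q i)\<^sup>T})"
    define T where "T = {\<omega> \<in> space ?J. good (fst \<omega>)}"
    have T: "T \<in> sets ?J" unfolding T_def by (rule edge_event_measurable[OF ipd])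
    have sub: "space ?J - (B1 \<union> B2) \<subseteq> T"
    proof
      fix \<omega> assume \<omega>: "\<omega> \<in> space ?J - (B1 \<union> B2)"
      obtain E X where \<omega>E: "\<omega> = (E, X)" using surj_pair[of \<omega>] by blast
      have Xs: "X \<in> space ?P" using \<omega> by (simp add: \<omega>E space_JRDPG[OF ipd])
      let ?O = "\<lambda>i. oos_embedding ase d m s (observed s u Q E) i"
      let ?W = "frame_mat d m s X (ase (omni_adj m s E))"
      have ev: "(Q i)\<^sup>T * ?O i \<in> carrier_mat u d"
        "vnorm (row ((Q i)\<^sup>T * ?O i) v - ?W\<^sup>T *\<^sub>v vec d (X (s + v))) \<le> \<epsilon>" if "i < m" "v < u" for i v
      proof -
        have "\<omega> \<in> ?Ev i v" using \<omega> that unfolding B1_def by force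
        thus "(Q i)\<^sup>T * ?O i \<in> carrier_mat u d"
          "vnorm (row ((Q i)\<^sup>T * ?O i) v - ?W\<^sup>T *\<^sub>v vec d (X (s + v))) \<le> \<epsilon>"
          by (auto simp: oos_event_def[OF ipd] \<omega>E)
      qed
      have gap: "4 * \<epsilon> < nrm d (\<lambda>a. X (s + v) a - X (s + w) a)" if "v < u" "w < u" "v \<noteq> w" for v w
      proof -
        have "(v, w) \<in> Off" using that by (simp add: Off_def)
        hence "X \<notin> ?G v w" using \<omega> unfolding B2_def \<omega>E by force
        thus ?thesis using Xs \<epsilon>0 by auto
      qed
      have "assignment_argmin u (cost_mat ase d m s u (observed s u Q E) i j) = {Q j * (Q i)\<^sup>T}" if ij: "i < m" "j < m" for i j
      \<comment> \<open>The shape of the embedding is read off from an event at vertex 0, which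
        exists when u > 0. For u = 0 there is just one permutation matrix.\<close>
      proof (cases "u = 0")
        case True
        hence "perm_mats u = {Q j * (Q i)\<^sup>T}"
          using Q ij perm_mats_carrier[of _ u] by (auto simp: perm_mats_iff perm_mat_def intro!: eq_matI exI[of _ id])
        thus ?thesis by (auto simp: assignment_argmin_def is_arg_min_def)
      next
        case False
        have O: "?O k \<in> carrier_mat u d" if "k < m" for k
          using carrier_matD(2)[OF ev(1)[of k 0]] False that dim_row_oos_embedding[of Q k u ase d m s E] Q
          by (intro carrier_matI) auto
        show ?thesis
          unfolding cost_mat_def
          by (rule perfect_alignment[OF _ _ O O frame_mat_orthogonal ev(2) ev(2) gap]) (use Q ij in auto)
      qed
      thus "\<omega> \<in> T" using \<omega> unfolding T_def good_def \<omega>E by simp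
    qed
    have "1 - J.prob (B1 \<union> B2) = J.prob (space ?J - (B1 \<union> B2))"
      using J.prob_compl[of "B1 \<union> B2"] B1(1) B2(1) by simp
    also have "\<dots> \<le> J.prob T" using sub T by (intro J.finite_measure_mono)
    finally have 1: "1 - J.prob (B1 \<union> B2) \<le> J.prob T" .
    have 2: "J.prob (B1 \<union> B2) \<le> real m * u * (D' / (real s)\<^sup>2) + (real u)\<^sup>2 * b"
      using measure_Un_le[OF B1(1) B2(1)] B1(2) B2(2) by linarith
    have 3: "(real u)\<^sup>2 * b \<le> 1 * c * 10 ^ d * D ^ d * real m powr (real d / 2) * (real u)\<^sup>2
        * (L ^ (2 * d) / real s powr (real d / 2))"
    proof -
      have "b = c * (10 ^ d * D ^ d * sqrt (real m) ^ d * (L ^ d / sqrt (real s) ^ d))"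
        by (simp add: b_def \<epsilon>_def power_mult_distrib power_divide)
      also have "\<dots> = c * (10 ^ d * D ^ d * real m powr (real d / 2) * (L ^ d / real s powr (real d / 2)))"
        using dm sr by (simp add: sqrt_power_eq_powr)
      \<comment> \<open>The small balls give log^d; since the logarithm is at least 1, this is below
        the stated log^(2d).\<close>
      also have "\<dots> \<le> c * (10 ^ d * D ^ d * real m powr (real d / 2) * (L ^ (2 * d) / real s powr (real d / 2)))"
        using c0 D L1 by (intro mult_left_mono divide_right_mono power_increasing) auto
      finally have "(real u)\<^sup>2 * b \<le> (real u)\<^sup>2 * (c * (10 ^ d * D ^ d * real m powr (real d / 2) * (L ^ (2 * d) / real s powr (real d / 2))))"
        by (intro mult_left_mono) auto
      thus ?thesis by (simp add: ac_simps)
    qed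
    have T_eq: "{\<omega> \<in> space ?J. case \<omega> of (E, X) \<Rightarrow> \<forall>i<m. \<forall>j<m.
        assignment_argmin u (cost_mat ase d m s u (observed s u Q E) i j) = {Q j * (Q i)\<^sup>T}} = T"
      unfolding T_def good_def by (simp add: case_prod_unfold)
    have 4: "D' * real m * real u / (real s)\<^sup>2 = real m * u * (D' / (real s)\<^sup>2)" by simp
    show ?thesis unfolding T_eq L_def[symmetric] 4 using 1 2 3 by linarith
  qed
  show ?case
  proof (rule exI[of _ D], rule conjI[OF D], rule exI[of _ D'], rule conjI[OF D'], rule exI[of _ s0], intro conjI)
    show "0 < s0" by (simp add: s0_def)
    show "\<exists>s1. OOS_bound d F m D D' s1" using OOS by blast
  qed (intro allI impI, elim conjE, rule main)
qed

end
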